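(* Let $K$ be an infinite field, let $n\ge 1$ and let $B=(\mu_1,\ldots,\mu_t)$ be a partition of $n$. Let $(\tilde i,\tilde\epsilon)$ be an admissible pair at which the maximum $\omega_1$ is attained, and let $\widehat B$ be the corresponding partition of $n-\omega_1$ (all as defined in the context). Let $Q(\widehat B)=(\widehat\omega_1,\widehat\omega_2,\ldots,\widehat\omega_{\hat z})$. Then the maximum partition which is associated to elements of $\mathcal N_B$ is $(\omega_1,\widehat\omega_1,\widehat\omega_2,\ldots,\widehat\omega_{\hat z})$, that is $$Q(B)=(\omega_1,Q(\widehat B)).$$
   Context: The partition associated to a nilpotent matrix is the non-increasing list of the orders of its Jordan blocks; nilpotent $\mathrm{GL}(n,K)$-orbits of $n\times n$ nilpotent matrices are identified with partitions of $n$. Partitions of $n$ are ordered by $B\le B'$ iff $\operatorname{rank}J^m\le \operatorname{rank}(J')^m$ for all $m$, where $J,J'$ are nilpotent matrices with partitions $B,B'$; equivalently $\sum_{i=1}^l\mu_i\le\sum_{i=1}^l\mu'_i$ for all $l$ (parts extended by $0$). For a partition $B=(\mu_1\ge\cdots\ge\mu_t\geq 1)$ of $n$, $J$ is the nilpotent matrix in Jordan canonical form with Jordan blocks of orders $\mu_1,\ldots,\mu_t$, and $\mathcal N_B$ is the set of all nilpotent $n\times n$ matrices over $K$ commuting with $J$. The partitions of the elements of $\mathcal N_B$ have a maximum with respect to $\le$ (this is known); it is denoted $Q(B)$. For the empty partition (of $0$), $Q$ is empty. Let $0=q_0<q_1<\cdots<q_u=t$ be such that $\mu_1=\mu_{q_1}\ne\mu_{q_1+1}=\mu_{q_2}\neq\mu_{q_2+1}=\cdots\neq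 \mu_{q_{u-1}+1}=\mu_{q_u}$; thus the distinct parts of $B$ are $\mu_{q_1}>\cdots>\mu_{q_u}$ and $\mu_{q_i}$ has multiplicity $q_i-q_{i-1}$. Call a pair $(i,\epsilon)\in\{1,\ldots,u\}\times\{0,1\}$ admissible if $i+\epsilon\le u$ and $\mu_{q_i}-\mu_{q_{i+\epsilon}}\le 1$. Let $\omega_1$ be the maximum, over the admissible pairs $(i,\epsilon)$, of $$2q_{i-1}+\mu_{q_i}(q_i-q_{i-1})+\epsilon\,\mu_{q_{i+1}}(q_{i+1}-q_i),$$ and let $(\tilde i,\tilde\epsilon)$ be an admissible pair at which it is attained. The partition $\widehat B$ is obtained from $B$ by deleting all the parts equal to $\mu_{q_i}$ for $i=\tilde i$ and $i=\tilde i+\tilde\epsilon$, and decreasing by $2$ all the parts equal to $\mu_{q_i}$ for $i=1,\ldots,\tilde i-1$, that is (exponents being multiplicities) $$\widehat B=\big((\mu_{q_1}-2)^{q_1},\ldots,(\mu_{q_{\tilde i-1}}-2)^{q_{\tilde i-1}-q_{\tilde i-2}},\mu_{q_{\tilde i+\tilde\epsilon+1}}^{q_{\tilde i+\tilde\epsilon+1}-q_{\tilde i+\tilde\epsilon}},\ldots,\mu_{q_u}^{q_u-q_{u-1}}\big),$$ parts equal to $0$ being omitted. *)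

theory Defs
  imports
    "Jordan_Normal_Form.Jordan_Normal_Form"
    "Jordan_Normal_Form.Jordan_Normal_Form_Uniqueness"
    "Jordan_Normal_Form.DL_Rank"
begin

section \<open>Partitions and nilpotent matrices\<close>

definition is_partition :: "nat \<Rightarrow> nat list \<Rightarrow> bool" where
  "is_partition n \<mu> \<longleftrightarrow> sorted_wrt (\<ge>) \<mu> \<and> (\<forall>x \<in> set \<mu>. 1 \<le> x) \<and> sum_list \<mu> = n"

definition nilpotent_jordan :: "nat list \<Rightarrow> 'a :: field mat" where
  "nilpotent_jordan \<mu> = jordan_matrix (map (\<lambda>k. (k, 0)) \<mu>)"

definition nilpotent_mat :: "nat \<Rightarrow> 'a :: field mat \<Rightarrow> bool" where
  "nilpotent_mat n A \<longleftrightarrow> A \<in> carrier_mat n n \<and> (\<exists>k. A ^\<^sub>m k = 0\<^sub>m n n)"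

definition has_partition :: "'a :: field mat \<Rightarrow> nat list \<Rightarrow> bool" where
  "has_partition A p \<longleftrightarrow> sorted_wrt (\<ge>) p \<and> jordan_nf A (map (\<lambda>k. (k, 0)) p)"

text \<open>The order on partitions, defined by the ranks of powers. The argument of type
  \<open>'a itself\<close>, here and below, only fixes the ground field.\<close>

definition partition_le :: "'a :: field itself \<Rightarrow> nat list \<Rightarrow> nat list \<Rightarrow> bool" where
  "partition_le K B B' \<longleftrightarrow>
     (\<forall>m. vec_space.rank (sum_list B) ((nilpotent_jordan B :: 'a mat) ^\<^sub>m m)
        \<le> vec_space.rank (sum_list B') ((nilpotent_jordan B' :: 'a mat) ^\<^sub>m m))"

definition nilpotent_commutator :: "nat list \<Rightarrow> 'a :: field mat set" where
  "nilpotent_commutator B =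
     {A. nilpotent_mat (sum_list B) A \<and> A * nilpotent_jordan B = nilpotent_jordan B * A}"

definition commuting_partitions :: "'a :: field itself \<Rightarrow> nat list \<Rightarrow> nat list set" where
  "commuting_partitions K B =
     {p. \<exists>A \<in> (nilpotent_commutator B :: 'a mat set). has_partition A p}"

definition is_max_partition :: "'a :: field itself \<Rightarrow> nat list \<Rightarrow> nat list \<Rightarrow> bool" where
  "is_max_partition K B P \<longleftrightarrow>
     P \<in> commuting_partitions K B \<and> (\<forall>p \<in> commuting_partitions K B. partition_le K p P)"

definition Q :: "'a :: field itself \<Rightarrow> nat list \<Rightarrow> nat list" where
  "Q K B = (THE P. is_max_partition K B P)"


section \<open>Distinct parts, admissible pairs and the reduced partition\<close>

text \<open>Parts are numbered from \<open>1\<close>, so \<open>part \<mu> j\<close> is \<open>\<mu>\<^sub>j\<close>; it is \<open>0\<close> beyond the length.\<close>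

definition part :: "nat list \<Rightarrow> nat \<Rightarrow> nat" where
  "part \<mu> j = (if 1 \<le> j \<and> j \<le> length \<mu> then \<mu> ! (j - 1) else 0)"

text \<open>The values \<open>q 0 < q 1 < \<dots> < q u\<close> are determined by \<open>\<mu>\<close>; those of \<open>q\<close> beyond \<open>u\<close> are
  irrelevant.\<close>

definition block_ends :: "nat list \<Rightarrow> nat \<Rightarrow> (nat \<Rightarrow> nat) \<Rightarrow> bool" where
  "block_ends \<mu> u q \<longleftrightarrow>
     q 0 = 0 \<and> (\<forall>i<u. q i < q (i + 1)) \<and> q u = length \<mu> \<and>
     (\<forall>i \<in> {1..u}. \<forall>j \<in> {q (i - 1) + 1..q i}. part \<mu> j = part \<mu> (q i)) \<and>
     (\<forall>i \<in> {1..<u}. part \<mu> (q i) \<noteq> part \<mu> (q i + 1))"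

text \<open>The truncated subtraction is harmless since the parts are non-increasing.\<close>

definition admissible :: "nat list \<Rightarrow> nat \<Rightarrow> (nat \<Rightarrow> nat) \<Rightarrow> (nat \<times> nat) set" where
  "admissible \<mu> u q =
     {(i, \<epsilon>). i \<in> {1..u} \<and> \<epsilon> \<in> {0, 1} \<and> i + \<epsilon> \<le> u \<and> part \<mu> (q i) - part \<mu> (q (i + \<epsilon>)) \<le> 1}"

definition pair_weight :: "nat list \<Rightarrow> (nat \<Rightarrow> nat) \<Rightarrow> nat \<Rightarrow> nat \<Rightarrow> nat" where
  "pair_weight \<mu> q i \<epsilon> =
     2 * q (i - 1) + part \<mu> (q i) * (q i - q (i - 1))
       + \<epsilon> * part \<mu> (q (i + 1)) * (q (i + 1) - q i)"

definition omega1 :: "nat list \<Rightarrow> nat \<Rightarrow> (nat \<Rightarrow> nat) \<Rightarrow> nat" where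
  "omega1 \<mu> u q = Max ((\<lambda>(i, \<epsilon>). pair_weight \<mu> q i \<epsilon>) ` admissible \<mu> u q)"

definition hat :: "nat list \<Rightarrow> nat \<Rightarrow> (nat \<Rightarrow> nat) \<Rightarrow> nat \<Rightarrow> nat \<Rightarrow> nat list" where
  "hat \<mu> u q i \<epsilon> = filter (\<lambda>x. 0 < x)
     (concat (map (\<lambda>j. replicate (q j - q (j - 1)) (part \<mu> (q j) - 2)) [1..<i])
      @ concat (map (\<lambda>j. replicate (q j - q (j - 1)) (part \<mu> (q j))) [i + \<epsilon> + 1..<u + 1]))"

end

theory Submission
  imports Defs "HOL-Combinatorics.Cycles" "Jordan_Normal_Form.Jordan_Normal_Form_Existence"
begin

text \<open>The rank of the \<open>m\<close>-th power of a nilpotent matrix with partition \<open>p\<close> is the sum of the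
  truncated differences \<open>x - m\<close> over the parts \<open>x\<close>, and these ranks determine \<open>p\<close>. For a
  configuration \<open>ss\<close> of \<open>k\<close> paths of total size \<open>F\<close> consider \<open>F - k * m\<close>, and let \<open>G m\<close> be the
  maximum over all configurations.

  No matrix \<open>A\<close> commuting with \<open>J\<close> has rank of \<open>A ^ m\<close> above \<open>G m\<close>: after a change of basis \<open>A\<close> is
  strictly increasing for a partial order on the basis, Greene--Kleitman duality bounds the rank
  by \<open>card X - k * m\<close> for a set \<open>X\<close> of width at most \<open>k\<close>, and averaging over rays in the quadrant shows
  that \<open>X\<close> is not larger than some configuration of \<open>k\<close> paths. Conversely, for every configuration
  a one-parameter family of commuting matrices degenerates, after conjugation, to the partial
  permutation along its paths, so that \<open>F - k * m\<close> is attained; over an infinite field a generic matrix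
  attains \<open>G m\<close> for all \<open>m\<close> at once.

  Finally, \<open>\<omega>\<^sub>1\<close> is the largest size of a single path, and by an exchange argument some optimal
  configuration contains this path; removing it leaves a configuration of the reduced partition.
  Hence \<open>G m\<close> is the sum of the truncated difference \<open>\<omega>\<^sub>1 - m\<close> and of the maximum for the
  reduced partition, which is the claim in terms of ranks.\<close>

text \<open>Ranks are handled as sizes of nonvanishing minors (\<open>has_minor\<close>). A
  factorization bounds such a size from above, and for a matrix depending polynomially on a
  parameter a minor that survives at one value survives at all but finitely many. The latter is
  needed because the partial permutation along the paths does not commute with the Jordan matrix in
  general: it is only visible at the parameter value 0 of a family whose other values are similar to
  commuting matrices. The obstacle to the upper bound is that commutation confines the nonzero
  entries to a relation that is not strict: between blocks of equal order the constant coefficients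
  are free, and nilpotency of \<open>A\<close> makes them nilpotent but not triangular. Hence the
  change of basis. A second obstacle is that the duality supplies a set of bounded width but of any
  shape, possibly different in blocks of equal order, whereas a configuration treats every block by
  thresholds on its order alone; the averaging bridges this gap.\<close>

section \<open>Configurations\<close>

text \<open>A configuration is a weakly increasing list \<open>ss\<close>. Its entry \<open>s\<close> at index \<open>i\<close> stands for a path through
  all basis vectors of the blocks of orders \<open>s + 2 * i\<close> and \<open>s + 2 * i + 1\<close> that the earlier paths have
  left, and through one more basis vector at each end of every larger block. These paths cover
  \<open>level_weight ss x\<close> vectors of a block of order \<open>x\<close>.\<close>

fun level_weight :: "nat list \<Rightarrow> nat \<Rightarrow> nat" where
  "level_weight [] x = 0"
| "level_weight (s # ss) x =
     (if x < s then 0 else if x \<le> s + 1 then x else 2 + level_weight ss (x - 2))"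

definition config_weight :: "nat list \<Rightarrow> nat list \<Rightarrow> nat" where
  "config_weight B ss = (\<Sum>x\<leftarrow>B. level_weight ss x)"

text \<open>The path at \<open>\<sigma>\<close> is meant to come first and \<open>ss\<close> to act
  on what it leaves, but the entries have to be listed in increasing order. Passing a smaller path
  costs the two vectors which that path takes, hence \<open>\<sigma> - 2\<close>. For
  \<open>\<sigma> = s + 1\<close> the two pairs of orders overlap; together the paths exhaust the
  orders \<open>s\<close> to \<open>s + 3\<close>, just as two equal entries \<open>s\<close>
  do.\<close>

fun config_insert :: "nat \<Rightarrow> nat list \<Rightarrow> nat list" where
  "config_insert \<sigma> [] = [\<sigma>]"
| "config_insert \<sigma> (s # ss) =
     (if \<sigma> \<le> s then \<sigma> # s # ss else if \<sigma> = s + 1 then s # s # ss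
      else s # config_insert (\<sigma> - 2) ss)"

text \<open>The partition that the path at \<open>\<sigma>\<close> leaves behind. Parts that become
  0 are kept here and dropped only in the comparison with \<open>hat\<close>.\<close>

definition remove_pair :: "nat \<Rightarrow> nat list \<Rightarrow> nat list" where
  "remove_pair \<sigma> B = map (\<lambda>x. if x < \<sigma> then x else x - 2) (filter (\<lambda>x. x < \<sigma> \<or> \<sigma> + 1 < x) B)"

lemma length_config_insert [simp]: "length (config_insert \<sigma> ss) = Suc (length ss)"
  by (induction \<sigma> ss rule: config_insert.induct) auto

lemma config_insert_ge:
  "\<lbrakk>sorted ss; \<forall>x\<in>set ss. c \<le> x; c \<le> \<sigma>\<rbrakk> \<Longrightarrow> \<forall>y\<in>set (config_insert \<sigma> ss). c \<le> y"
proof (induction \<sigma> ss rule: config_insert.induct)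
  case (2 \<sigma> s ss)
  show ?case
  proof (cases "\<sigma> \<le> s \<or> \<sigma> = s + 1")
    case False
    have "c \<le> s" using 2(3) by simp
    then have "c \<le> \<sigma> - 2" using False by arith
    then have "\<forall>y\<in>set (config_insert (\<sigma> - 2) ss). c \<le> y"
      using 2(1) False 2(2,3) by simp
    then show ?thesis using False \<open>c \<le> s\<close> by simp
  qed (use 2(2-4) in auto)
qed simp

lemma sorted_config_insert: "sorted ss \<Longrightarrow> sorted (config_insert \<sigma> ss)"
proof (induction \<sigma> ss rule: config_insert.induct)
  case (2 \<sigma> s ss)
  show ?case
  proof (cases "\<sigma> \<le> s \<or> \<sigma> = s + 1")
    case False
    then have "sorted (config_insert (\<sigma> - 2) ss)" using 2 by simp
    moreover have "\<forall>y\<in>set (config_insert (\<sigma> - 2) ss). s \<le> y"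
      using 2(2) False by (intro config_insert_ge) auto
    ultimately show ?thesis using False by simp
  qed (use 2(2) in auto)
qed simp

lemma level_weight_config_insert:
  "sorted ss \<Longrightarrow> level_weight (config_insert \<sigma> ss) x =
     (if x < \<sigma> then level_weight ss x else if x \<le> \<sigma> + 1 then x else 2 + level_weight ss (x - 2))"
proof (induction \<sigma> ss arbitrary: x rule: config_insert.induct)
  case (2 \<sigma> s ss)
  consider "\<sigma> \<le> s" | "\<sigma> = s + 1" | "s + 2 \<le> \<sigma>" by linarith
  then show ?case
  proof cases
    case 3
    have IH: "level_weight (config_insert (\<sigma> - 2) ss) (x - 2) = (if x - 2 < \<sigma> - 2 then level_weight ss (x - 2)
       else if x - 2 \<le> \<sigma> - 2 + 1 then x - 2 else 2 + level_weight ss (x - 2 - 2))"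
      using 2 3 by auto
    consider "x < s" | "s \<le> x" "x \<le> s + 1" | "s + 2 \<le> x" "x < \<sigma>"
      | "\<sigma> \<le> x" "x \<le> \<sigma> + 1" | "\<sigma> + 2 \<le> x" using 3 by linarith
    then show ?thesis using 3 IH by cases auto
  qed auto
qed simp

lemma sum_list_filter_if:
  "(\<Sum>x\<leftarrow>filter P B. f x) = (\<Sum>x\<leftarrow>B. if P x then f x else (0::nat))"
  by (induction B) auto

lemma config_weight_config_insert:
  assumes "sorted ss"
  shows "config_weight B (config_insert \<sigma> ss) = config_weight B [\<sigma>] + config_weight (remove_pair \<sigma> B) ss"
proof -
  have "config_weight (remove_pair \<sigma> B) ss =
     (\<Sum>x\<leftarrow>B. if x < \<sigma> \<or> \<sigma> + 1 < x then level_weight ss (if x < \<sigma> then x else x - 2) else 0)"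
    by (simp add: config_weight_def remove_pair_def o_def sum_list_filter_if)
  moreover have "level_weight (config_insert \<sigma> ss) x = level_weight [\<sigma>] x +
      (if x < \<sigma> \<or> \<sigma> + 1 < x then level_weight ss (if x < \<sigma> then x else x - 2) else 0)" for x
    by (simp add: level_weight_config_insert[OF assms])
  ultimately show ?thesis
    by (simp only: config_weight_def sum_list_addf)
qed

section \<open>Weights as sums over the single paths, and the exchange argument\<close>

definition level_term :: "nat \<Rightarrow> nat \<Rightarrow> nat \<Rightarrow> nat" where
  "level_term x i s = (if x < s + 2 * i then 0 else if x \<le> s + 2 * i + 1 then x - 2 * i else 2)"

definition config_term :: "nat list \<Rightarrow> nat \<Rightarrow> nat \<Rightarrow> nat" where
  "config_term B i s = (\<Sum>x\<leftarrow>B. level_term x i s)"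

text \<open>Because the entries increase, every block that the path of index \<open>i\<close> meets
  has lost exactly \<open>2 * i\<close> vectors to the earlier paths. Its share therefore depends on
  \<open>i\<close> and its own entry only, and entries can be changed independently as long as the
  list stays sorted.\<close>

lemma level_weight_sum:
  "sorted ss \<Longrightarrow> level_weight ss x = (\<Sum>i<length ss. level_term x i (ss ! i))"
proof (induction ss arbitrary: x)
  case (Cons s ss)
  have split: "(\<Sum>i<length (s # ss). level_term x i ((s # ss) ! i)) =
     level_term x 0 s + (\<Sum>i<length ss. level_term x (Suc i) (ss ! i))"
    using sum.lessThan_Suc_shift[of "\<lambda>i. level_term x i ((s # ss) ! i)" "length ss"] by simp
  have ge: "s \<le> ss ! i" if "i < length ss" for i using Cons.prems that by auto
  show ?case
  proof (cases "x \<le> s + 1")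
    case True
    have "level_term x (Suc i) (ss ! i) = 0" if "i < length ss" for i
      using ge[OF that] True by (auto simp: level_term_def)
    then show ?thesis unfolding split using True by (auto simp: level_term_def)
  next
    case False
    have "level_term x (Suc i) (ss ! i) = level_term (x - 2) i (ss ! i)" if "i < length ss" for i
      using False by (auto simp: level_term_def)
    then show ?thesis unfolding split using False Cons by (auto simp: level_term_def)
  qed
qed simp

lemma config_weight_sum:
  assumes "sorted ss"
  shows "config_weight B ss = (\<Sum>i<length ss. config_term B i (ss ! i))"
  by (induction B) (simp_all add: config_weight_def config_term_def level_weight_sum[OF assms] sum.distrib)

text \<open>Raising the entry gives up the \<open>s\<close> vectors in each block of order
  \<open>s + 2 * i\<close> and gains the \<open>s\<close> inner vectors in each block of order
  \<open>s + 2 * i + 2\<close>; the order between them stays covered.\<close>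

lemma config_term_Suc:
  "int (config_term B i (Suc s)) - int (config_term B i s) =
     int s * (int (count_list B (s + 2 + 2 * i)) - int (count_list B (s + 2 * i)))"
proof (induction B)
  case (Cons x B)
  have "int (level_term x i (Suc s)) - int (level_term x i s) =
    int s * ((if x = s + 2 + 2 * i then 1 else 0) - (if x = s + 2 * i then 1 else 0))"
    by (auto simp: level_term_def)
  with Cons show ?case by (auto simp: config_term_def algebra_simps)
qed (simp add: config_term_def)

lemma config_insert_remove:
  "\<lbrakk>sorted ss; j < length ss; ss ! j + 2 * j = \<sigma>\<rbrakk> \<Longrightarrow>
     config_insert \<sigma> (take j ss @ drop (Suc j) ss) = ss"
proof (induction ss arbitrary: j \<sigma>)
  case (Cons s ss)
  show ?case
  proof (cases j)
    case 0
    then show ?thesis using Cons.prems by (cases ss) auto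
  next
    case (Suc k)
    have k: "k < length ss" "ss ! k + 2 * k = \<sigma> - 2" "s \<le> ss ! k"
      using Cons.prems Suc by auto
    have "ss ! k + 2 * k + 2 = \<sigma>" using Cons.prems(3) Suc by simp
    then have "s + 2 \<le> \<sigma>" using k(3) by linarith
    then show ?thesis using Cons.IH[OF _ k(1,2)] Cons.prems(1) Suc by simp
  qed
qed simp

text \<open>Two equal neighbouring entries exhaust four consecutive orders and so contain the pair
  in the middle as well: the case \<open>\<sigma> = s + 1\<close> of \<open>config_insert\<close>
  read backwards.\<close>

lemma config_insert_remove_twin:
  "\<lbrakk>sorted ss; Suc j < length ss; ss ! j = ss ! Suc j; ss ! j + 2 * j + 1 = \<sigma>\<rbrakk> \<Longrightarrow>
     config_insert \<sigma> (take j ss @ drop (Suc j) ss) = ss"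
proof (induction ss arbitrary: j \<sigma>)
  case (Cons s ss)
  show ?case
  proof (cases j)
    case 0
    then show ?thesis using Cons.prems by (cases ss) auto
  next
    case (Suc k)
    have k: "Suc k < length ss" "ss ! k = ss ! Suc k" "ss ! k + 2 * k + 1 = \<sigma> - 2" "s \<le> ss ! k"
      using Cons.prems Suc by auto
    have "ss ! k + 2 * k + 3 = \<sigma>" using Cons.prems(4) Suc by simp
    then have "s + 2 \<le> \<sigma>" using k(4) by linarith
    then show ?thesis using Cons.IH[OF _ k(1-3)] Cons.prems(1) Suc by simp
  qed
qed simp

lemma config_weight_update:
  assumes "sorted ss" "sorted (ss[j := v])" "j < length ss"
    and "config_term B j (ss ! j) \<le> config_term B j v"
  shows "config_weight B ss \<le> config_weight B (ss[j := v])"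
  unfolding config_weight_sum[OF assms(1)] config_weight_sum[OF assms(2)] length_list_update
proof (rule sum_mono)
  fix i assume "i \<in> {..<length ss}"
  then show "config_term B i (ss ! i) \<le> config_term B i (ss[j := v] ! i)"
    using assms(3,4) by (cases "i = j") auto
qed

lemma sorted_list_updateI:
  fixes ss :: "nat list"
  assumes "sorted ss" "j < length ss"
    and "\<And>i. i < j \<Longrightarrow> ss ! i \<le> v" "\<And>i. j < i \<Longrightarrow> i < length ss \<Longrightarrow> v \<le> ss ! i"
  shows "sorted (ss[j := v])"
  unfolding sorted_iff_nth_mono_less
proof (intro allI impI)
  fix i k assume ik: "i < k" "k < length (ss[j := v])"
  have "ss ! i \<le> ss ! k" using assms(1) ik by (simp add: sorted_iff_nth_mono_less)
  then show "ss[j := v] ! i \<le> ss[j := v] ! k"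
    using assms ik by (cases "i = j"; cases "k = j") auto
qed

text \<open>For \<open>i = 0\<close> the claim is the maximality of \<open>\<sigma>\<close>. In general the increments of
  \<open>config_term B i\<close> are those of \<open>config_term B 0\<close>, scaled by the increasing factor
  \<open>(q - 2 * i) / q\<close>, so that Abel summation applies.\<close>

lemma config_term_le_maximal:
  assumes max: "\<And>s. config_term B 0 s \<le> config_term B 0 \<sigma>"
    and "2 * i \<le> q" "q \<le> \<sigma>"
  shows "config_term B i (q - 2 * i) \<le> config_term B i (\<sigma> - 2 * i)"
proof (cases "i = 0")
  case False
  define d where "d t = int (count_list B (t + 2)) - int (count_list B t)" for t
  define E where "E r = int (config_term B 0 \<sigma>) - int (config_term B 0 r)" for r
  define S where "S r = int (config_term B i (\<sigma> - 2 * i)) - int (config_term B i (r - 2 * i))" for r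
  have E: "E r = int r * d r + E (Suc r)" for r
    using config_term_Suc[of B 0 r] by (simp add: E_def d_def)
  have S: "S r = (int r - 2 * int i) * d r + S (Suc r)" if "2 * i \<le> r" for r
    using config_term_Suc[of B i "r - 2 * i"] that by (simp add: S_def d_def Suc_diff_le)
  have E0: "0 \<le> E r" for r using max[of r] by (simp add: E_def)
  \<comment> \<open>\<open>E\<close> and \<open>S\<close> are the gains from the given point up to
    \<open>\<sigma>\<close>. The downward induction loses only the term
    \<open>2 * int i * a\<close>, whose sign is known because \<open>a\<close> is a deficit from the
    maximum.\<close>
  have "(int q - 2 * int i) * E q \<le> int q * S q"
    using \<open>q \<le> \<sigma>\<close> \<open>2 * i \<le> q\<close>
  proof (induction rule: inc_induct)
    case base
    then show ?case by (simp add: E_def S_def)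
  next
    case (step r)
    define a b where "a = E (Suc r)" and "b = S (Suc r)"
    have IH: "(int r + 1 - 2 * int i) * a \<le> (int r + 1) * b"
      using step by (simp add: a_def b_def add.commute)
    have "(int r + 1) * ((int r - 2 * int i) * a) + 2 * int i * a = int r * ((int r + 1 - 2 * int i) * a)"
      by (simp add: algebra_simps)
    moreover have "int r * ((int r + 1 - 2 * int i) * a) \<le> int r * ((int r + 1) * b)"
      by (rule mult_left_mono[OF IH]) simp
    moreover have "0 \<le> 2 * int i * a" using E0 by (simp add: a_def)
    ultimately have "(int r + 1) * ((int r - 2 * int i) * a) \<le> (int r + 1) * (int r * b)"
      using mult.left_commute[of "int r" "int r + 1" b] by linarith
    then have "(int r - 2 * int i) * a \<le> int r * b"
      by (subst (asm) mult_le_cancel_left_pos) auto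
    moreover have "2 * i \<le> r" using step by linarith
    ultimately show ?case unfolding E[of r] S[OF \<open>2 * i \<le> r\<close>] a_def[symmetric] b_def[symmetric]
      by (simp add: algebra_simps)
  qed
  then have "0 \<le> int q * S q"
    using mult_nonneg_nonneg[of "int q - 2 * int i" "E q"] E0[of q] assms(2) by linarith
  then have "0 \<le> S q" using False assms(2) by (simp add: zero_le_mult_iff)
  then show ?thesis by (simp add: S_def)
qed (use max in auto)

text \<open>The pair at \<open>\<sigma>\<close> replaces the next smaller pair of the configuration, if there is one.\<close>

lemma config_exchange:
  assumes "sorted ss" "ss \<noteq> []" and max: "\<And>s. config_term B 0 s \<le> config_term B 0 \<sigma>"
  shows "\<exists>ss'. sorted ss' \<and> length ss = Suc (length ss') \<and>
    config_weight B ss \<le> config_weight B (config_insert \<sigma> ss')"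
proof -
  have mono: "ss ! i \<le> ss ! k" if "i \<le> k" "k < length ss" for i k
    using assms(1) that by (simp add: sorted_iff_nth_mono)
  have removed: "sorted (take j xs @ drop (Suc j) xs)" if "sorted xs" for j and xs :: "nat list"
  proof (cases "j < length xs")
    case True
    have "sorted (take j xs @ xs ! j # drop (Suc j) xs)" using that id_take_nth_drop[OF True] by simp
    then show ?thesis by (auto simp: sorted_append)
  qed (use that in simp)
  have finish: ?thesis if "sorted xs" "length xs = length ss" "config_weight B ss \<le> config_weight B xs"
    "j < length xs" "config_insert \<sigma> (take j xs @ drop (Suc j) xs) = xs" for xs j
    using that removed[of xs j] by (intro exI[of _ "take j xs @ drop (Suc j) xs"]) auto
  define P where "P j \<longleftrightarrow> j = length ss \<or> \<sigma> \<le> ss ! j + 2 * j" for j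
  define j where "j = (LEAST j. P j)"
  have Pj: "P j" unfolding j_def by (rule LeastI[of P "length ss"]) (simp add: P_def)
  have below: "\<not> P i" if "i < j" for i using that not_less_Least by (auto simp: j_def)
  have "j \<le> length ss" unfolding j_def by (rule Least_le) (simp add: P_def)
  have lower: "ss ! i + 2 * i < \<sigma>" if "i < j" for i using below[OF that] by (auto simp: P_def)
  have replace: ?thesis
    if k: "k < length ss" "2 * k \<le> \<sigma>" and "\<And>i. i < k \<Longrightarrow> ss ! i \<le> \<sigma> - 2 * k"
      "\<And>i. k < i \<Longrightarrow> i < length ss \<Longrightarrow> \<sigma> - 2 * k \<le> ss ! i"
      "config_term B k (ss ! k) \<le> config_term B k (\<sigma> - 2 * k)" for k
  proof -
    have s: "sorted (ss[k := \<sigma> - 2 * k])" by (rule sorted_list_updateI) (use that assms in auto)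
    show ?thesis
    proof (rule finish[OF s])
      show "config_weight B ss \<le> config_weight B (ss[k := \<sigma> - 2 * k])"
        by (rule config_weight_update[OF assms(1) s k(1) that(5)])
      show "k < length (ss[k := \<sigma> - 2 * k])" using k by simp
      then show "config_insert \<sigma> (take k (ss[k := \<sigma> - 2 * k]) @ drop (Suc k) (ss[k := \<sigma> - 2 * k]))
          = ss[k := \<sigma> - 2 * k]" by (rule config_insert_remove[OF s]) (use k in simp)
    qed simp
  qed
  \<comment> \<open>\<open>j\<close> is the first index whose pair is not below
    \<open>\<sigma>\<close>. Either that pair is the one at \<open>\<sigma>\<close>, or it overlaps
    it from above, or there is no smaller pair, or the pair before it can be raised to
    \<open>\<sigma>\<close>.\<close>
  consider (hit) "j < length ss" "ss ! j + 2 * j = \<sigma>"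
    | (near) "j < length ss" "ss ! j + 2 * j = \<sigma> + 1" "0 < j"
    | (first) "j = 0" "\<sigma> < ss ! 0"
    | (far) "0 < j" "j = length ss \<or> \<sigma> + 2 \<le> ss ! j + 2 * j"
  proof -
    have "0 < length ss" using assms(2) by simp
    have "j = length ss \<or> j < length ss \<and> \<sigma> \<le> ss ! j + 2 * j" using Pj \<open>j \<le> length ss\<close> by (auto simp: P_def)
    then consider "j = length ss" | "j < length ss" "ss ! j + 2 * j = \<sigma>"
      | "j < length ss" "ss ! j + 2 * j = \<sigma> + 1" | "j < length ss" "\<sigma> + 2 \<le> ss ! j + 2 * j" by linarith
    then show ?thesis
    proof cases
      case 1
      then show ?thesis using far \<open>0 < length ss\<close> by blast
    next
      case 2
      then show ?thesis by (rule hit)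
    next
      case 3
      then show ?thesis using near first by (cases "j = 0") auto
    next
      case 4
      then show ?thesis using far first by (cases "j = 0") auto
    qed
  qed
  then show ?thesis
  proof cases
    case hit
    then show ?thesis using config_insert_remove[OF assms(1)] using assms by (intro finish[of ss j]) simp_all
  next
    case near
    define i where "i = j - 1"
    have i: "j = Suc i" using near by (simp add: i_def)
    have le: "ss ! i \<le> ss ! j" using mono near i by simp
    have lt: "ss ! i + 2 * i < \<sigma>" using lower i by simp
    show ?thesis
    proof (cases "ss ! i = ss ! j")
      case True
      then have "config_insert \<sigma> (take i ss @ drop (Suc i) ss) = ss"
        using near i by (intro config_insert_remove_twin[OF assms(1)]) auto
      then show ?thesis using near i assms(1) by (intro finish[of ss i]) simp_all
    next
      case False
      \<comment> \<open>Raising entry \<open>i\<close> to \<open>\<sigma>\<close> would overtake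
        entry \<open>j\<close>. Instead entry \<open>j\<close> is lowered by one, which costs
        nothing: by maximality of \<open>\<sigma>\<close> the order \<open>\<sigma> + 2\<close> is
        not more frequent than \<open>\<sigma>\<close>.\<close>
      have v: "\<sigma> - 2 * j + 1 = ss ! j" "2 * j \<le> \<sigma>" using near le lt False i by auto
      have "ss ! k \<le> \<sigma> - 2 * j" if "k < j" for k
        using mono[of k i] that i near v False le by auto
      moreover have "\<sigma> - 2 * j \<le> ss ! k" if "j < k" "k < length ss" for k
        using mono[of j k] that v by auto
      moreover have "config_term B j (ss ! j) \<le> config_term B j (\<sigma> - 2 * j)"
      proof -
        have "0 < \<sigma>" using lt by simp
        have "int \<sigma> * (int (count_list B (\<sigma> + 2)) - int (count_list B \<sigma>)) \<le> 0"
          using config_term_Suc[of B 0 \<sigma>] max[of "Suc \<sigma>"] by simp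
        then have "int (count_list B (\<sigma> + 2)) - int (count_list B \<sigma>) \<le> 0"
          using \<open>0 < \<sigma>\<close> by (simp add: mult_le_0_iff)
        then have "int (config_term B j (Suc (\<sigma> - 2 * j))) - int (config_term B j (\<sigma> - 2 * j)) \<le> 0"
          using v(2) unfolding config_term_Suc by (intro mult_nonneg_nonpos) auto
        then show ?thesis using v by simp
      qed
      ultimately show ?thesis using v near by (intro replace[of j]) simp_all
    qed
  next
    case first
    have "\<sigma> \<le> ss ! k" if "k < length ss" for k using mono[of 0 k] that first by simp
    then show ?thesis using max assms(2) by (intro replace[of 0]) auto
  next
    case far
    define i where "i = j - 1"
    have i: "j = Suc i" using far by (simp add: i_def)
    have lt: "ss ! i + 2 * i < \<sigma>" using lower i by simp
    have len: "i < length ss" using i \<open>j \<le> length ss\<close> by simp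
    have "ss ! k \<le> \<sigma> - 2 * i" if "k < i" for k using mono[of k i] that len lt by auto
    moreover have "\<sigma> - 2 * i \<le> ss ! k" if "i < k" "k < length ss" for k
      using mono[of j k] that far i by auto
    moreover have "config_term B i (ss ! i) \<le> config_term B i (\<sigma> - 2 * i)"
      using config_term_le_maximal[OF max, of i "ss ! i + 2 * i"] lt by simp
    ultimately show ?thesis using len lt by (intro replace[of i]) simp_all
  qed
qed

section \<open>Antichains and configurations\<close>

fun path_weight :: "('v \<Rightarrow> 'v \<Rightarrow> int) \<Rightarrow> 'v list \<Rightarrow> int" where
  "path_weight w (x # y # p) = w x y + path_weight w (y # p)"
| "path_weight w _ = 0"

lemma path_weight_append: "path_weight w (p @ x # q) = path_weight w (p @ [x]) + path_weight w (x # q)"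
proof (induction p)
  case (Cons a p)
  then show ?case by (cases p) auto
qed simp

lemma path_weight_snoc: "path_weight w (xs @ [y]) = (\<Sum>(a, b)\<leftarrow>zip xs (tl xs @ [y]). w a b)"
proof (induction xs)
  case (Cons a xs)
  then show ?case by (cases xs) auto
qed simp

lemma cycle_weight:
  assumes "distinct cs" "cs \<noteq> []"
  shows "(\<Sum>x\<in>set cs. w x (cycle_of_list cs x)) = path_weight w (cs @ [hd cs])"
proof -
  have rot: "map (cycle_of_list cs) cs = rotate1 cs"
    using cyclic_rotation[of cs 1] assms by simp
  have "(\<Sum>x\<in>set cs. w x (cycle_of_list cs x)) = (\<Sum>x\<leftarrow>cs. w x (cycle_of_list cs x))"
    using assms(1) by (simp add: sum.distinct_set_conv_list)
  also have "\<dots> = (\<Sum>(a, b)\<leftarrow>zip cs (map (cycle_of_list cs) cs). w a b)"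
    by (simp add: zip_map2 zip_same_conv_map o_def)
  finally show ?thesis
    unfolding rot path_weight_snoc using assms(2) by (cases cs) auto
qed

text \<open>Shortest-path potentials: an optimal assignment has no negative cycle.\<close>

lemma assignment_potential:
  fixes c :: "'v \<Rightarrow> 'v \<Rightarrow> int"
  assumes "finite I"
    and opt: "\<And>\<pi>. \<pi> permutes I \<Longrightarrow> (\<Sum>i\<in>I. c i i) \<le> (\<Sum>i\<in>I. c i (\<pi> i))"
  shows "\<exists>d. \<forall>i\<in>I. \<forall>j\<in>I. d j \<le> d i + (c i j - c i i)"
proof -
  define w where "w i j = c i j - c i i" for i j
  have cyc: "0 \<le> path_weight w (cs @ [hd cs])" if cs: "distinct cs" "cs \<noteq> []" "set cs \<subseteq> I" for cs
  proof -
    have perm: "cycle_of_list cs permutes set cs" using cs by (simp add: cycle_permutes)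
    have "0 \<le> (\<Sum>i\<in>I. w i (cycle_of_list cs i))"
      using opt[OF permutes_subset[OF perm cs(3)]] by (simp add: w_def sum_subtractf)
    also have "\<dots> = (\<Sum>i\<in>set cs. w i (cycle_of_list cs i))"
      using assms(1) cs(3) permutes_not_in[OF perm] by (intro sum.mono_neutral_right) (auto simp: w_def)
    finally show ?thesis using cycle_weight[OF cs(1,2)] by simp
  qed
  define paths where "paths j = {p. distinct p \<and> p \<noteq> [] \<and> set p \<subseteq> I \<and> last p = j}" for j
  have fin: "finite (paths j)" for j
    using finite_subset_distinct[OF assms(1)] by (rule rev_finite_subset) (auto simp: paths_def)
  define d where "d j = Min (path_weight w ` paths j)" for j
  have "d j \<le> d i + w i j" if ij: "i \<in> I" "j \<in> I" for i j
  proof -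
    have "[i] \<in> paths i" using ij by (simp add: paths_def)
    then have "d i \<in> path_weight w ` paths i"
      unfolding d_def using fin by (intro Min_in) auto
    then obtain p where p: "p \<in> paths i" "d i = path_weight w p" by auto
    have le: "d j \<le> path_weight w q" if "q \<in> paths j" for q
      unfolding d_def using fin that by (intro Min_le) auto
    obtain p0 where p0: "p = p0 @ [i]" using p(1) by (auto simp: paths_def intro: append_butlast_last_id[symmetric])
    show ?thesis
    proof (cases "j \<in> set p")
      case False
      then have "p @ [j] \<in> paths j" using p(1) ij by (auto simp: paths_def)
      moreover have "path_weight w (p @ [j]) = path_weight w p + w i j"
        using path_weight_append[of w p0 i "[j]"] by (simp add: p0)
      ultimately show ?thesis using le p(2) by fastforce
    next
      case True
      \<comment> \<open>Here \<open>p\<close> extended by \<open>j\<close> is no longer simple. It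
        is cut at \<open>j\<close>, and the discarded part closes up to a cycle of nonnegative
        weight.\<close>
      then obtain p1 p2 where split: "p = p1 @ j # p2" by (meson split_list)
      have "p1 @ [j] \<in> paths j" using p(1) ij by (auto simp: paths_def split)
      then have "d j \<le> path_weight w (p1 @ [j])" by (rule le)
      moreover have "path_weight w p = path_weight w (p1 @ [j]) + path_weight w (j # p2)"
        unfolding split by (rule path_weight_append)
      moreover have "0 \<le> path_weight w ((j # p2) @ [j])"
        using cyc[of "j # p2"] p(1) by (auto simp: paths_def split)
      moreover have "path_weight w ((j # p2) @ [j]) = path_weight w (j # p2) + w i j"
      proof -
        have "last (j # p2) = i" using p(1) by (auto simp: paths_def split)
        then obtain q where q: "j # p2 = q @ [i]" by (metis append_butlast_last_id list.discI)
        show ?thesis using path_weight_append[of w q i "[j]"] by (simp add: q)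
      qed
      ultimately show ?thesis using p(2) by linarith
    qed
  qed
  then show ?thesis by (auto simp: w_def)
qed

text \<open>The weighted form of the Greene--Kleitman duality. Chains and antichains are produced by an
  assignment problem: every element is assigned its successor in a chain, or itself (at cost 1,
  for elements outside the chains), or a dummy; beginning a chain costs \<open>m\<close>. The optimal
  potentials give the union \<open>Z\<close> of \<open>m\<close> antichains.\<close>

lemma greene_kleitman_duality:
  fixes V :: "'v set" and r :: "'v \<Rightarrow> 'v \<Rightarrow> bool" and m :: nat
  assumes "finite V" and irrefl: "\<And>x. \<not> r x x" and trans: "\<And>x y z. r x y \<Longrightarrow> r y z \<Longrightarrow> r x z"
  obtains Z \<tau> X k where "Z \<subseteq> V" "\<And>v. v \<in> Z \<Longrightarrow> 1 \<le> \<tau> v \<and> \<tau> v \<le> m"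
    "\<And>v w. \<lbrakk>v \<in> Z; w \<in> Z; r v w\<rbrakk> \<Longrightarrow> \<tau> v < (\<tau> w :: nat)"
    "X \<subseteq> V" "\<And>A. \<lbrakk>A \<subseteq> X; \<And>a b. a \<in> A \<Longrightarrow> b \<in> A \<Longrightarrow> \<not> r a b\<rbrakk> \<Longrightarrow> card A \<le> k"
    "card V + k * m \<le> card X + card Z"
proof (cases "V = {}")
  case True
  show ?thesis by (rule that[of "{}" _ "{}" 0]) (use True in auto)
next
  case False
  define N where "N = card V"
  define I where "I = V \<times> (UNIV :: bool set)"
  \<comment> \<open>The flag distinguishes elements from dummies. An element assigned to a dummy
    ends its chain at cost 0, and a dummy assigned to an element begins one at cost
    \<open>m\<close>. The value \<open>N + 1\<close> exceeds the cost \<open>N\<close> of the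
    identity, so an optimal assignment uses only related pairs.\<close>
  define C :: "'v \<times> bool \<Rightarrow> 'v \<times> bool \<Rightarrow> int" where
    "C i j = (if snd j then if snd i then if fst i = fst j then 1 else if r (fst i) (fst j) then 0 else int N + 1
                else int m else 0)" for i j
  have fI: "finite I" using assms(1) by (simp add: I_def)
  have C0: "0 \<le> C i j" for i j by (simp add: C_def)
  define cost where "cost \<pi> = (\<Sum>i\<in>I. C i (\<pi> i))" for \<pi>
  have sumI: "(\<Sum>i\<in>I. f i) = (\<Sum>v\<in>V. f (v, True)) + (\<Sum>v\<in>V. f (v, False))" for f :: "_ \<Rightarrow> int"
  proof -
    have "(\<Sum>i\<in>I. f i) = (\<Sum>v\<in>V. \<Sum>b\<in>UNIV. f (v, b))"
      unfolding I_def sum.cartesian_product by simp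
    then show ?thesis by (simp add: UNIV_bool sum.distrib)
  qed
  obtain \<sigma> where \<sigma>: "\<sigma> permutes I" and min: "\<And>\<pi>. \<pi> permutes I \<Longrightarrow> cost \<sigma> \<le> cost \<pi>"
  proof -
    have fin: "finite {\<pi>. \<pi> permutes I}" using fI by (rule finite_permutations)
    have "id \<in> {\<pi>. \<pi> permutes I}" by (simp add: permutes_id)
    then have ne: "{\<pi>. \<pi> permutes I} \<noteq> {}" by blast
    show thesis
      using that[of "arg_min_on cost {\<pi>. \<pi> permutes I}"] arg_min_if_finite(1)[OF fin ne, of cost]
        arg_min_least[OF fin ne, of _ cost] by auto
  qed
  have \<sigma>I: "\<sigma> i \<in> I \<longleftrightarrow> i \<in> I" for i using \<sigma> by (rule permutes_in_image)
  have inj: "\<sigma> i = \<sigma> j \<longleftrightarrow> i = j" for i j using permutes_inj[OF \<sigma>] by (simp add: inj_eq)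
  have "cost \<sigma> \<le> cost id" by (rule min) (rule permutes_id)
  also have "cost id = int N" unfolding cost_def sumI by (simp add: C_def N_def)
  finally have costN: "cost \<sigma> \<le> int N" .
  have up: "w = v \<or> r v w" if "\<sigma> (v, True) = (w, True)" "v \<in> V" for v w
  proof (rule ccontr)
    assume "\<not> ?thesis"
    then have "C (v, True) (\<sigma> (v, True)) = int N + 1" using that by (auto simp: C_def)
    moreover have "C (v, True) (\<sigma> (v, True)) \<le> cost \<sigma>"
      unfolding cost_def using that fI C0 by (intro member_le_sum) (auto simp: I_def)
    ultimately show False using costN by simp
  qed
  define X where "X = {v \<in> V. \<sigma> (v, True) \<noteq> (v, True)}"
  define S where "S = {w \<in> V. \<exists>v. \<sigma> (v, False) = (w, True)}"
  have fX: "finite X" and fS: "finite S" using assms(1) by (auto simp: X_def S_def)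
  define k where "k = card S"
  have cost_eq: "int N - int (card X) + int k * int m \<le> cost \<sigma>"
  proof -
    have "int (card (V - X)) = (\<Sum>v\<in>V. if v \<in> V - X then 1 else 0)"
      by (subst sum.inter_restrict[symmetric, OF assms(1)]) (simp add: Int_absorb1)
    also have "\<dots> \<le> (\<Sum>v\<in>V. C (v, True) (\<sigma> (v, True)))"
      by (rule sum_mono) (auto simp: X_def C_def)
    finally have 1: "int N - int (card X) \<le> (\<Sum>v\<in>V. C (v, True) (\<sigma> (v, True)))"
      using assms(1) by (simp add: N_def card_Diff_subset X_def fX[unfolded X_def] of_nat_diff card_mono)
    define D where "D = {v \<in> V. snd (\<sigma> (v, False))}"
    have "S \<subseteq> (\<lambda>v. fst (\<sigma> (v, False))) ` D"
    proof
      fix w assume "w \<in> S"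
      then obtain v where v: "\<sigma> (v, False) = (w, True)" "w \<in> V" by (auto simp: S_def)
      then have "v \<in> V" using \<sigma>I[of "(v, False)"] by (simp add: I_def)
      then show "w \<in> (\<lambda>v. fst (\<sigma> (v, False))) ` D" using v by (force simp: D_def)
    qed
    then have "k \<le> card D" unfolding k_def using assms(1) by (auto simp: D_def intro: surj_card_le)
    then have "int k * int m \<le> int (card D) * int m" by (intro mult_right_mono) auto
    also have "\<dots> = (\<Sum>v\<in>V. if v \<in> D then int m else 0)"
      using assms(1) by (simp add: sum.If_cases D_def Int_absorb1 Int_def conj_commute)
    also have "\<dots> = (\<Sum>v\<in>V. C (v, False) (\<sigma> (v, False)))"
      by (rule sum.cong) (auto simp: D_def C_def)
    finally show ?thesis using 1 unfolding cost_def sumI by linarith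
  qed
  have width: "card A \<le> k" if A: "A \<subseteq> X" "\<And>a b. a \<in> A \<Longrightarrow> b \<in> A \<Longrightarrow> \<not> r a b" for A
  proof -
    \<comment> \<open>\<open>L\<close> is what lies below \<open>A\<close> in \<open>X\<close>.
      Every member of \<open>A \<union> L\<close> that does not begin a chain has its predecessor in
      \<open>L\<close>, and predecessors are distinct; since \<open>A\<close> and \<open>L\<close>
      are disjoint, \<open>card A\<close> is at most the number of chains.\<close>
    define L where "L = {x \<in> X. \<exists>a\<in>A. r x a}"
    have fin: "finite A" "finite L" using fX A(1) by (auto simp: L_def intro: finite_subset)
    have "A \<inter> L = {}" using A(2) by (auto simp: L_def)
    then have cardAL: "card (A \<union> L) = card A + card L" using fin by (simp add: card_Un_disjoint)
    define prv where "prv x = fst (inv_into UNIV \<sigma> (x, True))" for x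
    have prv: "\<sigma> (prv x, True) = (x, True)" if x: "x \<in> (A \<union> L) - S" for x
    proof -
      have "x \<in> V" using x A(1) by (auto simp: X_def L_def)
      have eq: "\<sigma> (inv_into UNIV \<sigma> (x, True)) = (x, True)" using permutes_inverses(1)[OF \<sigma>] .
      have "snd (inv_into UNIV \<sigma> (x, True))"
      proof (rule ccontr)
        assume "\<not> ?thesis"
        then have "inv_into UNIV \<sigma> (x, True) = (prv x, False)" by (simp add: prv_def prod_eq_iff)
        then show False using eq x \<open>x \<in> V\<close> by (auto simp: S_def)
      qed
      then have "inv_into UNIV \<sigma> (x, True) = (prv x, True)" by (simp add: prv_def prod_eq_iff)
      then show ?thesis using eq by simp
    qed
    have "inj_on prv ((A \<union> L) - S)" by (rule inj_onI) (metis prv prod.inject)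
    moreover have "prv ` ((A \<union> L) - S) \<subseteq> L"
    proof
      fix y assume "y \<in> prv ` ((A \<union> L) - S)"
      then obtain x where x: "x \<in> (A \<union> L) - S" "y = prv x" by auto
      have xX: "x \<in> X" using x A(1) by (auto simp: L_def)
      have eq: "\<sigma> (y, True) = (x, True)" using prv x by simp
      have "y \<noteq> x" using eq xX by (auto simp: X_def)
      have "y \<in> V" using eq xX \<sigma>I[of "(y, True)"] by (simp add: I_def X_def)
      then have "r y x" using up[OF eq] \<open>y \<noteq> x\<close> by auto
      moreover have "y \<in> X" using eq \<open>y \<in> V\<close> \<open>y \<noteq> x\<close> by (auto simp: X_def)
      ultimately show "y \<in> L" using x trans by (auto simp: L_def)
    qed
    ultimately have "card ((A \<union> L) - S) \<le> card L" using fin by (metis card_image card_mono)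
    moreover have "card (A \<union> L) \<le> card ((A \<union> L) - S) + card S"
      using card_mono[of "((A \<union> L) - S) \<union> S" "A \<union> L"] card_Un_le[of "(A \<union> L) - S" S] fin fS
      by auto
    ultimately show ?thesis using cardAL by (simp add: k_def)
  qed
  obtain d where d: "\<And>i j. i \<in> I \<Longrightarrow> j \<in> I \<Longrightarrow> d j \<le> d i + (C i (\<sigma> j) - C i (\<sigma> i))"
  proof -
    have "(\<Sum>i\<in>I. C i (\<sigma> i)) \<le> (\<Sum>i\<in>I. C i (\<sigma> (\<pi> i)))" if "\<pi> permutes I" for \<pi>
      using min[OF permutes_compose[OF that \<sigma>]] by (simp add: cost_def)
    from assignment_potential[OF fI, of "\<lambda>i j. C i (\<sigma> j)", OF this] show thesis using that by blast
  qed
  define e where "e y = d (inv_into UNIV \<sigma> y)" for y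
  define u where "u i = C i (\<sigma> i) - d i" for i
  have ue: "u i + e y \<le> C i y" if "i \<in> I" "y \<in> I" for i y
  proof -
    have "inv_into UNIV \<sigma> y \<in> I" using permutes_in_image[OF permutes_inv[OF \<sigma>]] that by simp
    from d[OF that(1) this] show ?thesis by (simp add: u_def e_def permutes_inverses(1)[OF \<sigma>])
  qed
  have "(\<Sum>i\<in>I. e i) = (\<Sum>i\<in>I. d i)"
    unfolding e_def using sum.permute[OF permutes_inv[OF \<sigma>], of d] by (simp add: o_def)
  then have dual: "cost \<sigma> = (\<Sum>i\<in>I. u i) + (\<Sum>i\<in>I. e i)"
    by (simp add: cost_def u_def sum_subtractf)
  define a where "a = Max ((\<lambda>v. u (v, False)) ` V)"
  define b where "b = Max ((\<lambda>v. e (v, False)) ` V)"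
  have "a \<in> (\<lambda>v. u (v, False)) ` V" unfolding a_def using assms(1) False by (intro Max_in) auto
  then obtain va where va: "va \<in> V" "a = u (va, False)" by auto
  have "b \<in> (\<lambda>v. e (v, False)) ` V" unfolding b_def using assms(1) False by (intro Max_in) auto
  then obtain vb where vb: "vb \<in> V" "b = e (vb, False)" by auto
  have ab: "a + b \<le> 0" using ue[of "(va, False)" "(vb, False)"] va vb by (simp add: I_def C_def)
  have ub: "u (v, True) + b \<le> 0" if "v \<in> V" for v
    using ue[of "(v, True)" "(vb, False)"] that vb by (simp add: I_def C_def)
  have ea: "a + e (v, True) \<le> int m" if "v \<in> V" for v
    using ue[of "(va, False)" "(v, True)"] that va by (simp add: I_def C_def)
  have uv: "u (v, True) + e (v, True) \<le> 1" if "v \<in> V" for v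
    using ue[of "(v, True)" "(v, True)"] that by (simp add: I_def C_def)
  have uvr: "u (v, True) + e (w, True) \<le> 0" if "v \<in> V" "w \<in> V" "r v w" for v w
    using ue[of "(v, True)" "(w, True)"] that irrefl by (auto simp: I_def C_def split: if_splits)
  \<comment> \<open>The elements whose self-assignment is tight. If \<open>a + b = 0\<close>, the
    potential \<open>u\<close> grows strictly along \<open>r\<close> on \<open>Z\<close>, and the
    costs 0 and \<open>m\<close> of ending and beginning a chain confine it to \<open>m\<close>
    values.\<close>
  define Z where "Z = {v \<in> V. u (v, True) + e (v, True) = 1}"
  have "(\<Sum>v\<in>V. u (v, True) + e (v, True)) \<le> (\<Sum>v\<in>V. if v \<in> Z then 1 else 0)"
    using uv by (intro sum_mono) (force simp: Z_def)
  also have "\<dots> = int (card Z)" using assms(1) by (simp add: sum.If_cases Z_def Int_def conj_commute)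
  finally have Z1: "(\<Sum>v\<in>V. u (v, True)) + (\<Sum>v\<in>V. e (v, True)) \<le> int (card Z)" by (simp add: sum.distrib)
  have "(\<Sum>v\<in>V. u (v, False)) \<le> (\<Sum>v\<in>V. a)" unfolding a_def using assms(1) by (intro sum_mono Max_ge) auto
  moreover have "(\<Sum>v\<in>V. e (v, False)) \<le> (\<Sum>v\<in>V. b)" unfolding b_def using assms(1) by (intro sum_mono Max_ge) auto
  ultimately have costZ: "cost \<sigma> \<le> int (card Z) + int N * (a + b)"
    using Z1 unfolding dual sumI by (simp add: N_def algebra_simps)
  have "card Z \<le> N" unfolding N_def Z_def using assms(1) by (intro card_mono) auto
  show ?thesis
  proof (cases "a + b = 0")
    case True
    define \<tau> where "\<tau> v = nat (u (v, True) - a + int m)" for v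
    have range: "u (v, True) - a + int m \<ge> 1 \<and> u (v, True) - a + int m \<le> int m" if "v \<in> Z" for v
      using that ub[of v] ea[of v] True by (auto simp: Z_def)
    have mono: "u (v, True) < u (w, True)" if "v \<in> Z" "w \<in> Z" "r v w" for v w
      using that uvr[of v w] by (auto simp: Z_def)
    show ?thesis
    proof (rule that[of Z \<tau> X k])
      show "1 \<le> \<tau> v \<and> \<tau> v \<le> m" if "v \<in> Z" for v using range[OF that] by (auto simp: \<tau>_def)
      show "\<tau> v < \<tau> w" if "v \<in> Z" "w \<in> Z" "r v w" for v w
        using range[OF that(1)] range[OF that(2)] mono[OF that] by (auto simp: \<tau>_def)
      have "int (card V + k * m) \<le> int (card X + card Z)"
        using cost_eq costZ True by (simp add: N_def)
      then show "card V + k * m \<le> card X + card Z" by linarith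
    qed (use width in \<open>auto simp: Z_def X_def\<close>)
  next
    case False
    \<comment> \<open>Each of the \<open>N\<close> dummies now loses at least 1, which outweighs all
      of \<open>Z\<close>; the chains alone suffice and \<open>Z\<close> may be taken empty.\<close>
    then have "int N * (a + b) \<le> int N * (- 1)" using ab by (intro mult_left_mono) auto
    then have "cost \<sigma> \<le> 0" using costZ \<open>card Z \<le> N\<close> by simp
    then have "int (card V + k * m) \<le> int (card X)" using cost_eq by (simp add: N_def)
    then have "card V + k * m \<le> card X" by linarith
    then show ?thesis by (intro that[of "{}" "\<lambda>_. 0" X k]) (use width in \<open>auto simp: X_def\<close>)
  qed
qed

text \<open>The points at the top of a chain of \<open>i + 1\<close> points of \<open>P\<close> that
  increases strictly in both coordinates. It is the filtration of \<open>P\<close> by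
  height.\<close>

primrec chain_level :: "(nat \<times> nat) set \<Rightarrow> nat \<Rightarrow> (nat \<times> nat) set" where
  "chain_level P 0 = P"
| "chain_level P (Suc i) = {z \<in> P. \<exists>z'\<in>chain_level P i. fst z' < fst z \<and> snd z' < snd z}"

lemma chain_level_subset: "chain_level P i \<subseteq> P"
  by (cases i) auto

lemma chain_level_ge: "z \<in> chain_level P i \<Longrightarrow> i \<le> fst z \<and> i \<le> snd z"
proof (induction i arbitrary: z)
  case (Suc i)
  then obtain z' where "z' \<in> chain_level P i" "fst z' < fst z" "snd z' < snd z" by auto
  with Suc.IH[of z'] show ?case by linarith
qed simp

lemma chain_level_chain:
  "z \<in> chain_level P i \<Longrightarrow> \<exists>C\<subseteq>P. finite C \<and> card C = Suc i \<and> (\<forall>c\<in>C. c = z \<or> fst c < fst z \<and> snd c < snd z) \<and>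
     (\<forall>c\<in>C. \<forall>c'\<in>C. c \<noteq> c' \<longrightarrow> fst c < fst c' \<and> snd c < snd c' \<or> fst c' < fst c \<and> snd c' < snd c)"
proof (induction i arbitrary: z)
  case 0
  then show ?case by (intro exI[of _ "{z}"]) auto
next
  case (Suc i)
  then obtain z' where z': "z' \<in> chain_level P i" "fst z' < fst z" "snd z' < snd z" and "z \<in> P" by auto
  obtain C where C: "C \<subseteq> P" "finite C" "card C = Suc i"
    and le: "\<And>c. c \<in> C \<Longrightarrow> c = z' \<or> fst c < fst z' \<and> snd c < snd z'"
    and tot: "\<And>c c'. \<lbrakk>c \<in> C; c' \<in> C; c \<noteq> c'\<rbrakk> \<Longrightarrow>
      fst c < fst c' \<and> snd c < snd c' \<or> fst c' < fst c \<and> snd c' < snd c"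
    using Suc.IH[OF z'(1)] by blast
  have lt: "fst c < fst z \<and> snd c < snd z" if "c \<in> C" for c using le[OF that] z' by auto
  then have "z \<notin> C" by blast
  show ?case
    by (rule exI[of _ "insert z C"]) (use C \<open>z \<in> P\<close> \<open>z \<notin> C\<close> lt tot in auto)
qed

text \<open>If \<open>j\<close> divides the number of rays, they are equally distributed over the
  \<open>j\<close> cells of level \<open>j\<close>.\<close>

lemma card_div_fiber:
  fixes q :: nat
  assumes "0 < q" "c < j"
  shows "card {t \<in> {..<j * q}. t div q = c} = q"
proof -
  have iff: "t div q = c \<longleftrightarrow> c * q \<le> t \<and> t < c * q + q" for t
  proof
    assume "t div q = c"
    then show "c * q \<le> t \<and> t < c * q + q"
      using assms(1) dividend_less_div_times[of q t] div_times_less_eq_dividend[of t q] by (auto simp: mult.commute)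
  next
    assume "c * q \<le> t \<and> t < c * q + q"
    then show "t div q = c" by (auto intro!: div_nat_eqI simp: mult.commute)
  qed
  have "c * q + q \<le> j * q" using mult_le_mono1[of "Suc c" j q] assms(2) by simp
  then have "{t \<in> {..<j * q}. t div q = c} = {c * q..<c * q + q}"
    unfolding iff by auto
  then show ?thesis by simp
qed

text \<open>Each of the \<open>k\<close> chains covering \<open>P\<close> is the lower boundary of the up-set \<open>up i\<close>, shifted by
  \<open>(i, i)\<close>. A ray from the corner of the quadrant, with slope given by \<open>t / L\<close>, meets the cells of
  level \<open>j\<close> at position \<open>j * t div L\<close>; its first meeting with the up-sets is at a weakly increasing
  sequence of levels, and averaging the weights of these configurations over all rays gives exactly
  the number of points between \<open>up i\<close> and its shift by \<open>(1, 1)\<close>.\<close>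

lemma ray_average:
  fixes P :: "(nat \<times> nat) set"
  assumes "finite P"
    and chain: "\<And>C. \<lbrakk>C \<subseteq> P; finite C;
       \<And>c c'. \<lbrakk>c \<in> C; c' \<in> C; c \<noteq> c'\<rbrakk> \<Longrightarrow> fst c < fst c' \<and> snd c < snd c' \<or> fst c' < fst c \<and> snd c' < snd c\<rbrakk>
       \<Longrightarrow> card C \<le> k"
  obtains L :: nat and ss :: "nat \<Rightarrow> nat list" where "0 < L"
    "\<And>t. sorted (ss t)" "\<And>t. length (ss t) \<le> k"
    "\<And>x. x \<le> n \<Longrightarrow> L * card {a. a < x \<and> (a, x - 1 - a) \<in> P} \<le> (\<Sum>t<L. level_weight (ss t) x)"
proof -
  \<comment> \<open>A common multiple of all levels up to \<open>n\<close>, so that the averages are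
    exact on each of them.\<close>
  define L :: nat where "L = fact n"
  have L0: "0 < L" by (simp add: L_def)
  \<comment> \<open>The shift by \<open>(i, i)\<close> moves a block of order \<open>x\<close> to
    the level \<open>x - 2 * i\<close>, the number of its vectors not yet taken by \<open>i\<close>
    earlier paths.\<close>
  define up where "up i = {z. \<exists>z'\<in>chain_level P i. fst z' \<le> fst z + i \<and> snd z' \<le> snd z + i}" for i
  have up_mono: "z' \<in> up i" if "z \<in> up i" "fst z \<le> fst z'" "snd z \<le> snd z'" for z z' i
  proof -
    from that(1) obtain y where "y \<in> chain_level P i" "fst y \<le> fst z + i" "snd y \<le> snd z + i"
      by (auto simp: up_def)
    then show ?thesis using that(2,3) unfolding up_def by (intro CollectI bexI[of _ y]) auto
  qed
  have up_Suc: "up (Suc i) \<subseteq> up i" for i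
  proof
    fix z assume "z \<in> up (Suc i)"
    then obtain y where y: "y \<in> chain_level P (Suc i)" "fst y \<le> fst z + Suc i" "snd y \<le> snd z + Suc i"
      unfolding up_def by blast
    then obtain y' where "y' \<in> chain_level P i" "fst y' < fst y" "snd y' < snd y" by auto
    then show "z \<in> up i" unfolding up_def using y by (intro CollectI bexI[of _ y']) auto
  qed
  define V where "V i j = card {c. c < j \<and> (c, j - 1 - c) \<in> up i}" for i j
  define D where "D i x = {a. a < x \<and> (a, x - 1 - a) \<in> chain_level P i - chain_level P (Suc i)}" for i x
  \<comment> \<open>The points of height exactly \<open>i\<close>, shifted back, and the cells of
    \<open>up i\<close> two levels below, moved by \<open>(1, 1)\<close>, all lie in
    \<open>up i\<close>. They are disjoint, since a common cell would lie strictly above a point of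
    height \<open>i\<close> and so have greater height.\<close>
  have D: "card (D i x) + V i (x - 2 * i - 2) \<le> V i (x - 2 * i)" for i x
  proof -
    define j where "j = x - 2 * i"
    have sub1: "(\<lambda>a. a - i) ` D i x \<subseteq> {c. c < j \<and> (c, j - 1 - c) \<in> up i}"
    proof
      fix c assume "c \<in> (\<lambda>a. a - i) ` D i x"
      then obtain a where a: "c = a - i" "a < x" "(a, x - 1 - a) \<in> chain_level P i" by (auto simp: D_def)
      then have "i \<le> a" "i \<le> x - 1 - a" using chain_level_ge[of "(a, x - 1 - a)" P i] by auto
      then show "c \<in> {c. c < j \<and> (c, j - 1 - c) \<in> up i}"
        using a unfolding up_def j_def by (auto intro!: bexI[of _ "(a, x - 1 - a)"])
    qed
    have sub2: "Suc ` {c. c < j - 2 \<and> (c, j - 2 - 1 - c) \<in> up i} \<subseteq> {c. c < j \<and> (c, j - 1 - c) \<in> up i}"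
    proof
      fix c assume "c \<in> Suc ` {c. c < j - 2 \<and> (c, j - 2 - 1 - c) \<in> up i}"
      then obtain d where d: "c = Suc d" "d < j - 2" "(d, j - 2 - 1 - d) \<in> up i" by auto
      then show "c \<in> {c. c < j \<and> (c, j - 1 - c) \<in> up i}" using up_mono[OF d(3), of "(c, j - 1 - c)"] by auto
    qed
    have disj: "(\<lambda>a. a - i) ` D i x \<inter> Suc ` {c. c < j - 2 \<and> (c, j - 2 - 1 - c) \<in> up i} = {}"
    proof (rule ccontr)
      assume "\<not> ?thesis"
      then obtain a d where a: "a - i = Suc d" "a \<in> D i x" and d: "d < j - 2" "(d, j - 2 - 1 - d) \<in> up i"
        by auto
      have lev: "(a, x - 1 - a) \<in> chain_level P i" "(a, x - 1 - a) \<notin> chain_level P (Suc i)" "a < x"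
        using a(2) by (auto simp: D_def)
      from d(2) obtain y where y: "y \<in> chain_level P i" "fst y \<le> d + i" "snd y \<le> j - 2 - 1 - d + i"
        by (auto simp: up_def)
      have "fst y < a" "snd y < x - 1 - a"
        using y a(1) d(1) by (auto simp: j_def)
      then have "(a, x - 1 - a) \<in> chain_level P (Suc i)"
        using y(1) lev(1) chain_level_subset[of P i] by auto
      then show False using lev(2) by simp
    qed
    have inj: "inj_on (\<lambda>a. a - i) (D i x)"
    proof (rule inj_onI)
      fix a a' assume "a \<in> D i x" "a' \<in> D i x" "a - i = a' - i"
      moreover have "i \<le> b" if "b \<in> D i x" for b
        using that chain_level_ge[of "(b, x - 1 - b)" P i] by (auto simp: D_def)
      ultimately show "a = a'" by (metis le_add_diff_inverse)
    qed
    have "card ((\<lambda>a. a - i) ` D i x \<union> Suc ` {c. c < j - 2 \<and> (c, j - 2 - 1 - c) \<in> up i}) \<le> V i j"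
      unfolding V_def by (rule card_mono) (use sub1 sub2 in auto)
    moreover have "finite (D i x)" by (simp add: D_def)
    ultimately show ?thesis
      using disj inj by (subst (asm) card_Un_disjoint) (auto simp: card_image V_def j_def)
  qed
  have empty: "chain_level P i = {}" if "k \<le> i" for i
  proof (rule ccontr)
    assume "chain_level P i \<noteq> {}"
    then obtain z where "z \<in> chain_level P i" by auto
    from chain_level_chain[OF this] obtain C where C: "C \<subseteq> P" "finite C" "card C = Suc i"
      "\<And>c c'. \<lbrakk>c \<in> C; c' \<in> C; c \<noteq> c'\<rbrakk> \<Longrightarrow> fst c < fst c' \<and> snd c < snd c' \<or> fst c' < fst c \<and> snd c' < snd c"
      by blast
    show False using chain[OF C(1,2,4)] C(3) that by simp
  qed
  have cover: "{a. a < x \<and> (a, x - 1 - a) \<in> P} \<subseteq> (\<Union>i<k. D i x)" for x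
  proof
    fix a assume "a \<in> {a. a < x \<and> (a, x - 1 - a) \<in> P}"
    then have a: "a < x" "(a, x - 1 - a) \<in> P" by auto
    define i where "i = (LEAST i. (a, x - 1 - a) \<notin> chain_level P i)"
    have notin: "(a, x - 1 - a) \<notin> chain_level P i"
      unfolding i_def by (rule LeastI[of _ k]) (simp add: empty)
    then have "i \<noteq> 0" using a(2) by (cases i) auto
    then obtain i' where i': "i = Suc i'" by (cases i) auto
    have "i \<le> k" unfolding i_def by (rule Least_le) (simp add: empty)
    moreover have "(a, x - 1 - a) \<in> chain_level P i'"
      using not_less_Least[of i' "\<lambda>i. (a, x - 1 - a) \<notin> chain_level P i"] i' by (simp add: i_def)
    ultimately show "a \<in> (\<Union>i<k. D i x)" using a notin i' by (auto simp: D_def intro!: bexI[of _ i'])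
  qed
  define R where "R i j t \<longleftrightarrow> 0 < j \<and> (j * t div L, j - 1 - j * t div L) \<in> up i" for i j t
  have pos_less: "j * t div L < j" if "t < L" "0 < j" for j t
    using that L0 by (simp add: less_mult_imp_div_less)
  \<comment> \<open>From one level to the next the position on the ray grows by 0 or 1, so neither
    coordinate of its cell decreases and the ray stays in the up-set.\<close>
  have R_Suc: "R i (Suc j) t" if "R i j t" "t < L" for i j t
  proof -
    have "Suc j * t div L \<le> (j * t + L) div L" using that(2) by (intro div_le_mono) simp
    also have "\<dots> = Suc (j * t div L)" using L0 by simp
    finally have le: "Suc j * t div L \<le> Suc (j * t div L)" .
    have ge: "j * t div L \<le> Suc j * t div L" by (intro div_le_mono) simp
    have "j * t div L < j" using pos_less that by (simp add: R_def)
    then show ?thesis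
      using that(1) le ge up_mono[of "(j * t div L, j - 1 - j * t div L)" i "(Suc j * t div L, j - Suc j * t div L)"]
      by (simp add: R_def)
  qed
  have R_mono: "R i j' t" if "R i j t" "j \<le> j'" "t < L" for i j j' t
    using that(2,1) by (induction j' rule: dec_induct) (use that(3) R_Suc in auto)
  have R_anti: "R i j t" if "R (Suc i) j t" for i j t using that up_Suc by (auto simp: R_def)
  have count: "(\<Sum>t<L. if R i j t then j else 0) = L * V i j" if "j \<le> n" for i j
  proof (cases "j = 0")
    case False
    have "j dvd L" unfolding L_def using that False by (intro dvd_fact) auto
    then obtain q where q: "L = j * q" by auto
    have q0: "0 < q" using L0 q by (cases q) auto
    have pos: "j * t div L = t div q" for t unfolding q using False by simp
    have div_less: "t div q < j" if "t < L" for t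
      using pos_less[OF that, of j] False unfolding pos by simp
    have "(\<Sum>t<L. if R i j t then j else 0) = j * card {t \<in> {..<L}. R i j t}"
      by (simp add: sum.If_cases Int_def)
    also have "{t \<in> {..<L}. R i j t} = (\<Union>c\<in>{c. c < j \<and> (c, j - 1 - c) \<in> up i}. {t \<in> {..<j * q}. t div q = c})"
      using False div_less unfolding R_def pos q[symmetric] by auto
    also have "card \<dots> = (\<Sum>c\<in>{c. c < j \<and> (c, j - 1 - c) \<in> up i}. card {t \<in> {..<j * q}. t div q = c})"
      by (rule card_UN_disjoint) auto
    also have "\<dots> = (\<Sum>c\<in>{c. c < j \<and> (c, j - 1 - c) \<in> up i}. q)"
      using card_div_fiber[OF q0] by (intro sum.cong) (simp_all only: mem_Collect_eq)
    finally show ?thesis by (simp add: V_def q)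
  qed (simp add: R_def V_def)
  define ex where "ex i t \<longleftrightarrow> (\<exists>j\<le>n. R i j t)" for i t
  define len where "len t = (LEAST i. i = k \<or> \<not> ex i t)" for t
  define s where "s i t = (LEAST j. R i j t)" for i t
  define ss where "ss t = (if t < L then map (\<lambda>i. s i t) [0..<len t] else [])" for t
  have len_le: "len t \<le> k" for t unfolding len_def by (rule Least_le) simp
  have ex_less: "ex i t" if "i < len t" for i t
    using not_less_Least[of i "\<lambda>i. i = k \<or> \<not> ex i t"] that by (simp add: len_def)
  have ex_anti: "ex i t" if "ex i' t" "i \<le> i'" for i i' t
    using that(2,1) by (induction i rule: inc_induct) (use R_anti in \<open>auto simp: ex_def\<close>)
  have not_ex: "\<not> ex i t" if "len t \<le> i" "i < k" for i t
  proof -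
    have "len t = k \<or> \<not> ex (len t) t" unfolding len_def by (rule LeastI[of _ k]) simp
    then show ?thesis using that ex_anti[of i t "len t"] by auto
  qed
  have s_least: "R i (s i t) t" "\<And>j. R i j t \<Longrightarrow> s i t \<le> j" if "ex i t" for i t
  proof -
    from that obtain j where "R i j t" by (auto simp: ex_def)
    then show "R i (s i t) t" unfolding s_def by (rule LeastI)
    show "s i t \<le> j" if "R i j t" for j using that unfolding s_def by (rule Least_le)
  qed
  have sorted: "sorted (ss t)" for t
  proof (cases "t < L")
    case True
    have "s i t \<le> s i' t" if "i \<le> i'" "i' < len t" for i i'
      using that
    proof (induction i' rule: dec_induct)
      case (step i')
      have "R i' (s (Suc i') t) t" using s_least(1)[OF ex_less[OF step.prems]] R_anti by blast
      then have "s i' t \<le> s (Suc i') t" using s_least(2)[of i' t] ex_less[of i' t] step.prems by simp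
      then show ?case using step by simp
    qed simp
    then show ?thesis using True by (simp add: ss_def sorted_iff_nth_mono)
  qed (simp add: ss_def)
  define lt where "lt x i t = (if i < len t then level_term x i (s i t) else 0)" for x i t
  have weight: "level_weight (ss t) x = (\<Sum>i<k. lt x i t)" if "t < L" for t x
  proof -
    have "level_weight (ss t) x = (\<Sum>i<len t. lt x i t)"
      unfolding level_weight_sum[OF sorted] using that by (simp add: ss_def lt_def)
    also have "\<dots> = (\<Sum>i<k. lt x i t)" using len_le by (intro sum.mono_neutral_left) (auto simp: lt_def)
    finally show ?thesis .
  qed
  \<comment> \<open>From level \<open>s i t\<close> on the ray is inside \<open>up i\<close>. So
    \<open>level_term\<close> is what is gained between level \<open>x - 2 * i - 2\<close> and level
    \<open>x - 2 * i\<close>: everything on the first two levels inside, then 2.\<close>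
  have step: "(if R i (x - 2 * i) t then x - 2 * i else 0)
      \<le> lt x i t + (if R i (x - 2 * i - 2) t then x - 2 * i - 2 else 0)"
    if "i < k" "x \<le> n" "t < L" for i x t
  proof (cases "R i (x - 2 * i) t")
    case True
    then have "ex i t" unfolding ex_def using that(2) by (intro exI[of _ "x - 2 * i"]) auto
    then have i: "i < len t" using not_ex[of t i] that(1) by (meson not_less)
    have "s i t \<le> x - 2 * i" using s_least(2)[OF \<open>ex i t\<close>] True by blast
    moreover have "0 < s i t" using s_least(1)[OF \<open>ex i t\<close>] by (simp add: R_def)
    moreover have "R i (x - 2 * i - 2) t" if "s i t + 2 \<le> x - 2 * i"
      using R_mono[OF s_least(1)[OF \<open>ex i t\<close>]] that \<open>t < L\<close> by simp
    ultimately show ?thesis using True i by (auto simp: lt_def level_term_def)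
  qed simp
  have main: "L * card (D i x) \<le> (\<Sum>t<L. lt x i t)" if "i < k" "x \<le> n" for i x
  proof -
    have "L * card (D i x) + L * V i (x - 2 * i - 2) \<le> L * V i (x - 2 * i)"
      using mult_le_mono2[OF D[of i x], of L] by (simp add: distrib_left)
    also have "\<dots> = (\<Sum>t<L. if R i (x - 2 * i) t then x - 2 * i else 0)" using that by (simp add: count)
    also have "\<dots> \<le> (\<Sum>t<L. lt x i t + (if R i (x - 2 * i - 2) t then x - 2 * i - 2 else 0))"
      using step[OF that] by (intro sum_mono) auto
    also have "\<dots> = (\<Sum>t<L. lt x i t) + L * V i (x - 2 * i - 2)"
      using that count[of "x - 2 * i - 2" i] by (simp add: sum.distrib)
    finally show ?thesis by simp
  qed
  show thesis
  proof (rule that[OF L0, of ss])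
    fix x assume x: "x \<le> n"
    have "card {a. a < x \<and> (a, x - 1 - a) \<in> P} \<le> card (\<Union>i<k. D i x)"
      using cover by (intro card_mono) (auto simp: D_def)
    also have "\<dots> \<le> (\<Sum>i<k. card (D i x))" by (rule card_UN_le) simp
    finally have "L * card {a. a < x \<and> (a, x - 1 - a) \<in> P} \<le> (\<Sum>i<k. L * card (D i x))"
      by (simp add: sum_distrib_left[symmetric])
    also have "\<dots> \<le> (\<Sum>i<k. \<Sum>t<L. lt x i t)" using main x by (intro sum_mono) auto
    also have "\<dots> = (\<Sum>t<L. level_weight (ss t) x)"
      by (subst sum.swap) (simp add: weight)
    finally show "L * card {a. a < x \<and> (a, x - 1 - a) \<in> P} \<le> (\<Sum>t<L. level_weight (ss t) x)" .
  qed (use sorted len_le in \<open>auto simp: ss_def\<close>)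
qed

text \<open>The averages over the same family of rays hold for all orders simultaneously and can be
  summed over the blocks; some ray is at least as good as the average.\<close>

lemma card_le_config_weight:
  fixes B :: "nat list" and X :: "(nat \<times> nat) set"
  assumes X: "X \<subseteq> {(j, a). j < length B \<and> a < B ! j}"
    and width: "\<And>A. \<lbrakk>A \<subseteq> X; \<And>j a j' a'. \<lbrakk>(j, a) \<in> A; (j', a') \<in> A; (j, a) \<noteq> (j', a')\<rbrakk> \<Longrightarrow>
       a < a' \<and> B ! j - 1 - a < B ! j' - 1 - a' \<or> a' < a \<and> B ! j' - 1 - a' < B ! j - 1 - a\<rbrakk> \<Longrightarrow> card A \<le> k"
  shows "\<exists>ss. sorted ss \<and> length ss \<le> k \<and> card X \<le> config_weight B ss"
proof -
  \<comment> \<open>A block of order \<open>x\<close> becomes the antidiagonal of coordinate sum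
    \<open>x - 1\<close>. Blocks of equal order are superimposed, so a chain in the image is lifted
    by choosing preimages.\<close>
  define f where "f = (\<lambda>(j, a). (a, B ! j - 1 - a))"
  define n where "n = sum_list B"
  have fin: "finite X"
  proof (rule finite_subset[OF X])
    have "{(j, a). j < length B \<and> a < B ! j} = (SIGMA j:{..<length B}. {..<B ! j})" by auto
    then show "finite {(j, a). j < length B \<and> a < B ! j}" by simp
  qed
  have chain: "card C \<le> k" if C: "C \<subseteq> f ` X"
    "\<And>c c'. \<lbrakk>c \<in> C; c' \<in> C; c \<noteq> c'\<rbrakk> \<Longrightarrow> fst c < fst c' \<and> snd c < snd c' \<or> fst c' < fst c \<and> snd c' < snd c" for C
  proof -
    obtain A where A: "A \<subseteq> X" "inj_on f A" "C = f ` A" using C(1) by (meson subset_image_inj)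
    have "card A \<le> k"
    proof (rule width[OF A(1)])
      fix j a j' a' assume as: "(j, a) \<in> A" "(j', a') \<in> A" "(j, a) \<noteq> (j', a')"
      then have "f (j, a) \<noteq> f (j', a')" "f (j, a) \<in> C" "f (j', a') \<in> C"
        using A(2,3) by (auto dest: inj_onD)
      then show "a < a' \<and> B ! j - 1 - a < B ! j' - 1 - a' \<or> a' < a \<and> B ! j' - 1 - a' < B ! j - 1 - a"
        using C(2)[of "f (j, a)" "f (j', a')"] by (simp add: f_def)
    qed
    then show ?thesis using A by (simp add: card_image)
  qed
  obtain L ss where L: "0 < L" and ss: "\<And>t. sorted (ss t)" "\<And>t. length (ss t) \<le> k"
    and avg: "\<And>x. x \<le> n \<Longrightarrow> L * card {a. a < x \<and> (a, x - 1 - a) \<in> f ` X} \<le> (\<Sum>t<L. level_weight (ss t) x)"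
    by (rule ray_average[of "f ` X" k n]) (use fin chain in auto)
  have "X \<subseteq> (SIGMA j:{..<length B}. {a. a < B ! j \<and> (a, B ! j - 1 - a) \<in> f ` X})"
    using X by (force simp: f_def)
  then have "card X \<le> card (SIGMA j:{..<length B}. {a. a < B ! j \<and> (a, B ! j - 1 - a) \<in> f ` X})"
    by (rule card_mono[rotated]) auto
  also have "\<dots> = (\<Sum>j<length B. card {a. a < B ! j \<and> (a, B ! j - 1 - a) \<in> f ` X})"
    by (rule card_SigmaI) auto
  finally have "L * card X \<le> (\<Sum>j<length B. L * card {a. a < B ! j \<and> (a, B ! j - 1 - a) \<in> f ` X})"
    by (simp add: sum_distrib_left[symmetric])
  also have "\<dots> \<le> (\<Sum>j<length B. \<Sum>t<L. level_weight (ss t) (B ! j))"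
    by (intro sum_mono avg) (auto simp: n_def member_le_sum_list)
  also have "\<dots> = (\<Sum>t<L. config_weight B (ss t))"
    by (subst sum.swap) (simp add: config_weight_def sum_list_sum_nth atLeast0LessThan)
  finally have total: "L * card X \<le> (\<Sum>t<L. config_weight B (ss t))" .
  have "\<exists>t. card X \<le> config_weight B (ss t)"
  proof (rule ccontr)
    assume "\<not> ?thesis"
    then have "config_weight B (ss t) < card X" for t by (meson not_le)
    then have "(\<Sum>t<L. config_weight B (ss t)) < (\<Sum>t<L. card X)"
      using L by (intro sum_strict_mono) auto
    then show False using total by simp
  qed
  then show ?thesis using ss by blast
qed

section \<open>Minors of powers\<close>

text \<open>The rank is at least \<open>r\<close>. Arbitrary \<open>L\<close> and \<open>R\<close>
  instead of a choice of rows and columns make invariance under similarity immediate, and for fixed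
  \<open>L\<close> and \<open>R\<close> the condition is polynomial in the entries.\<close>

definition has_minor :: "nat \<Rightarrow> nat \<Rightarrow> 'a :: field mat \<Rightarrow> bool" where
  "has_minor n r A \<longleftrightarrow> (\<exists>L \<in> carrier_mat r n. \<exists>R \<in> carrier_mat n r. det (L * A * R) \<noteq> 0)"

lemma det_mult_small:
  fixes X Y :: "'a :: field mat"
  assumes X: "X \<in> carrier_mat r c" and Y: "Y \<in> carrier_mat c r" and "c < r"
  shows "det (X * Y) = 0"
proof -
  define X' where "X' = mat r r (\<lambda>(i, j). if j < c then X $$ (i, j) else 0)"
  define Y' where "Y' = mat r r (\<lambda>(i, j). if i < c then Y $$ (i, j) else 0)"
  have "X * Y = X' * Y'"
  proof (rule eq_matI)
    fix i j assume ij: "i < dim_row (X' * Y')" "j < dim_col (X' * Y')"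
    then have ij': "i < r" "j < r" by (auto simp: X'_def Y'_def)
    have "(X' * Y') $$ (i, j) = (\<Sum>k<r. (if k < c then X $$ (i, k) else 0) * (if k < c then Y $$ (k, j) else 0))"
      using ij' by (simp add: X'_def Y'_def scalar_prod_def atLeast0LessThan)
    also have "\<dots> = (\<Sum>k<c. X $$ (i, k) * Y $$ (k, j))"
      using \<open>c < r\<close> by (intro sum.mono_neutral_cong_right) auto
    also have "\<dots> = (X * Y) $$ (i, j)"
      using ij' X Y by (simp add: scalar_prod_def atLeast0LessThan)
    finally show "(X * Y) $$ (i, j) = (X' * Y') $$ (i, j)" by simp
  qed (use X Y in \<open>auto simp: X'_def Y'_def\<close>)
  moreover have "det X' = 0"
  proof -
    have X': "X' \<in> carrier_mat r r" by (simp add: X'_def)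
    have "X' *\<^sub>v unit_vec r c = 0\<^sub>v r"
      using \<open>c < r\<close> by (intro eq_vecI) (auto simp: X'_def)
    moreover have "unit_vec r c \<noteq> (0\<^sub>v r :: 'a vec)"
    proof
      assume "unit_vec r c = (0\<^sub>v r :: 'a vec)"
      then have "unit_vec r c $ c = (0\<^sub>v r :: 'a vec) $ c" by simp
      then show False using \<open>c < r\<close> by simp
    qed
    ultimately show ?thesis unfolding det_0_iff_vec_prod_zero[OF X']
      by (intro exI[of _ "unit_vec r c"]) simp
  qed
  moreover have "X' \<in> carrier_mat r r" "Y' \<in> carrier_mat r r" by (auto simp: X'_def Y'_def)
  ultimately show ?thesis by (simp add: det_mult)
qed

lemma has_minor_factor:
  fixes A P Q :: "'a :: field mat"
  assumes "has_minor n r A" "A = P * Q" "P \<in> carrier_mat n c" "Q \<in> carrier_mat c n"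
  shows "r \<le> c"
proof (rule ccontr)
  assume "\<not> r \<le> c"
  obtain L R where LR: "L \<in> carrier_mat r n" "R \<in> carrier_mat n r" "det (L * A * R) \<noteq> 0"
    using assms(1) by (auto simp: has_minor_def)
  have "L * A = L * P * Q" unfolding assms(2) by (rule assoc_mult_mat[symmetric, OF LR(1) assms(3,4)])
  then have "L * A * R = (L * P) * (Q * R)"
    using assoc_mult_mat[OF mult_carrier_mat[OF LR(1) assms(3)] assms(4) LR(2)] by simp
  moreover have "L * P \<in> carrier_mat r c" "Q * R \<in> carrier_mat c r" using LR assms(3,4) by auto
  ultimately show False using det_mult_small[of "L * P" r c "Q * R"] LR(3) \<open>\<not> r \<le> c\<close> by simp
qed

lemma has_minor_similar_wit:
  fixes A B P Q :: "'a :: field mat"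
  assumes "similar_mat_wit A B P Q" "A \<in> carrier_mat n n" "has_minor n r A"
  shows "has_minor n r B"
proof -
  note w = similar_mat_witD2[OF assms(2,1)]
  obtain L R where LR: "L \<in> carrier_mat r n" "R \<in> carrier_mat n r" "det (L * A * R) \<noteq> 0"
    using assms(3) by (auto simp: has_minor_def)
  have "L * A = L * (P * B) * Q"
    unfolding w(3) by (rule assoc_mult_mat[symmetric, OF LR(1) mult_carrier_mat[OF w(6,5)] w(7)])
  also have "L * (P * B) = L * P * B"
    by (rule assoc_mult_mat[symmetric, OF LR(1) w(6,5)])
  finally have "L * A * R = (L * P) * B * (Q * R)"
    using assoc_mult_mat[OF mult_carrier_mat[OF mult_carrier_mat[OF LR(1) w(6)] w(5)] w(7) LR(2)] by simp
  moreover have "L * P \<in> carrier_mat r n" "Q * R \<in> carrier_mat n r" using LR w by auto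
  ultimately show ?thesis using LR(3) unfolding has_minor_def by metis
qed

lemma has_minor_similar_pow:
  fixes A B :: "'a :: field mat"
  assumes "similar_mat A B" "A \<in> carrier_mat n n"
  shows "has_minor n r (A ^\<^sub>m m) \<longleftrightarrow> has_minor n r (B ^\<^sub>m m)"
proof -
  have imp: "has_minor n r (Y ^\<^sub>m m)"
    if sim: "similar_mat X Y" and "X \<in> carrier_mat n n" "has_minor n r (X ^\<^sub>m m)" for X Y :: "'a mat"
  proof -
    obtain P Q where "similar_mat_wit X Y P Q" using sim by (auto simp: similar_mat_def)
    from similar_mat_wit_pow[OF this, of m] show ?thesis
      using that by (intro has_minor_similar_wit[of "X ^\<^sub>m m" "Y ^\<^sub>m m" P Q]) auto
  qed
  have "B \<in> carrier_mat n n" using assms by (auto simp: similar_mat_def similar_mat_wit_def Let_def)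
  then show ?thesis using imp[of A B] imp[of B A] assms similar_mat_sym[OF assms(1)] by blast
qed

text \<open>A layered cut: a walk of length \<open>m\<close> must meet some \<open>y \<in> V - Z\<close> exactly at the step \<open>H y\<close>,
  where \<open>H\<close> is the largest time \<open>\<tau>\<close> below \<open>y\<close>. So \<open>A ^ m\<close> factors through \<open>V - Z\<close>.\<close>

lemma has_minor_pow_cut:
  fixes A :: "'a :: field mat" and V :: "'v set" and b :: "'v \<Rightarrow> nat \<Rightarrow> 'a" and r :: "'v \<Rightarrow> 'v \<Rightarrow> bool"
  assumes A: "A \<in> carrier_mat n n" and "finite V"
    and trans: "\<And>x y z. r x y \<Longrightarrow> r y z \<Longrightarrow> r x z"
    and step: "\<And>v i. \<lbrakk>v \<in> V; i < n\<rbrakk> \<Longrightarrow> (\<Sum>l<n. A $$ (i, l) * b v l) = (\<Sum>w\<in>V. C w v * b w i)"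
    and strict: "\<And>v w. \<lbrakk>v \<in> V; w \<in> V; C w v \<noteq> 0\<rbrakk> \<Longrightarrow> r v w"
    and span: "\<And>x i. \<lbrakk>x < n; i < n\<rbrakk> \<Longrightarrow> (if i = x then 1 else 0) = (\<Sum>v\<in>V. b v i * q v x)"
    and Z: "Z \<subseteq> V" "\<And>v. v \<in> Z \<Longrightarrow> 1 \<le> \<tau> v \<and> \<tau> v \<le> m"
      "\<And>v w. \<lbrakk>v \<in> Z; w \<in> Z; r v w\<rbrakk> \<Longrightarrow> \<tau> v < (\<tau> w :: nat)"
    and minor: "has_minor n \<rho> (A ^\<^sub>m m)"
  shows "\<rho> + card Z \<le> card V"
proof -
  define H where "H v = Max (insert 0 (\<tau> ` {z \<in> Z. z = v \<or> r z v}))" for v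
  have finZ: "finite Z" using Z(1) \<open>finite V\<close> by (rule finite_subset)
  then have fin: "finite (insert 0 (\<tau> ` {z \<in> Z. z = v \<or> r z v}))" for v by simp
  have H_ge: "\<tau> z \<le> H v" if "z \<in> Z" "z = v \<or> r z v" for z v
    unfolding H_def using that fin by (intro Max_ge) auto
  have H_in: "H v = 0 \<or> (\<exists>z\<in>Z. (z = v \<or> r z v) \<and> H v = \<tau> z)" for v
    using Max_in[OF fin[of v]] by (auto simp: H_def[symmetric])
  have H_le: "H v \<le> m" for v using H_in[of v] Z(2) by force
  have H_mono: "H v \<le> H w" if "r v w" for v w
    using H_in[of v] H_ge[of _ w] trans[of _ v w] that by force
  have H_strict: "H v < H w" if "r v w" "w \<in> Z" for v w
  proof (cases "H v = 0")
    case True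
    then show ?thesis using H_ge[of w w] Z(2)[of w] that by force
  next
    case False
    then obtain z where z: "z \<in> Z" "z = v \<or> r z v" "H v = \<tau> z" using H_in[of v] by auto
    then have "r z w" using that trans by blast
    then show ?thesis using Z(3)[of z w] z that H_ge[of w w] by force
  qed
  define Y where "Y = V - Z"
  have finY: "finite Y" using \<open>finite V\<close> by (simp add: Y_def)
  define op where "op k v i = (\<Sum>l<n. (A ^\<^sub>m k) $$ (i, l) * b v l)" for k v i
  have op_Suc: "op (Suc k) v i = (\<Sum>w\<in>V. C w v * op k w i)" if "v \<in> V" "i < n" for k v i
  proof -
    have "op (Suc k) v i = (\<Sum>l<n. (\<Sum>j<n. (A ^\<^sub>m k) $$ (i, j) * A $$ (j, l)) * b v l)"
      unfolding op_def using A that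
      by (intro sum.cong refl) (simp add: scalar_prod_def atLeast0LessThan)
    also have "\<dots> = (\<Sum>l<n. \<Sum>j<n. (A ^\<^sub>m k) $$ (i, j) * (A $$ (j, l) * b v l))"
      by (simp only: sum_distrib_right mult.assoc)
    also have "\<dots> = (\<Sum>j<n. \<Sum>l<n. (A ^\<^sub>m k) $$ (i, j) * (A $$ (j, l) * b v l))" by (rule sum.swap)
    also have "\<dots> = (\<Sum>j<n. (A ^\<^sub>m k) $$ (i, j) * (\<Sum>w\<in>V. C w v * b w j))"
      using step that by (intro sum.cong refl) (simp add: sum_distrib_left[symmetric])
    also have "\<dots> = (\<Sum>j<n. \<Sum>w\<in>V. C w v * ((A ^\<^sub>m k) $$ (i, j) * b w j))"
      by (simp only: sum_distrib_left mult.left_commute)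
    also have "\<dots> = (\<Sum>w\<in>V. \<Sum>j<n. C w v * ((A ^\<^sub>m k) $$ (i, j) * b w j))" by (rule sum.swap)
    also have "\<dots> = (\<Sum>w\<in>V. C w v * op k w i)" by (simp only: op_def sum_distrib_left)
    finally show ?thesis .
  qed
  \<comment> \<open>The image of the basis vector of \<open>y\<close> under the part of the walk
    that remains after the time \<open>H y\<close> of its cut. These vectors will span the image of
    \<open>A ^ m\<close>.\<close>
  define W where "W y i = op (m - H y) y i" for y i
  define good where "good k v \<longleftrightarrow> (\<exists>c. \<forall>i<n. op k v i = (\<Sum>y\<in>Y. c y * W y i))" for k v
  have good_W: "good (m - H y) y" if "y \<in> Y" for y
    unfolding good_def using finY that
    by (intro exI[of _ "\<lambda>z. if z = y then 1 else 0"]) (simp add: W_def if_distrib[of "\<lambda>x. x * _"] cong: if_cong)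
  have good_above: "good (m - s) v" if "v \<in> V" "s \<le> m" "s < H v" for s v
    using that(2,1,3)
  proof (induction s arbitrary: v rule: inc_induct)
    case base
    then show ?case using H_le[of v] by simp
  next
    case (step s)
    have "\<exists>c. \<forall>i<n. C w v * op (m - Suc s) w i = (\<Sum>y\<in>Y. c y * W y i)" if w: "w \<in> V" for w
    proof (cases "C w v = 0")
      case False
      then have r: "r v w" using strict step.prems w by auto
      have "good (m - Suc s) w"
      proof (cases "Suc s < H w")
        case True
        then show ?thesis using step.IH w by simp
      next
        case F2: False
        \<comment> \<open>The walk reaches \<open>w\<close> exactly at the time \<open>H w\<close>,
          and \<open>H\<close> did not increase on the last step. It would have increased if
          \<open>w\<close> were in \<open>Z\<close>, so this is where the walk meets the
          cut.\<close>
        then have eq: "H w = Suc s" using H_mono[OF r] step.prems by simp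
        have "w \<notin> Z" using H_strict[OF r] eq step.prems by auto
        then show ?thesis using good_W[of w] w eq by (simp add: Y_def)
      qed
      then obtain c where "\<forall>i<n. op (m - Suc s) w i = (\<Sum>y\<in>Y. c y * W y i)" by (auto simp: good_def)
      then show ?thesis
        by (intro exI[of _ "\<lambda>y. C w v * c y"]) (simp add: sum_distrib_left mult.assoc)
    qed (auto intro: exI[of _ "\<lambda>_. 0"])
    then have "\<forall>w\<in>V. \<exists>c. \<forall>i<n. C w v * op (m - Suc s) w i = (\<Sum>y\<in>Y. c y * W y i)" by blast
    from bchoice[OF this] obtain c
      where c: "\<forall>w\<in>V. \<forall>i<n. C w v * op (m - Suc s) w i = (\<Sum>y\<in>Y. c w y * W y i)" by blast
    have ms: "m - s = Suc (m - Suc s)" using step by simp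
    have "op (m - s) v i = (\<Sum>y\<in>Y. (\<Sum>w\<in>V. c w y) * W y i)" if i: "i < n" for i
    proof -
      have "op (m - s) v i = (\<Sum>w\<in>V. C w v * op (m - Suc s) w i)"
        unfolding ms using i step.prems(1) by (rule op_Suc[rotated])
      also have "\<dots> = (\<Sum>w\<in>V. \<Sum>y\<in>Y. c w y * W y i)" using c i by (intro sum.cong refl) blast
      also have "\<dots> = (\<Sum>y\<in>Y. \<Sum>w\<in>V. c w y * W y i)" by (rule sum.swap)
      finally show ?thesis by (simp only: sum_distrib_right)
    qed
    then show ?case unfolding good_def by (intro exI[of _ "\<lambda>y. \<Sum>w\<in>V. c w y"]) blast
  qed
  have "good m v" if "v \<in> V" for v
  proof (cases "H v = 0")
    case True
    then have "v \<notin> Z" using H_ge[of v v] Z(2)[of v] by force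
    then show ?thesis using good_W[of v] that True by (simp add: Y_def)
  qed (use good_above[of v 0] that in auto)
  then have "\<forall>v\<in>V. \<exists>c. \<forall>i<n. op m v i = (\<Sum>y\<in>Y. c y * W y i)" unfolding good_def by blast
  from bchoice[OF this] obtain c
    where c: "\<forall>v\<in>V. \<forall>i<n. op m v i = (\<Sum>y\<in>Y. c v y * W y i)" by blast
  obtain e where e: "bij_betw e {0..<card Y} Y" using ex_bij_betw_nat_finite[OF finY] by blast
  define P where "P = mat n (card Y) (\<lambda>(i, k). W (e k) i)"
  define S where "S = mat (card Y) n (\<lambda>(k, x). \<Sum>v\<in>V. c v (e k) * q v x)"
  have "A ^\<^sub>m m = P * S"
  proof (rule eq_matI)
    fix i x assume "i < dim_row (P * S)" "x < dim_col (P * S)"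
    then have ix: "i < n" "x < n" by (auto simp: P_def S_def)
    have "(A ^\<^sub>m m) $$ (i, x) = (\<Sum>l<n. (A ^\<^sub>m m) $$ (i, l) * (if l = x then 1 else 0))"
      using ix by (simp add: if_distrib cong: if_cong)
    also have "\<dots> = (\<Sum>l<n. (A ^\<^sub>m m) $$ (i, l) * (\<Sum>v\<in>V. b v l * q v x))"
      using span ix by (intro sum.cong) auto
    also have "\<dots> = (\<Sum>l<n. \<Sum>v\<in>V. (A ^\<^sub>m m) $$ (i, l) * b v l * q v x)"
      by (simp only: sum_distrib_left mult.assoc)
    also have "\<dots> = (\<Sum>v\<in>V. \<Sum>l<n. (A ^\<^sub>m m) $$ (i, l) * b v l * q v x)" by (rule sum.swap)
    also have "\<dots> = (\<Sum>v\<in>V. op m v i * q v x)" by (simp only: op_def sum_distrib_right)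
    also have "\<dots> = (\<Sum>v\<in>V. \<Sum>y\<in>Y. W y i * (c v y * q v x))"
      using c ix by (intro sum.cong refl) (simp add: sum_distrib_left mult_ac)
    also have "\<dots> = (\<Sum>y\<in>Y. \<Sum>v\<in>V. W y i * (c v y * q v x))" by (rule sum.swap)
    also have "\<dots> = (\<Sum>y\<in>Y. W y i * (\<Sum>v\<in>V. c v y * q v x))" by (simp only: sum_distrib_left)
    also have "\<dots> = (\<Sum>k\<in>{0..<card Y}. W (e k) i * (\<Sum>v\<in>V. c v (e k) * q v x))"
      using sum.reindex_bij_betw[OF e] by (rule sym)
    also have "\<dots> = (P * S) $$ (i, x)" using ix by (simp add: P_def S_def scalar_prod_def)
    finally show "(A ^\<^sub>m m) $$ (i, x) = (P * S) $$ (i, x)" .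
  qed (use A in \<open>auto simp: P_def S_def\<close>)
  then have "\<rho> \<le> card Y"
    by (rule has_minor_factor[OF minor]) (auto simp: P_def S_def)
  moreover have "card Y = card V - card Z" unfolding Y_def using Z(1) finZ by (simp add: card_Diff_subset)
  moreover have "card Z \<le> card V" using Z(1) \<open>finite V\<close> by (simp add: card_mono)
  ultimately show ?thesis by simp
qed

lemma has_minor_selection:
  fixes M :: "'a :: field mat"
  assumes M: "M \<in> carrier_mat n n" and S: "S \<subseteq> {..<n}" and g: "inj_on g S" "g ` S \<subseteq> {..<n}"
    and col: "\<And>v i. v \<in> S \<Longrightarrow> i < n \<Longrightarrow> M $$ (i, v) = (if i = g v then 1 else 0)"
    and "r \<le> card S"
  shows "has_minor n r M"
proof -
  obtain S' where S': "S' \<subseteq> S" "card S' = r" "finite S'"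
    using obtain_subset_with_card_n[OF \<open>r \<le> card S\<close>] by blast
  obtain e where e: "bij_betw e {0..<r} S'" using ex_bij_betw_nat_finite[OF S'(3)] S'(2) by blast
  have eS: "e a \<in> S" "e a < n" "g (e a) < n" if "a < r" for a
  proof -
    have "e a \<in> S'" using e that by (auto dest!: bij_betwE)
    then show "e a \<in> S" "e a < n" "g (e a) < n" using S' S g(2) by auto
  qed
  define L :: "'a mat" where "L = mat r n (\<lambda>(a, i). if i = g (e a) then 1 else 0)"
  define R :: "'a mat" where "R = mat n r (\<lambda>(i, a). if i = e a then 1 else 0)"
  have "L * M * R = 1\<^sub>m r"
  proof (rule eq_matI)
    fix a c assume "a < dim_row (1\<^sub>m r :: 'a mat)" "c < dim_col (1\<^sub>m r :: 'a mat)"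
    then have ac: "a < r" "c < r" by auto
    have LM: "(L * M) $$ (a, v) = M $$ (g (e a), v)" if "v < n" for v
      using that ac eS[OF ac(1)] M
      by (simp add: L_def scalar_prod_def if_distrib[of "\<lambda>x. x * _"] cong: if_cong)
    have "(L * M * R) $$ (a, c) = (\<Sum>v\<in>{0..<n}. (L * M) $$ (a, v) * (if v = e c then 1 else 0))"
      using ac M by (simp add: L_def R_def scalar_prod_def)
    also have "\<dots> = M $$ (g (e a), e c)" using eS[OF ac(2)] LM by (simp add: if_distrib cong: if_cong)
    also have "\<dots> = (if g (e a) = g (e c) then 1 else 0)" using col eS ac by simp
    also have "g (e a) = g (e c) \<longleftrightarrow> a = c"
      using inj_onD[OF g(1)] eS ac inj_onD[OF bij_betw_imp_inj_on[OF e]] by (metis atLeastLessThan_iff le0)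
    finally show "(L * M * R) $$ (a, c) = 1\<^sub>m r $$ (a, c)" using ac by simp
  qed (use M in \<open>auto simp: L_def R_def\<close>)
  then show ?thesis unfolding has_minor_def
    by (intro bexI[of _ L] bexI[of _ R]) (auto simp: L_def R_def)
qed

lemma pow_mat_Suc_left:
  assumes M: "(M :: 'a :: semiring_1 mat) \<in> carrier_mat n n"
  shows "M ^\<^sub>m Suc m = M * M ^\<^sub>m m"
proof (induction m)
  case (Suc m)
  have "M ^\<^sub>m Suc (Suc m) = M * M ^\<^sub>m m * M" using Suc by simp
  also have "\<dots> = M * (M ^\<^sub>m m * M)" by (rule assoc_mult_mat[OF M pow_carrier_mat[OF M] M])
  finally show ?case by simp
qed (use M in simp)

text \<open>At most \<open>k\<close> elements of \<open>X\<close> have no successor, so each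
  multiplication by \<open>M\<close> loses at most \<open>k\<close> of the columns that are distinct
  unit vectors inside \<open>X\<close>. Only the columns in \<open>E\<close> are ever consulted; the
  others may be arbitrary.\<close>

lemma has_minor_partial_permutation_pow:
  fixes M :: "'a :: field mat"
  assumes M: "M \<in> carrier_mat n n" and X: "X \<subseteq> {..<n}" "E \<subseteq> X" "card X \<le> card E + k"
    and s: "inj_on s E" "s ` E \<subseteq> X"
    and col: "\<And>v i. v \<in> E \<Longrightarrow> i < n \<Longrightarrow> M $$ (i, v) = (if i = s v then 1 else 0)"
    and "r + k * m \<le> card X"
  shows "has_minor n r (M ^\<^sub>m m)"
proof -
  have fX: "finite X" using X(1) by (rule finite_subset) simp
  have "\<exists>S g. S \<subseteq> X \<and> inj_on g S \<and> g ` S \<subseteq> X \<and> card X \<le> card S + k * m \<and>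
    (\<forall>v\<in>S. \<forall>i<n. (M ^\<^sub>m m) $$ (i, v) = (if i = g v then 1 else 0))"
  proof (induction m)
    case 0
    show ?case by (intro exI[of _ X] exI[of _ id]) (use M X(1) in auto)
  next
    case (Suc m)
    then obtain S g where S: "S \<subseteq> X" "inj_on g S" "g ` S \<subseteq> X" "card X \<le> card S + k * m"
      "\<And>v i. v \<in> S \<Longrightarrow> i < n \<Longrightarrow> (M ^\<^sub>m m) $$ (i, v) = (if i = g v then 1 else 0)" by blast
    have fS: "finite S" using S(1) fX by (rule finite_subset)
    define S' where "S' = {v \<in> S. g v \<in> E}"
    have "card (S - S') \<le> card (X - E)"
      by (rule card_inj_on_le[of g]) (use S fX in \<open>auto simp: S'_def intro: inj_on_subset\<close>)
    moreover have "card (X - E) \<le> k"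
      using X fX by (simp add: card_Diff_subset finite_subset)
    moreover have "card (S - S') = card S - card S'" "card S' \<le> card S"
      using fS by (auto simp: S'_def intro!: card_Diff_subset card_mono)
    ultimately have "card X \<le> card S' + k * Suc m" using S(4) by simp
    moreover have "(M ^\<^sub>m Suc m) $$ (i, v) = (if i = (s \<circ> g) v then 1 else 0)" if "v \<in> S'" "i < n" for v i
    proof -
      have vn: "v < n" "g v < n" "v \<in> S" "g v \<in> E" using that S X by (auto simp: S'_def)
      have "M ^\<^sub>m Suc m = M * M ^\<^sub>m m" using M by (rule pow_mat_Suc_left)
      then have "(M ^\<^sub>m Suc m) $$ (i, v) = (\<Sum>j\<in>{0..<n}. M $$ (i, j) * (M ^\<^sub>m m) $$ (j, v))"
        using M that vn by (simp add: scalar_prod_def)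
      also have "\<dots> = (\<Sum>j\<in>{0..<n}. M $$ (i, j) * (if j = g v then 1 else 0))"
        using S(5) vn by (intro sum.cong) auto
      also have "\<dots> = M $$ (i, g v)" using vn by (simp add: if_distrib cong: if_cong)
      also have "\<dots> = (if i = (s \<circ> g) v then 1 else 0)" using col vn that by simp
      finally show ?thesis .
    qed
    moreover have "inj_on (s \<circ> g) S'"
      using S(2) s(1) by (intro comp_inj_on) (auto simp: S'_def intro: inj_on_subset)
    moreover have "(s \<circ> g) ` S' \<subseteq> X" "S' \<subseteq> X" using s(2) S(1) by (auto simp: S'_def)
    ultimately show ?case by blast
  qed
  then obtain S g where S: "S \<subseteq> X" "inj_on g S" "g ` S \<subseteq> X" "card X \<le> card S + k * m"
    "\<And>v i. v \<in> S \<Longrightarrow> i < n \<Longrightarrow> (M ^\<^sub>m m) $$ (i, v) = (if i = g v then 1 else 0)" by blast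
  show ?thesis
    by (rule has_minor_selection[of _ _ S g]) (use S X M assms(8) in auto)
qed

section \<open>Minors of generic members of a family\<close>

lemma comm_ring_hom_poly: "comm_ring_hom (\<lambda>p. poly p (t :: 'a :: comm_ring_1))"
  by unfold_locales auto

lemma semiring_hom_poly: "semiring_hom (\<lambda>p. poly p (t :: 'a :: comm_ring_1))"
  by unfold_locales auto

text \<open>The witnesses \<open>L\<close> and \<open>R\<close> for \<open>t0\<close> are kept for
  all \<open>t\<close>; a failure is then a root of one fixed nonzero polynomial.\<close>

lemma finite_not_has_minor:
  fixes M :: "'a :: field poly mat"
  assumes M: "M \<in> carrier_mat n n" and minor: "has_minor n r (map_mat (\<lambda>p. poly p t0) M)"
  shows "finite {t. \<not> has_minor n r (map_mat (\<lambda>p. poly p t) M)}"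
proof -
  obtain L R where LR: "L \<in> carrier_mat r n" "R \<in> carrier_mat n r"
    and det: "det (L * map_mat (\<lambda>p. poly p t0) M * R) \<noteq> 0"
    using minor by (auto simp: has_minor_def)
  define D where "D = det (map_mat (\<lambda>c. [:c:]) L * M * map_mat (\<lambda>c. [:c:]) R)"
  have D: "poly D t = det (L * map_mat (\<lambda>p. poly p t) M * R)" for t
  proof -
    have const: "map_mat (\<lambda>p. poly p t) (map_mat (\<lambda>c. [:c:]) N) = N" for N :: "'a mat"
      by (intro eq_matI) auto
    have "poly D t = det (map_mat (\<lambda>p. poly p t) (map_mat (\<lambda>c. [:c:]) L * M * map_mat (\<lambda>c. [:c:]) R))"
      unfolding D_def by (rule comm_ring_hom.hom_det[OF comm_ring_hom_poly, symmetric])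
    also have "map_mat (\<lambda>p. poly p t) (map_mat (\<lambda>c. [:c:]) L * M * map_mat (\<lambda>c. [:c:]) R) =
        L * map_mat (\<lambda>p. poly p t) M * R"
      using LR M by (subst semiring_hom.mat_hom_mult[OF semiring_hom_poly, of _ r n _ r], simp, simp, subst semiring_hom.mat_hom_mult[OF semiring_hom_poly, of _ r n _ n])
        (auto simp: const)
    finally show ?thesis .
  qed
  have "D \<noteq> 0" using det D[of t0] by auto
  then have "finite {t. poly D t = 0}" by (rule poly_roots_finite)
  moreover have "{t. \<not> has_minor n r (map_mat (\<lambda>p. poly p t) M)} \<subseteq> {t. poly D t = 0}"
    using LR by (auto simp: has_minor_def D)
  ultimately show ?thesis by (rule rev_finite_subset)
qed

lemma finite_not_has_minor_pow:
  fixes M :: "'a :: field poly mat"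
  assumes M: "M \<in> carrier_mat n n" and minor: "has_minor n r (map_mat (\<lambda>p. poly p t0) M ^\<^sub>m m)"
  shows "finite {t. \<not> has_minor n r (map_mat (\<lambda>p. poly p t) M ^\<^sub>m m)}"
proof -
  have pow: "map_mat (\<lambda>p. poly p t) (M ^\<^sub>m m) = map_mat (\<lambda>p. poly p t) M ^\<^sub>m m" for t
    by (rule semiring_hom.mat_hom_pow[OF semiring_hom_poly M])
  show ?thesis using finite_not_has_minor[of "M ^\<^sub>m m" n r t0] M minor by (simp add: pow)
qed

text \<open>The matrix found so far is joined by a line to one for the next power. On the line each
  of the finitely many conditions fails only finitely often. Closure under lines plays the role of
  irreducibility.\<close>

lemma simultaneous_minors:
  fixes S :: "'a :: field mat set"
  assumes inf: "infinite (UNIV :: 'a set)" and S: "S \<subseteq> carrier_mat n n"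
    and line: "\<And>X Y t. \<lbrakk>X \<in> S; Y \<in> S\<rbrakk> \<Longrightarrow> mat n n (\<lambda>ij. X $$ ij + t * (Y $$ ij - X $$ ij)) \<in> S"
    and ex: "\<And>m. m \<le> N \<Longrightarrow> \<exists>X\<in>S. has_minor n (\<rho> m) (X ^\<^sub>m m)"
  shows "\<exists>X\<in>S. \<forall>m\<le>N. has_minor n (\<rho> m) (X ^\<^sub>m m)"
  using ex
proof (induction N)
  case 0
  then show ?case by auto
next
  case (Suc N)
  obtain X where X: "X \<in> S" "\<And>m. m \<le> N \<Longrightarrow> has_minor n (\<rho> m) (X ^\<^sub>m m)"
    using Suc by (meson le_Suc_eq)
  obtain Y where Y: "Y \<in> S" "has_minor n (\<rho> (Suc N)) (Y ^\<^sub>m Suc N)" using Suc.prems[of "Suc N"] by auto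
  define M where "M = mat n n (\<lambda>ij. [:X $$ ij, Y $$ ij - X $$ ij:])"
  have M: "M \<in> carrier_mat n n" by (simp add: M_def)
  have ev: "map_mat (\<lambda>p. poly p t) M = mat n n (\<lambda>ij. X $$ ij + t * (Y $$ ij - X $$ ij))" for t
    by (intro eq_matI) (auto simp: M_def)
  have ev0: "map_mat (\<lambda>p. poly p 0) M = X" and ev1: "map_mat (\<lambda>p. poly p 1) M = Y"
    unfolding ev using X(1) Y(1) S by (auto intro!: eq_matI)
  define bad where "bad m = {t. \<not> has_minor n (\<rho> m) (map_mat (\<lambda>p. poly p t) M ^\<^sub>m m)}" for m
  have "finite (bad m)" if "m \<le> Suc N" for m
  proof (cases "m = Suc N")
    case True
    then show ?thesis unfolding bad_def
      using finite_not_has_minor_pow[OF M, of _ 1] Y(2) by (simp add: ev1 del: pow_mat.simps)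
  next
    case False
    then show ?thesis unfolding bad_def
      using finite_not_has_minor_pow[OF M, of _ 0] X(2)[of m] that by (simp add: ev0)
  qed
  then have "finite (\<Union>m\<le>Suc N. bad m)" by blast
  then obtain t where "t \<notin> (\<Union>m\<le>Suc N. bad m)" using inf ex_new_if_finite by blast
  then show ?case using line[OF X(1) Y(1), of t]
    by (intro bexI[of _ "map_mat (\<lambda>p. poly p t) M"]) (auto simp: bad_def ev)
qed

text \<open>This works over any field because the only eigenvalue in question is 0. In a basis that
  starts with a kernel vector the first column vanishes, and the complementary block is again
  nilpotent.\<close>

lemma similar_strictly_upper_triangular:
  fixes A :: "'a :: field mat"
  assumes "A \<in> carrier_mat n n" "A ^\<^sub>m k = 0\<^sub>m n n"
  shows "\<exists>T \<in> carrier_mat n n. similar_mat A T \<and> (\<forall>i<n. \<forall>j<n. j \<le> i \<longrightarrow> T $$ (i, j) = 0)"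
  using assms
proof (induction n arbitrary: A)
  case 0
  then show ?case by (intro bexI[of _ A]) (auto intro: similar_mat_refl)
next
  case (Suc n)
  let ?n = "Suc n"
  note A = Suc.prems(1)
  have "det A = 0"
  proof (rule ccontr)
    assume "det A \<noteq> 0"
    have "det (A ^\<^sub>m j) = det A ^ j" for j
      by (induction j) (use A det_mult[OF pow_carrier_mat[OF A] A] in \<open>auto simp: mult.commute\<close>)
    moreover have "det (0\<^sub>m ?n ?n :: 'a mat) = 0"
      using det_zero[of ?n] by simp
    ultimately show False using Suc.prems(2) \<open>det A \<noteq> 0\<close> by (metis power_not_zero)
  qed
  then obtain v where v: "v \<in> carrier_vec ?n" "v \<noteq> 0\<^sub>v ?n" "A *\<^sub>v v = 0\<^sub>v ?n"
    using det_0_iff_vec_prod_zero_field[OF A] by blast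
  interpret vec_space "TYPE('a)" ?n .
  define P where "P = mat_of_cols ?n (basis_completion v)"
  note bc = basis_completion[OF v(1,2)]
  have P: "P \<in> carrier_mat ?n ?n" unfolding P_def using bc(6) by auto
  have cols: "cols P = basis_completion v" unfolding P_def using bc(2) by (intro cols_mat_of_cols) auto
  have "rank P = ?n" using lin_indpt_full_rank[OF P] bc(4,5) by (simp add: cols)
  then have "det P \<noteq> 0" using det_rank_iff[OF P] by simp
  from det_non_zero_imp_unit[OF P this, of "()"] obtain R
    where R: "R \<in> carrier_mat ?n ?n" "R * P = 1\<^sub>m ?n" "P * R = 1\<^sub>m ?n"
    unfolding Units_def ring_mat_def by auto
  define B where "B = R * A * P"
  have B: "B \<in> carrier_mat ?n ?n" using A P R by (simp add: B_def)
  have "similar_mat_wit A B P R"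
  proof (rule similar_mat_witI[OF R(3,2)])
    have "P * B * R = P * R * A * (P * R)"
      unfolding B_def using A P R(1)
      by (simp add: assoc_mult_mat[of _ ?n ?n _ ?n _ ?n])
    then show "A = P * B * R" using A R by simp
  qed (use A B P R in auto)
  then have sim: "similar_mat A B" by (auto simp: similar_mat_def)
  have Bk: "B ^\<^sub>m k = 0\<^sub>m ?n ?n"
  proof -
    have "similar_mat_wit B A R P" by (rule similar_mat_wit_sym) fact
    from similar_mat_wit_pow_id[OF this, of k] show ?thesis using Suc.prems(2) P R by simp
  qed
  have col0: "col B 0 = 0\<^sub>v ?n"
  proof -
    have "col P 0 = v" using bc(6,7) cols P
      by (metis cols_nth carrier_matD(2) hd_conv_nth length_0_conv nat.distinct(1) zero_less_Suc)
    then have "col B 0 = R * A *\<^sub>v v" unfolding B_def using A P R by (subst col_mult2[of _ ?n ?n]) auto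
    also have "\<dots> = R *\<^sub>v (A *\<^sub>v v)" using A R v by (intro assoc_mult_mat_vec) auto
    also have "\<dots> = 0\<^sub>v ?n" using v(3) R by (intro eq_vecI) auto
    finally show ?thesis .
  qed
  obtain B1 B2 B3 B4 where spl: "split_block B 1 1 = (B1, B2, B3, B4)" by (metis prod_cases4)
  have dims: "dim_row B = 1 + n" "dim_col B = 1 + n" using B by auto
  note sb = split_block[OF spl dims]
  have B30: "B3 = 0\<^sub>m n 1" and B10: "B1 = 0\<^sub>m 1 1"
  proof -
    have ent: "B $$ (i, 0) = 0" if "i < ?n" for i
      using arg_cong[OF col0, of "\<lambda>w. w $ i"] that B by simp
    show "B3 = 0\<^sub>m n 1" "B1 = 0\<^sub>m 1 1"
      using spl ent B by (auto simp: split_block_def Let_def intro!: eq_matI)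
  qed
  have "\<exists>U W. U \<in> carrier_mat 1 1 \<and> W \<in> carrier_mat 1 n \<and> B ^\<^sub>m j = four_block_mat U W (0\<^sub>m n 1) (B4 ^\<^sub>m j)" for j
  proof (induction j)
    case 0
    have "1\<^sub>m ?n = four_block_mat (1\<^sub>m 1) (0\<^sub>m 1 n) (0\<^sub>m n 1) (1\<^sub>m n :: 'a mat)"
      by (intro eq_matI) auto
    then show ?case using B sb(4) by (intro exI[of _ "1\<^sub>m 1"] exI[of _ "0\<^sub>m 1 n"]) auto
  next
    case (Suc j)
    then obtain U W where UW: "U \<in> carrier_mat 1 1" "W \<in> carrier_mat 1 n"
      "B ^\<^sub>m j = four_block_mat U W (0\<^sub>m n 1) (B4 ^\<^sub>m j)" by auto
    have "B ^\<^sub>m Suc j = four_block_mat U W (0\<^sub>m n 1) (B4 ^\<^sub>m j) * four_block_mat B1 B2 (0\<^sub>m n 1) B4"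
      using UW(3) sb(5) B30 by simp
    also have "\<dots> = four_block_mat (U * B1 + W * 0\<^sub>m n 1) (U * B2 + W * B4)
        (0\<^sub>m n 1 * B1 + B4 ^\<^sub>m j * 0\<^sub>m n 1) (0\<^sub>m n 1 * B2 + B4 ^\<^sub>m j * B4)"
      by (rule mult_four_block_mat[OF UW(1,2) _ _ sb(1,2) _ sb(4)]) (use sb(4) in auto)
    also have "0\<^sub>m n 1 * B1 + B4 ^\<^sub>m j * 0\<^sub>m n 1 = 0\<^sub>m n 1" using sb by simp
    also have "0\<^sub>m n 1 * B2 + B4 ^\<^sub>m j * B4 = B4 ^\<^sub>m Suc j"
      using sb(2) left_add_zero_mat[OF mult_carrier_mat[OF pow_carrier_mat[OF sb(4)] sb(4)]] by simp
    finally show ?case using UW sb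
      by (intro exI[of _ "U * B1 + W * 0\<^sub>m n 1"] exI[of _ "U * B2 + W * B4"]) auto
  qed
  then obtain U W where UW: "U \<in> carrier_mat 1 1" "W \<in> carrier_mat 1 n"
    "0\<^sub>m ?n ?n = four_block_mat U W (0\<^sub>m n 1) (B4 ^\<^sub>m k)" using Bk by metis
  have "B4 ^\<^sub>m k = 0\<^sub>m n n"
  proof (rule eq_matI)
    fix i j assume "i < dim_row (0\<^sub>m n n :: 'a mat)" "j < dim_col (0\<^sub>m n n :: 'a mat)"
    then have ij: "i < n" "j < n" by auto
    have "(0\<^sub>m ?n ?n :: 'a mat) $$ (Suc i, Suc j) = (B4 ^\<^sub>m k) $$ (i, j)"
      unfolding UW(3) using ij UW(1,2) sb(4) by simp
    then show "(B4 ^\<^sub>m k) $$ (i, j) = (0\<^sub>m n n :: 'a mat) $$ (i, j)" using ij by simp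
  qed (use sb(4) in auto)
  from Suc.IH[OF sb(4) this] obtain T4 where T4: "T4 \<in> carrier_mat n n" "similar_mat B4 T4"
    "\<And>i j. i < n \<Longrightarrow> j < n \<Longrightarrow> j \<le> i \<Longrightarrow> T4 $$ (i, j) = 0" by blast
  from similar_mat_four_block_0_ex[OF similar_mat_refl[OF sb(1)] T4(2) sb(2) sb(1) sb(4)]
  obtain T2 where T2: "T2 \<in> carrier_mat 1 n"
    "similar_mat (four_block_mat B1 B2 (0\<^sub>m n 1) B4) (four_block_mat B1 T2 (0\<^sub>m n 1) T4)" by blast
  define T where "T = four_block_mat B1 T2 (0\<^sub>m n 1) T4"
  have "similar_mat B T" using T2(2) sb(5) B30 by (simp add: T_def)
  then have "similar_mat A T" by (rule similar_mat_trans[OF sim])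
  moreover have "T \<in> carrier_mat ?n ?n"
    using four_block_carrier_mat[OF sb(1) T4(1)] by (simp add: T_def)
  moreover have "T $$ (i, j) = 0" if "i < ?n" "j < ?n" "j \<le> i" for i j
    using that T2(1) T4(1,3) unfolding T_def B10 by (cases i; cases j) auto
  ultimately show ?case by blast
qed

section \<open>Jordan matrices\<close>

lemma similar_mat_swap_blocks:
  fixes A B :: "'a :: field mat"
  assumes A: "A \<in> carrier_mat a a" and B: "B \<in> carrier_mat b b"
  shows "similar_mat (four_block_mat A (0\<^sub>m a b) (0\<^sub>m b a) B) (four_block_mat B (0\<^sub>m b a) (0\<^sub>m a b) A)"
proof -
  define P where "P = four_block_mat (0\<^sub>m a b) (1\<^sub>m a) (1\<^sub>m b) (0\<^sub>m b a :: 'a mat)"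
  define R where "R = four_block_mat (0\<^sub>m b a) (1\<^sub>m b) (1\<^sub>m a) (0\<^sub>m a b :: 'a mat)"
  have ab: "b + a = a + b" by simp
  have one: "four_block_mat (1\<^sub>m x) (0\<^sub>m x y) (0\<^sub>m y x) (1\<^sub>m y) = (1\<^sub>m (x + y) :: 'a mat)" for x y
    by (rule eq_matI) auto
  have PR: "P * R = 1\<^sub>m (a + b)"
    unfolding P_def R_def
    by (subst mult_four_block_mat[of _ a b _ a _ b _ _ a _ b]) (auto simp: one)
  have RP: "R * P = 1\<^sub>m (a + b)"
    unfolding P_def R_def
    by (subst mult_four_block_mat[of _ b a _ b _ a _ _ b _ a]) (auto simp: one add.commute)
  have PM: "P * four_block_mat B (0\<^sub>m b a) (0\<^sub>m a b) A = four_block_mat (0\<^sub>m a b) A B (0\<^sub>m b a)"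
    unfolding P_def using A B
    by (subst mult_four_block_mat[of _ a b _ a _ b _ _ b _ a]) auto
  have "P * four_block_mat B (0\<^sub>m b a) (0\<^sub>m a b) A * R = four_block_mat A (0\<^sub>m a b) (0\<^sub>m b a) B"
    unfolding PM unfolding R_def using A B
    by (subst mult_four_block_mat[of _ a b _ a _ b _ _ a _ b]) auto
  then have "similar_mat_wit (four_block_mat A (0\<^sub>m a b) (0\<^sub>m b a) B)
      (four_block_mat B (0\<^sub>m b a) (0\<^sub>m a b) A) P R"
    using A B by (intro similar_mat_witI[OF PR RP]) (auto simp: P_def R_def ab)
  then show ?thesis by (auto simp: similar_mat_def)
qed

lemma jordan_matrix_append:
  "jordan_matrix (xs @ ys) = four_block_mat (jordan_matrix xs)
     (0\<^sub>m (sum_list (map fst xs)) (sum_list (map fst ys)))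
     (0\<^sub>m (sum_list (map fst ys)) (sum_list (map fst xs))) (jordan_matrix ys)"
proof -
  have "diag_block_mat [jordan_matrix xs, jordan_matrix ys] =
    diag_block_mat ([jordan_matrix xs] @ [jordan_matrix ys])" by simp
  then show ?thesis using jordan_matrix_concat_diag_block_mat[of "[xs, ys]"]
    unfolding diag_block_mat_append diag_block_mat_singleton by (simp add: Let_def)
qed

text \<open>A Jordan normal form lists its blocks in any order, while \<open>has_partition\<close>
  wants them sorted.\<close>

lemma similar_jordan_matrix_mset:
  fixes xs ys :: "(nat \<times> 'a :: field) list"
  assumes "mset xs = mset ys"
  shows "similar_mat (jordan_matrix xs) (jordan_matrix ys)"
  using assms
proof (induction xs arbitrary: ys)
  case Nil
  then show ?case by (auto intro: similar_mat_refl[OF jordan_matrix_carrier])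
next
  case (Cons x xs)
  then have "x \<in> set ys" by (metis list.set_intros(1) set_mset_mset)
  then obtain ys1 ys2 where ys: "ys = ys1 @ x # ys2" by (meson split_list)
  have "similar_mat (jordan_matrix xs) (jordan_matrix (ys2 @ ys1))"
    using Cons by (intro Cons.IH) (simp add: ys)
  then have "similar_mat (jordan_matrix ([x] @ xs)) (jordan_matrix ([x] @ (ys2 @ ys1)))"
    unfolding jordan_matrix_append[of "[x]"] 
    using similar_mat_four_block_0_0[OF similar_mat_refl[OF jordan_matrix_carrier[of "[x]"]] _ jordan_matrix_carrier jordan_matrix_carrier, of xs "jordan_matrix (ys2 @ ys1)"]
      Cons.prems by (simp add: ys sum_mset_sum_list[symmetric] add.commute del: sum_mset_sum_list)
  also have "[x] @ (ys2 @ ys1) = (x # ys2) @ ys1" by simp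
  finally have 1: "similar_mat (jordan_matrix (x # xs)) (jordan_matrix ((x # ys2) @ ys1))" by simp
  have 2: "similar_mat (jordan_matrix ((x # ys2) @ ys1)) (jordan_matrix ys)"
    unfolding ys jordan_matrix_append[of "x # ys2" ys1] jordan_matrix_append[of ys1 "x # ys2"]
    by (rule similar_mat_swap_blocks) (rule jordan_matrix_carrier)+
  show ?case by (rule similar_mat_trans[OF 1 2])
qed

lemma nilpotent_has_partition:
  fixes A :: "'a :: field mat"
  assumes "nilpotent_mat n A"
  shows "\<exists>p. has_partition A p"
proof -
  obtain k where A: "A \<in> carrier_mat n n" "A ^\<^sub>m k = 0\<^sub>m n n" using assms by (auto simp: nilpotent_mat_def)
  obtain T where T: "T \<in> carrier_mat n n" "similar_mat A T"
    "\<And>i j. i < n \<Longrightarrow> j < n \<Longrightarrow> j \<le> i \<Longrightarrow> T $$ (i, j) = 0"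
    using similar_strictly_upper_triangular[OF A] by blast
  have ut: "upper_triangular T" using T(1,3) by (auto simp: upper_triangular_def)
  define nas where "nas = triangular_to_jnf_vector T"
  have jT: "jordan_nf T nas" unfolding nas_def by (rule triangular_to_jnf_vector[OF T(1) ut])
  have zero: "a = 0" if "(k, a) \<in> set nas" for k a
  proof -
    have "char_poly T = (\<Prod>a\<leftarrow>diag_mat T. [:- a, 1:])" by (rule char_poly_upper_triangular[OF T(1) ut])
    also have "\<dots> = (\<Prod>a\<leftarrow>replicate n 0. [:- a, 1:])"
    proof -
      have "diag_mat T = replicate n 0" using T by (intro nth_equalityI) (auto simp: diag_mat_def)
      then show ?thesis by simp
    qed
    also have "\<dots> = [:0, 1:] ^ n" by (simp add: prod_list_replicate)
    finally have "(\<Prod>(n, a)\<leftarrow>nas. [:- a, 1:] ^ n) = [:0, 1:] ^ n" using jordan_nf_char_poly[OF jT] by simp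
    moreover have "poly (\<Prod>(n, a)\<leftarrow>nas. [:- a, 1:] ^ n) a = 0"
    proof -
      have "k \<noteq> 0" using jT that by (force simp: jordan_nf_def)
      then have "poly ([:- a, 1:] ^ k) a = 0" by simp
      then show ?thesis using that
        by (induction nas) (auto simp: poly_mult)
    qed
    ultimately show ?thesis by (simp add: poly_power)
  qed
  define p where "p = rev (sort (map fst nas))"
  have "nas = map (\<lambda>k. (k, 0)) (map fst nas)" using zero by (auto intro!: nth_equalityI simp: prod_eq_iff) (metis nth_mem surjective_pairing)
  then have "mset nas = mset (map (\<lambda>k. (k, 0)) p)"
    by (metis mset_map mset_rev mset_sort p_def)
  then have "similar_mat (jordan_matrix nas) (jordan_matrix (map (\<lambda>k. (k, 0)) p))"
    by (rule similar_jordan_matrix_mset)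
  moreover have "similar_mat A (jordan_matrix nas)"
    using T(2) jT similar_mat_trans by (auto simp: jordan_nf_def)
  ultimately have "similar_mat A (jordan_matrix (map (\<lambda>k. (k, 0)) p))" using similar_mat_trans by blast
  moreover have "0 \<notin> fst ` set (map (\<lambda>k. (k, 0 :: 'a)) p)"
    using jT by (auto simp: jordan_nf_def p_def image_image)
  moreover have "sorted_wrt (\<ge>) p" by (simp add: p_def sorted_wrt_rev)
  ultimately show ?thesis unfolding has_partition_def jordan_nf_def by blast
qed

section \<open>Coordinates by block and position, and the ranks of the powers\<close>

definition block_index :: "nat list \<Rightarrow> nat \<times> nat \<Rightarrow> nat" where
  "block_index \<mu> = (\<lambda>(j, s). sum_list (take j \<mu>) + s)"

definition block_positions :: "nat list \<Rightarrow> (nat \<times> nat) set" where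
  "block_positions \<mu> = (SIGMA j:{..<length \<mu>}. {..<\<mu> ! j})"

lemma finite_block_positions [simp]: "finite (block_positions \<mu>)"
  by (simp add: block_positions_def)

lemma card_block_positions: "card (block_positions \<mu>) = sum_list \<mu>"
  by (simp add: block_positions_def sum_list_sum_nth atLeast0LessThan)

lemma block_index_Cons [simp]:
  "block_index (x # \<mu>) (0, s) = s" "block_index (x # \<mu>) (Suc j, s) = x + block_index \<mu> (j, s)"
  by (simp_all add: block_index_def)

lemma block_index_less: "(j, s) \<in> block_positions \<mu> \<Longrightarrow> block_index \<mu> (j, s) < sum_list \<mu>"
proof (induction \<mu> arbitrary: j)
  case (Cons x \<mu>)
  show ?case
  proof (cases j)
    case (Suc i)
    then show ?thesis using Cons.IH[of i] Cons.prems by (simp add: block_positions_def)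
  qed (use Cons.prems in \<open>simp add: block_positions_def\<close>)
qed (simp add: block_positions_def)

lemma block_index_inj:
  "\<lbrakk>(j, s) \<in> block_positions \<mu>; (l, t) \<in> block_positions \<mu>; block_index \<mu> (j, s) = block_index \<mu> (l, t)\<rbrakk>
     \<Longrightarrow> j = l \<and> s = t"
proof (induction \<mu> arbitrary: j l)
  case (Cons x \<mu>)
  show ?case
  proof (cases j; cases l)
    fix i k assume "j = Suc i" "l = Suc k"
    then show ?thesis using Cons.IH[of i k] Cons.prems by (simp add: block_positions_def)
  qed (use Cons.prems in \<open>auto simp: block_positions_def\<close>)
qed (simp add: block_positions_def)

lemma inj_on_block_index: "inj_on (block_index \<mu>) (block_positions \<mu>)"
  using block_index_inj by (auto intro!: inj_onI)

lemma block_index_image: "block_index \<mu> ` block_positions \<mu> = {..<sum_list \<mu>}"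
proof (rule card_subset_eq)
  show "block_index \<mu> ` block_positions \<mu> \<subseteq> {..<sum_list \<mu>}" using block_index_less by auto
  show "card (block_index \<mu> ` block_positions \<mu>) = card {..<sum_list \<mu>}"
    using card_image[OF inj_on_block_index] by (simp add: card_block_positions)
qed simp

lemma nilpotent_jordan_carrier [simp]:
  "(nilpotent_jordan \<mu> :: 'a :: field mat) \<in> carrier_mat (sum_list \<mu>) (sum_list \<mu>)"
proof -
  have "jordan_matrix (map (\<lambda>k. (k, 0 :: 'a)) \<mu>) \<in> carrier_mat (sum_list (map fst (map (\<lambda>k. (k, 0 :: 'a)) \<mu>)))
     (sum_list (map fst (map (\<lambda>k. (k, 0 :: 'a)) \<mu>)))" by (rule jordan_matrix_carrier)
  then show ?thesis by (simp add: nilpotent_jordan_def o_def)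
qed

lemma nilpotent_jordan_index:
  "\<lbrakk>(j, s) \<in> block_positions \<mu>; (l, t) \<in> block_positions \<mu>\<rbrakk> \<Longrightarrow>
     (nilpotent_jordan \<mu> :: 'a :: field mat) $$ (block_index \<mu> (j, s), block_index \<mu> (l, t)) =
       (if j = l \<and> t = Suc s then 1 else 0)"
proof (induction \<mu> arbitrary: j l)
  case (Cons x \<mu>)
  have Jc: "(nilpotent_jordan (x # \<mu>) :: 'a mat) = four_block_mat (jordan_block x 0) (0\<^sub>m x (sum_list \<mu>))
     (0\<^sub>m (sum_list \<mu>) x) (nilpotent_jordan \<mu>)"
    by (simp add: nilpotent_jordan_def jordan_matrix_Cons o_def)
  have Jd: "dim_row (nilpotent_jordan \<mu> :: 'a mat) = sum_list \<mu>"
    "dim_col (nilpotent_jordan \<mu> :: 'a mat) = sum_list \<mu>"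
    using nilpotent_jordan_carrier[of \<mu>, where 'a = 'a] unfolding carrier_mat_def by auto
  show ?case
  proof (cases j; cases l)
    assume "j = 0" "l = 0"
    then show ?thesis using Cons.prems by (simp add: Jc block_positions_def Jd)
  next
    fix k assume jl: "j = 0" "l = Suc k"
    then have "(k, t) \<in> block_positions \<mu>" using Cons.prems by (simp add: block_positions_def)
    from block_index_less[OF this] show ?thesis using jl Cons.prems by (simp add: Jc block_positions_def Jd)
  next
    fix i assume jl: "j = Suc i" "l = 0"
    then have "(i, s) \<in> block_positions \<mu>" using Cons.prems by (simp add: block_positions_def)
    from block_index_less[OF this] show ?thesis using jl Cons.prems by (simp add: Jc block_positions_def Jd)
  next
    fix i k assume jl: "j = Suc i" "l = Suc k"
    then have v: "(i, s) \<in> block_positions \<mu>" "(k, t) \<in> block_positions \<mu>"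
      using Cons.prems by (simp_all add: block_positions_def)
    show ?thesis using jl Cons.IH[OF v] block_index_less[OF v(1)] block_index_less[OF v(2)] by (simp add: Jc Jd)
  qed
qed (simp add: block_positions_def)

lemma nilpotent_jordan_pow_index:
  assumes "(j, s) \<in> block_positions \<mu>" "(l, t) \<in> block_positions \<mu>"
  shows "(nilpotent_jordan \<mu> ^\<^sub>m m) $$ (block_index \<mu> (j, s), block_index \<mu> (l, t)) =
    (if j = l \<and> t = s + m then 1 else (0 :: 'a :: field))"
  using assms(2)
proof (induction m arbitrary: t)
  case 0
  then show ?case using block_index_less[OF assms(1)] block_index_less[OF 0] block_index_inj[OF assms(1) 0]
    nilpotent_jordan_carrier[of \<mu>, where 'a = 'a] unfolding carrier_mat_def by auto
next
  case (Suc m)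
  let ?J = "nilpotent_jordan \<mu> :: 'a mat" and ?f = "block_index \<mu>"
  have J: "?J \<in> carrier_mat (sum_list \<mu>) (sum_list \<mu>)" by simp
  have lt: "?f (j, s) < sum_list \<mu>" "?f (l, t) < sum_list \<mu>" using assms(1) Suc.prems block_index_less by auto
  have "(?J ^\<^sub>m Suc m) $$ (?f (j, s), ?f (l, t)) = (\<Sum>k<sum_list \<mu>. (?J ^\<^sub>m m) $$ (?f (j, s), k) * ?J $$ (k, ?f (l, t)))"
    using lt carrier_matD[OF J] carrier_matD[OF pow_carrier_mat[OF J, of m]]
    by (simp add: scalar_prod_def atLeast0LessThan)
  also have "\<dots> = (\<Sum>z\<in>block_positions \<mu>. (?J ^\<^sub>m m) $$ (?f (j, s), ?f z) * ?J $$ (?f z, ?f (l, t)))"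
    unfolding block_index_image[symmetric] by (subst sum.reindex[OF inj_on_block_index]) simp
  also have "\<dots> = (\<Sum>z\<in>block_positions \<mu>. if z = (l, t - 1) then (if t = 0 then 0 else (?J ^\<^sub>m m) $$ (?f (j, s), ?f z)) else 0)"
    using Suc.prems by (intro sum.cong refl) (auto simp: nilpotent_jordan_index split: prod.splits if_splits)
  also have "\<dots> = (if t = 0 then 0 else (?J ^\<^sub>m m) $$ (?f (j, s), ?f (l, t - 1)))"
    using Suc.prems by (auto simp: block_positions_def)
  also have "\<dots> = (if j = l \<and> t = s + Suc m then 1 else 0)"
    using Suc.IH[of "t - 1"] Suc.prems by (auto simp: block_positions_def)
  finally show ?case .
qed

definition excess :: "nat list \<Rightarrow> nat \<Rightarrow> nat" where
  "excess p m = (\<Sum>x\<leftarrow>p. x - m)"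

text \<open>The power moves position \<open>t\<close> of a block to position \<open>t - m\<close>,
  so exactly the columns with \<open>m \<le> t\<close> survive, each as a unit vector of its
  own.\<close>

lemma nilpotent_jordan_pow_selection:
  fixes \<mu> m
  defines "n \<equiv> sum_list \<mu>"
  obtains S g where "S \<subseteq> {..<n}" "inj_on g S" "g ` S \<subseteq> {..<n}" "card S = excess \<mu> m"
    "\<And>i v. i < n \<Longrightarrow> v < n \<Longrightarrow>
       (nilpotent_jordan \<mu> ^\<^sub>m m) $$ (i, v) = (if v \<in> S \<and> i = g v then 1 else (0 :: 'a :: field))"
proof -
  define V where "V = (SIGMA j:{..<length \<mu>}. {m..<\<mu> ! j})"
  define f where "f = block_index \<mu>"
  have V: "V \<subseteq> block_positions \<mu>" by (auto simp: V_def block_positions_def)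
  have inj: "inj_on f (block_positions \<mu>)" unfolding f_def by (rule inj_on_block_index)
  define g where "g v = f (let z = inv_into (block_positions \<mu>) f v in (fst z, snd z - m))" for v
  have g: "g (f z) = f (fst z, snd z - m)" if "z \<in> block_positions \<mu>" for z
    unfolding g_def using inj that by (simp add: Let_def)
  have valid: "(fst z, snd z - m) \<in> block_positions \<mu>" if "z \<in> block_positions \<mu>" for z
    using that by (auto simp: block_positions_def)
  show thesis
  proof (rule that[of "f ` V" g])
    show "f ` V \<subseteq> {..<n}" using V block_index_image[of \<mu>] by (auto simp: f_def n_def)
    show "inj_on g (f ` V)"
    proof (rule inj_onI)
      fix x y assume "x \<in> f ` V" "y \<in> f ` V" and eq: "g x = g y"
      then obtain z w where zw: "z \<in> V" "w \<in> V" "x = f z" "y = f w" by auto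
      have zw': "z \<in> block_positions \<mu>" "w \<in> block_positions \<mu>" using zw V by blast+
      have "f (fst z, snd z - m) = f (fst w, snd w - m)" using eq zw(3,4) g[OF zw'(1)] g[OF zw'(2)] by simp
      then have "(fst z, snd z - m) = (fst w, snd w - m)"
        by (rule inj_onD[OF inj _ valid[OF zw'(1)] valid[OF zw'(2)]])
      then have "z = w" using zw by (auto simp: V_def prod_eq_iff)
      then show "x = y" using zw by simp
    qed
    show "g ` f ` V \<subseteq> {..<n}"
    proof
      fix x assume "x \<in> g ` f ` V"
      then obtain z where z: "z \<in> V" "x = g (f z)" by blast
      then have "z \<in> block_positions \<mu>" using V by blast
      from g[OF this] valid[OF this] have "x \<in> f ` block_positions \<mu>" using z(2) by simp
      then show "x \<in> {..<n}" using block_index_image[of \<mu>] by (simp add: f_def n_def)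
    qed
    show "card (f ` V) = excess \<mu> m"
      using card_image[OF inj_on_subset[OF inj V]]
      by (simp add: V_def excess_def sum_list_sum_nth atLeast0LessThan)
    fix i v assume iv: "i < n" "v < n"
    have "i \<in> f ` block_positions \<mu>" "v \<in> f ` block_positions \<mu>"
      using iv block_index_image[of \<mu>] by (simp_all add: f_def n_def)
    then obtain z w where zw: "z \<in> block_positions \<mu>" "w \<in> block_positions \<mu>" "i = f z" "v = f w"
      by blast
    have "(nilpotent_jordan \<mu> ^\<^sub>m m) $$ (i, v) = (if fst z = fst w \<and> snd w = snd z + m then 1 else (0 :: 'a))"
      using nilpotent_jordan_pow_index[of "fst z" "snd z" \<mu> "fst w" "snd w" m] zw by (simp add: f_def)
    moreover have "v \<in> f ` V \<longleftrightarrow> w \<in> V"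
      using inj_on_image_mem_iff[OF inj zw(2) V] zw(4) by simp
    moreover have "w \<in> V \<longleftrightarrow> m \<le> snd w" using zw by (auto simp: V_def block_positions_def)
    moreover have "i = g v \<longleftrightarrow> z = (fst w, snd w - m)"
      using inj_on_eq_iff[OF inj zw(1) valid[OF zw(2)]] g[OF zw(2)] zw(3,4) by simp
    ultimately show "(nilpotent_jordan \<mu> ^\<^sub>m m) $$ (i, v) = (if v \<in> f ` V \<and> i = g v then 1 else (0 :: 'a))"
      by (auto simp: prod_eq_iff)
  qed
qed

text \<open>The link between the rank in \<open>partition_le\<close> and \<open>has_minor\<close>:
  for a partial permutation matrix both are governed by the number of its ones.\<close>

lemma rank_selection:
  fixes M :: "'a :: field mat"
  assumes M: "M \<in> carrier_mat n n" and S: "S \<subseteq> {..<n}" and g: "inj_on g S" "g ` S \<subseteq> {..<n}"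
    and ent: "\<And>i v. i < n \<Longrightarrow> v < n \<Longrightarrow> M $$ (i, v) = (if v \<in> S \<and> i = g v then 1 else 0)"
  shows "vec_space.rank n M = card S" and "has_minor n r M \<longleftrightarrow> r \<le> card S"
proof -
  interpret vec_space "TYPE('a)" n .
  have fS: "finite S" using S by (rule finite_subset) simp
  have col: "col M v = (if v \<in> S then unit_vec n (g v) else 0\<^sub>v n)" if "v < n" for v
    using that M g(2) by (intro eq_vecI) (auto simp: ent unit_vec_def)
  define U where "U = (\<lambda>v. unit_vec n (g v) :: 'a vec) ` S"
  have setc: "set (cols M) = col M ` {..<n}" using M by (auto simp: cols_def)
  have U1: "U \<subseteq> set (cols M)" unfolding U_def setc using col S by force
  have U2: "set (cols M) \<subseteq> insert (0\<^sub>v n) U" unfolding U_def setc using col by auto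
  have uinj: "i = j" if "unit_vec n i = (unit_vec n j :: 'a vec)" "i < n" "j < n" for i j
  proof (rule ccontr)
    assume "i \<noteq> j"
    moreover have "unit_vec n i $ i = (unit_vec n j :: 'a vec) $ i" using that by simp
    ultimately show False using that by simp
  qed
  have "inj_on (\<lambda>v. unit_vec n (g v) :: 'a vec) S"
    using uinj g by (intro inj_onI) (metis image_subset_iff inj_onD lessThan_iff)
  then have cU: "card U = card S" unfolding U_def by (rule card_image)
  have "U \<subseteq> set (unit_vecs n)" unfolding U_def unit_vecs_def using g(2) by auto
  then have li: "lin_indpt U"
    using unit_vecs_basis subset_li_is_li unfolding basis_def by blast
  have carr: "set (cols M) \<subseteq> carrier_vec n" using cols_dim M by blast
  have "maximal U (\<lambda>T. T \<subseteq> set (cols M) \<and> lin_indpt T)"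
  proof -
    have "T = U" if T: "U \<subseteq> T" "T \<subseteq> set (cols M)" "lin_indpt T" for T
    proof -
      have "(UNIV :: 'a set) \<noteq> {0}" by (metis UNIV_I singletonD one_neq_zero)
      then have "0\<^sub>v n \<notin> T" using zero_nin_lin_indpt[of T] T carr by auto
      then show "T = U" using T U2 by auto
    qed
    then show ?thesis unfolding maximal_def using U1 li by blast
  qed
  from rank_card_indpt[OF M this] show "vec_space.rank n M = card S" using cU by simp
  show "has_minor n r M \<longleftrightarrow> r \<le> card S"
  proof
    assume "r \<le> card S"
    then show "has_minor n r M" using ent S by (intro has_minor_selection[OF M S g]) auto
  next
    assume minor: "has_minor n r M"
    obtain e where e: "bij_betw e {0..<card S} S" using ex_bij_betw_nat_finite[OF fS] by blast
    define P :: "'a mat" where "P = mat n (card S) (\<lambda>(i, k). if i = g (e k) then 1 else 0)"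
    define R :: "'a mat" where "R = mat (card S) n (\<lambda>(k, v). if v = e k then 1 else 0)"
    have "M = P * R"
    proof (rule eq_matI)
      fix i v assume "i < dim_row (P * R)" "v < dim_col (P * R)"
      then have iv: "i < n" "v < n" by (auto simp: P_def R_def)
      have "(P * R) $$ (i, v) = (\<Sum>k\<in>{0..<card S}. (if i = g (e k) then 1 else 0) * (if v = e k then 1 else 0))"
        using iv by (simp add: P_def R_def scalar_prod_def)
      also have "\<dots> = (\<Sum>w\<in>S. (if i = g w then 1 else 0) * (if v = w then 1 else 0))"
        using sum.reindex_bij_betw[OF e, of "\<lambda>w. (if i = g w then 1 else 0) * (if v = w then 1 else 0)"] by simp
      also have "\<dots> = (\<Sum>w\<in>S. if w = v then (if i = g v then 1 else 0) else 0)"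
        by (intro sum.cong) auto
      also have "\<dots> = M $$ (i, v)" using iv fS by (simp add: ent)
      finally show "M $$ (i, v) = (P * R) $$ (i, v)" by simp
    qed (use M in \<open>auto simp: P_def R_def\<close>)
    then show "r \<le> card S" by (rule has_minor_factor[OF minor]) (auto simp: P_def R_def)
  qed
qed

lemma nilpotent_jordan_pow_rank:
  "vec_space.rank (sum_list \<mu>) ((nilpotent_jordan \<mu> :: 'a :: field mat) ^\<^sub>m m) = excess \<mu> m"
  "has_minor (sum_list \<mu>) r ((nilpotent_jordan \<mu> :: 'a mat) ^\<^sub>m m) \<longleftrightarrow> r \<le> excess \<mu> m"
proof -
  obtain S g where S: "S \<subseteq> {..<sum_list \<mu>}" "inj_on g S" "g ` S \<subseteq> {..<sum_list \<mu>}" "card S = excess \<mu> m"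
    "\<And>i v. i < sum_list \<mu> \<Longrightarrow> v < sum_list \<mu> \<Longrightarrow>
       (nilpotent_jordan \<mu> ^\<^sub>m m) $$ (i, v) = (if v \<in> S \<and> i = g v then 1 else (0 :: 'a))"
    using nilpotent_jordan_pow_selection[of \<mu> m] by metis
  have M: "(nilpotent_jordan \<mu> :: 'a mat) ^\<^sub>m m \<in> carrier_mat (sum_list \<mu>) (sum_list \<mu>)" by simp
  show "vec_space.rank (sum_list \<mu>) ((nilpotent_jordan \<mu> :: 'a mat) ^\<^sub>m m) = excess \<mu> m"
    "has_minor (sum_list \<mu>) r ((nilpotent_jordan \<mu> :: 'a mat) ^\<^sub>m m) \<longleftrightarrow> r \<le> excess \<mu> m"
    using rank_selection[OF M S(1-3,5)] S(4) by simp_all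
qed

lemma partition_le_iff: "partition_le TYPE('a :: field) p p' \<longleftrightarrow> (\<forall>m. excess p m \<le> excess p' m)"
  by (simp add: partition_le_def nilpotent_jordan_pow_rank)

lemma has_partition_minor:
  fixes A :: "'a :: field mat"
  assumes "has_partition A p" "A \<in> carrier_mat n n"
  shows "sum_list p = n" "has_minor n r (A ^\<^sub>m m) \<longleftrightarrow> r \<le> excess p m"
proof -
  have sim: "similar_mat A (nilpotent_jordan p)"
    using assms(1) by (auto simp: has_partition_def jordan_nf_def nilpotent_jordan_def)
  obtain P R where wit: "similar_mat_wit A (nilpotent_jordan p) P R"
    using sim by (auto simp: similar_mat_def)
  have "(nilpotent_jordan p :: 'a mat) \<in> carrier_mat n n"
    by (rule similar_mat_witD2(5)[OF assms(2) wit])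
  then show n: "sum_list p = n"
    using carrier_matD(1)[OF nilpotent_jordan_carrier[of p, where 'a = 'a]] carrier_matD(1) by metis
  show "has_minor n r (A ^\<^sub>m m) \<longleftrightarrow> r \<le> excess p m"
    unfolding has_minor_similar_pow[OF sim assms(2), of r m]
    using nilpotent_jordan_pow_rank(2)[of p r m, where 'a = 'a] unfolding n .
qed

lemma excess_Suc: "excess p m = excess p (Suc m) + length (filter (\<lambda>x. m < x) p)"
  by (induction p) (auto simp: excess_def)

lemma length_filter_less_count:
  "length (filter (\<lambda>x. m < x) p) = count_list p (Suc m) + length (filter (\<lambda>x. Suc m < x) p)"
  by (induction p) auto

text \<open>The second differences of \<open>excess\<close> in \<open>m\<close> are the
  multiplicities of the parts. A part 0 leaves no trace in them and has to be excluded.\<close>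

lemma mset_eq_of_excess:
  assumes "\<And>m. excess p m = excess p' m" "0 \<notin> set p" "0 \<notin> set p'"
  shows "mset p = mset p'"
proof (rule multiset_eqI)
  fix x
  have len: "length (filter (\<lambda>x. m < x) p) = length (filter (\<lambda>x. m < x) p')" for m
    using assms(1)[of m] assms(1)[of "Suc m"] excess_Suc[of p m] excess_Suc[of p' m] by simp
  show "count (mset p) x = count (mset p') x"
  proof (cases x)
    case 0
    then show ?thesis using assms(2,3) by (metis count_inI set_mset_mset)
  next
    case (Suc m)
    then show ?thesis
      using len[of m] len[of "Suc m"] length_filter_less_count[of m p] length_filter_less_count[of m p']
      by (simp add: count_mset)
  qed
qed

lemma sorted_desc_unique:
  fixes p p' :: "nat list"
  assumes "mset p = mset p'" "sorted_wrt (\<ge>) p" "sorted_wrt (\<ge>) p'"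
  shows "p = p'"
proof -
  have "rev p = rev p'"
    using assms by (intro properties_for_sort[THEN trans[OF sym], of "rev p" "rev p'"])
      (auto simp: sorted_wrt_rev sorted_sort_id)
  then show ?thesis by simp
qed

section \<open>The upper bound\<close>

lemma block_index_cases:
  assumes "i < sum_list \<mu>"
  obtains z where "z \<in> block_positions \<mu>" "i = block_index \<mu> z"
  using assms block_index_image[of \<mu>] by (metis imageE lessThan_iff)

lemma sum_block_index: "(\<Sum>k<sum_list \<mu>. F k) = (\<Sum>z\<in>block_positions \<mu>. F (block_index \<mu> z))"
  unfolding block_index_image[symmetric] by (subst sum.reindex[OF inj_on_block_index]) simp

lemma mult_nilpotent_jordan_entries:
  fixes A :: "'a :: field mat" and \<mu> :: "nat list"
  defines "f \<equiv> block_index \<mu>"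
  assumes A: "A \<in> carrier_mat (sum_list \<mu>) (sum_list \<mu>)"
    and z: "(j, s) \<in> block_positions \<mu>" and w: "(l, t) \<in> block_positions \<mu>"
  shows "(A * nilpotent_jordan \<mu>) $$ (f (j, s), f (l, t)) = (if t = 0 then 0 else A $$ (f (j, s), f (l, t - 1)))"
    and "(nilpotent_jordan \<mu> * A) $$ (f (j, s), f (l, t)) =
      (if Suc s < \<mu> ! j then A $$ (f (j, Suc s), f (l, t)) else 0)"
proof -
  let ?J = "nilpotent_jordan \<mu> :: 'a mat"
  define a where "a z w = A $$ (f z, f w)" for z w
  have J: "?J \<in> carrier_mat (sum_list \<mu>) (sum_list \<mu>)" by simp
  note dims = carrier_matD[OF A] carrier_matD[OF J] block_index_less[OF z] block_index_less[OF w]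
  have "(A * ?J) $$ (f (j, s), f (l, t)) = (\<Sum>y\<in>block_positions \<mu>. a (j, s) y * ?J $$ (f y, f (l, t)))"
    using dims by (simp add: scalar_prod_def atLeast0LessThan sum_block_index a_def f_def)
  also have "\<dots> = (\<Sum>y\<in>block_positions \<mu>. if y = (l, t - 1) then (if t = 0 then 0 else a (j, s) (l, t - 1)) else 0)"
    using w by (intro sum.cong refl) (auto simp: nilpotent_jordan_index f_def split: prod.splits if_splits)
  also have "\<dots> = (if t = 0 then 0 else a (j, s) (l, t - 1))"
    using w by (auto simp: block_positions_def)
  finally show "(A * ?J) $$ (f (j, s), f (l, t)) = (if t = 0 then 0 else A $$ (f (j, s), f (l, t - 1)))"
    by (simp add: a_def)
  have "(?J * A) $$ (f (j, s), f (l, t)) = (\<Sum>y\<in>block_positions \<mu>. ?J $$ (f (j, s), f y) * a y (l, t))"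
    using dims by (simp add: scalar_prod_def atLeast0LessThan sum_block_index a_def f_def)
  also have "\<dots> = (\<Sum>y\<in>block_positions \<mu>. if y = (j, Suc s) then a (j, Suc s) (l, t) else 0)"
    using z by (intro sum.cong refl) (auto simp: nilpotent_jordan_index f_def split: prod.splits if_splits)
  also have "\<dots> = (if Suc s < \<mu> ! j then a (j, Suc s) (l, t) else 0)"
    using z by (auto simp: block_positions_def)
  finally show "(?J * A) $$ (f (j, s), f (l, t)) = (if Suc s < \<mu> ! j then A $$ (f (j, Suc s), f (l, t)) else 0)"
    by (simp add: a_def)
qed

text \<open>Between any two blocks a commuting matrix is constant along the diagonals, and zero on a
  diagonal that leaves the blocks on the wrong side.\<close>

lemma commuting_entries:
  fixes A :: "'a :: field mat" and \<mu> :: "nat list"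
  defines "a \<equiv> \<lambda>z w. A $$ (block_index \<mu> z, block_index \<mu> w)"
  assumes A: "A \<in> carrier_mat (sum_list \<mu>) (sum_list \<mu>)"
    and comm: "A * nilpotent_jordan \<mu> = nilpotent_jordan \<mu> * A"
    and z: "(j, s) \<in> block_positions \<mu>" and w: "(l, t) \<in> block_positions \<mu>"
  shows "(if t = 0 then 0 else a (j, s) (l, t - 1)) = (if Suc s < \<mu> ! j then a (j, Suc s) (l, t) else 0)"
  using mult_nilpotent_jordan_entries[OF A z w] comm unfolding a_def by metis

text \<open>A nonzero entry persists along its diagonal, which must not run into the zero boundary
  at either end. In terms of position and distance to the end of the block: \<open>A\<close> moves
  the position weakly down and the distance weakly up.\<close>

lemma commuting_entries_le:
  fixes A :: "'a :: field mat" and \<mu> :: "nat list"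
  defines "a \<equiv> \<lambda>z w. A $$ (block_index \<mu> z, block_index \<mu> w)"
  assumes A: "A \<in> carrier_mat (sum_list \<mu>) (sum_list \<mu>)"
    and comm: "A * nilpotent_jordan \<mu> = nilpotent_jordan \<mu> * A"
    and z: "(j, s) \<in> block_positions \<mu>" and w: "(l, t) \<in> block_positions \<mu>"
    and nz: "a (j, s) (l, t) \<noteq> 0"
  shows "s \<le> t" and "\<mu> ! l + s \<le> \<mu> ! j + t"
proof -
  have ce: "(if t = 0 then 0 else a (j, s) (l, t - 1)) = (if Suc s < \<mu> ! j then a (j, Suc s) (l, t) else 0)"
    if "(j, s) \<in> block_positions \<mu>" "(l, t) \<in> block_positions \<mu>" for j s l t
    unfolding a_def by (rule commuting_entries[OF A comm that])
  show "s \<le> t" using z w nz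
  proof (induction s arbitrary: t)
    case (Suc s)
    have z': "(j, s) \<in> block_positions \<mu>" "Suc s < \<mu> ! j" using Suc.prems by (auto simp: block_positions_def)
    have "a (j, Suc s) (l, t) = (if t = 0 then 0 else a (j, s) (l, t - 1))"
      using ce[OF z'(1) Suc.prems(2)] z'(2) by simp
    then have "t \<noteq> 0" "a (j, s) (l, t - 1) \<noteq> 0" using Suc.prems(3) by (auto split: if_splits)
    moreover have "(l, t - 1) \<in> block_positions \<mu>" using Suc.prems(2) by (auto simp: block_positions_def)
    ultimately show ?case using Suc.IH[of "t - 1"] z' by simp
  qed simp
  show "\<mu> ! l + s \<le> \<mu> ! j + t" using z w nz
  proof (induction "\<mu> ! l - t" arbitrary: s t)
    case 0
    then show ?case by (auto simp: block_positions_def)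
  next
    case (Suc d)
    show ?case
    proof (cases "Suc t < \<mu> ! l")
      case True
      have w': "(l, Suc t) \<in> block_positions \<mu>" using Suc.prems True by (auto simp: block_positions_def)
      have eq: "a (j, s) (l, t) = (if Suc s < \<mu> ! j then a (j, Suc s) (l, Suc t) else 0)"
        using ce[OF Suc.prems(1) w'] by simp
      then have s: "Suc s < \<mu> ! j" "a (j, Suc s) (l, Suc t) \<noteq> 0" using Suc.prems(3) by (auto split: if_splits)
      have "(j, Suc s) \<in> block_positions \<mu>" using Suc.prems(1) s by (auto simp: block_positions_def)
      moreover have "d = \<mu> ! l - Suc t" using Suc.hyps(2) by simp
      ultimately show ?thesis using Suc.hyps(1)[of "Suc t" "Suc s"] w' s by simp
    next
      case False
      then show ?thesis using Suc.prems by (auto simp: block_positions_def)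
    qed
  qed
qed

lemma commuting_entries_diagonal:
  fixes A :: "'a :: field mat" and \<mu> :: "nat list"
  defines "a \<equiv> \<lambda>z w. A $$ (block_index \<mu> z, block_index \<mu> w)"
  assumes A: "A \<in> carrier_mat (sum_list \<mu>) (sum_list \<mu>)"
    and comm: "A * nilpotent_jordan \<mu> = nilpotent_jordan \<mu> * A"
    and "(j, s) \<in> block_positions \<mu>" "(l, s) \<in> block_positions \<mu>"
  shows "a (j, s) (l, s) = a (j, 0) (l, 0)"
  using assms(4,5)
proof (induction s)
  case (Suc s)
  have v: "(j, s) \<in> block_positions \<mu>" "(l, s) \<in> block_positions \<mu>" "Suc s < \<mu> ! j"
    using Suc.prems by (auto simp: block_positions_def)
  have "a (j, s) (l, s) = a (j, Suc s) (l, Suc s)"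
    using commuting_entries[OF A comm v(1) Suc.prems(2)] v(3) by (simp add: a_def)
  then show ?case using Suc.IH v by simp
qed simp

text \<open>The triangular form of a nilpotent matrix, carried over from the indices below
  \<open>m\<close> to the numbers of the blocks of one order.\<close>

lemma level_triangularization:
  fixes N :: "nat \<Rightarrow> nat \<Rightarrow> 'a :: field"
  assumes e: "bij_betw e {0..<m} J" and nil: "mat m m (\<lambda>(i, k). N (e i) (e k)) ^\<^sub>m K = 0\<^sub>m m m"
  shows "\<exists>p \<rho>. (\<forall>j\<in>J. \<forall>l\<in>J. (\<Sum>i\<in>J. p j i * \<rho> i l) = (if j = l then 1 else 0)) \<and>
    (\<forall>j\<in>J. \<forall>l\<in>J. (\<Sum>j'\<in>J. \<Sum>l'\<in>J. \<rho> j j' * N j' l' * p l' l) \<noteq> 0 \<longrightarrow>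
       inv_into {0..<m} e j < inv_into {0..<m} e l)"
proof -
  define M where "M = mat m m (\<lambda>(i, k). N (e i) (e k))"
  have M: "M \<in> carrier_mat m m" by (simp add: M_def)
  obtain T where T: "T \<in> carrier_mat m m" "similar_mat M T"
    "\<And>i j. i < m \<Longrightarrow> j < m \<Longrightarrow> j \<le> i \<Longrightarrow> T $$ (i, j) = 0"
    using similar_strictly_upper_triangular[OF M nil[folded M_def]] by blast
  obtain P R where wit: "similar_mat_wit M T P R" using T(2) by (auto simp: similar_mat_def)
  note w = similar_mat_witD2[OF M wit]
  define i where "i = inv_into {0..<m} e"
  have ie: "i (e k) = k" if "k < m" for k
    unfolding i_def using e that by (simp add: bij_betw_def inv_into_f_f)
  have ei: "e (i j) = j" "i j < m" if "j \<in> J" for j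
    using e that inv_into_into[of j e "{0..<m}"] f_inv_into_f[of j e "{0..<m}"]
    by (auto simp: i_def bij_betw_def)
  define p where "p j l = P $$ (i j, i l)" for j l
  define \<rho> where "\<rho> j l = R $$ (i j, i l)" for j l
  have sumJ: "(\<Sum>j\<in>J. F j) = (\<Sum>k\<in>{0..<m}. F (e k))" for F :: "nat \<Rightarrow> 'a"
    using sum.reindex_bij_betw[OF e, of F] by simp
  have inverse: "(\<Sum>k\<in>J. p j k * \<rho> k l) = (if j = l then 1 else 0)" if "j \<in> J" "l \<in> J" for j l
  proof -
    have "(\<Sum>k\<in>J. p j k * \<rho> k l) = (\<Sum>k\<in>{0..<m}. P $$ (i j, k) * R $$ (k, i l))"
      unfolding sumJ p_def \<rho>_def by (intro sum.cong refl) (simp add: ie)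
    also have "\<dots> = (P * R) $$ (i j, i l)"
      using carrier_matD[OF w(6)] carrier_matD[OF w(7)] ei(2)[OF that(1)] ei(2)[OF that(2)]
      by (simp add: scalar_prod_def)
    also have "\<dots> = (if i j = i l then 1 else 0)" using w ei[OF that(1)] ei[OF that(2)] by simp
    also have "i j = i l \<longleftrightarrow> j = l" using ei[OF that(1)] ei[OF that(2)] by metis
    finally show ?thesis .
  qed
  have RMP: "R * M * P = T"
  proof -
    have "R * M = R * (P * T) * R" unfolding w(3)
      by (rule assoc_mult_mat[symmetric, OF w(7) mult_carrier_mat[OF w(6,5)] w(7)])
    also have "R * (P * T) = R * P * T" by (rule assoc_mult_mat[symmetric, OF w(7,6,5)])
    also have "\<dots> = T" using w by simp
    finally have "R * M * P = T * (R * P)" using assoc_mult_mat[OF w(5) w(7) w(6)] by simp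
    then show ?thesis using w by simp
  qed
  have "i j < i l" if jl: "j \<in> J" "l \<in> J" and nz: "(\<Sum>j'\<in>J. \<Sum>l'\<in>J. \<rho> j j' * N j' l' * p l' l) \<noteq> 0" for j l
  proof -
    have "(\<Sum>j'\<in>J. \<Sum>l'\<in>J. \<rho> j j' * N j' l' * p l' l)
        = (\<Sum>j'\<in>{0..<m}. \<Sum>l'\<in>{0..<m}. R $$ (i j, j') * M $$ (j', l') * P $$ (l', i l))"
      unfolding sumJ p_def \<rho>_def M_def by (intro sum.cong refl) (simp add: ie)
    also have "\<dots> = (\<Sum>l'\<in>{0..<m}. (\<Sum>j'\<in>{0..<m}. R $$ (i j, j') * M $$ (j', l')) * P $$ (l', i l))"
      by (subst sum.swap) (simp only: sum_distrib_right)
    also have "\<dots> = (R * M * P) $$ (i j, i l)"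
      using w M ei[OF jl(1)] ei[OF jl(2)] by (simp add: scalar_prod_def)
    finally have "T $$ (i j, i l) \<noteq> 0" using nz RMP by simp
    then show ?thesis using T(3)[of "i j" "i l"] ei[OF jl(1)] ei[OF jl(2)] by force
  qed
  then show ?thesis using inverse unfolding i_def by blast
qed


lemma pow_mat_commute:
  assumes "(A :: 'a :: semiring_1 mat) \<in> carrier_mat n n" "J \<in> carrier_mat n n" "A * J = J * A"
  shows "A ^\<^sub>m k * J = J * A ^\<^sub>m k"
proof (induction k)
  case (Suc k)
  note P = pow_carrier_mat[OF assms(1), of k]
  have "A ^\<^sub>m Suc k * J = A ^\<^sub>m k * (J * A)"
    using assoc_mult_mat[OF P assms(1,2)] assms(3) by simp
  also have "\<dots> = J * A ^\<^sub>m k * A" using assoc_mult_mat[OF P assms(2,1)] Suc by simp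
  also have "\<dots> = J * A ^\<^sub>m Suc k" using assoc_mult_mat[OF assms(2) P assms(1)] by simp
  finally show ?case .
qed (use assms in simp)

text \<open>So \<open>level_triangularization\<close> applies at every level, and a change of basis commuting with the
  Jordan matrix makes all constant coefficients strictly triangular.\<close>

lemma level_nilpotent:
  fixes A :: "'a :: field mat" and \<mu> :: "nat list"
  defines "a \<equiv> \<lambda>z w. A $$ (block_index \<mu> z, block_index \<mu> w)"
  assumes A: "A \<in> carrier_mat (sum_list \<mu>) (sum_list \<mu>)"
    and comm: "A * nilpotent_jordan \<mu> = nilpotent_jordan \<mu> * A"
    and nil: "A ^\<^sub>m K = 0\<^sub>m (sum_list \<mu>) (sum_list \<mu>)"
    and "0 < x" and e: "bij_betw e {0..<m} {j. j < length \<mu> \<and> \<mu> ! j = x}"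
  shows "mat m m (\<lambda>(i, k). a (e i, 0) (e k, 0)) ^\<^sub>m K = 0\<^sub>m m m"
proof -
  define M where "M = mat m m (\<lambda>(i, k). a (e i, 0) (e k, 0))"
  have M: "M \<in> carrier_mat m m" by (simp add: M_def)
  have eJ: "e i < length \<mu>" "\<mu> ! e i = x" if "i < m" for i
    using bij_betwE[OF e] that by auto
  have pos: "(e i, 0) \<in> block_positions \<mu>" if "i < m" for i
    using eJ[OF that] \<open>0 < x\<close> by (simp add: block_positions_def)
  have "(M ^\<^sub>m k) $$ (i, i') = (A ^\<^sub>m k) $$ (block_index \<mu> (e i, 0), block_index \<mu> (e i', 0))"
    if "i < m" "i' < m" for i i' k
    using that(2)
  proof (induction k arbitrary: i')
    case 0
    have "block_index \<mu> (e i, 0) = block_index \<mu> (e i', 0) \<longleftrightarrow> i = i'"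
      using block_index_inj[OF pos[OF that(1)] pos[OF 0]] that(1) 0 e
      by (auto simp: bij_betw_def inj_on_def)
    then show ?case using that(1) 0 block_index_less[OF pos[OF that(1)]] block_index_less[OF pos[OF 0]]
        carrier_matD(1)[OF A] carrier_matD(1)[OF M] by simp
  next
    case (Suc k)
    let ?f = "block_index \<mu>"
    note Ak = pow_carrier_mat[OF A, of k] and Mk = pow_carrier_mat[OF M, of k]
    have S: "(\<lambda>i. (e i, 0)) ` {0..<m} \<subseteq> block_positions \<mu>" using pos by auto
    have inj: "inj_on (\<lambda>i. (e i, 0 :: nat)) {0..<m}" using e by (auto simp: bij_betw_def inj_on_def)
    have "(A ^\<^sub>m Suc k) $$ (?f (e i, 0), ?f (e i', 0)) =
        (\<Sum>y\<in>block_positions \<mu>. (A ^\<^sub>m k) $$ (?f (e i, 0), ?f y) * a y (e i', 0))"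
      using carrier_matD[OF A] carrier_matD[OF Ak] block_index_less[OF pos[OF that(1)]] block_index_less[OF pos[OF Suc.prems]]
      by (simp add: scalar_prod_def atLeast0LessThan sum_block_index a_def)
    also have "\<dots> = (\<Sum>y\<in>(\<lambda>i. (e i, 0)) ` {0..<m}. (A ^\<^sub>m k) $$ (?f (e i, 0), ?f y) * a y (e i', 0))"
    proof (rule sum.mono_neutral_right[OF _ S], simp, rule ballI, rule ccontr)
      \<comment> \<open>The intermediate position is squeezed: the entry of \<open>A\<close> forces
        position 0 and order at least \<open>x\<close>, the entry of \<open>A ^ k\<close> forces
        order at most \<open>x\<close>. So taking constant coefficients is compatible with
        products.\<close>
      fix y assume y: "y \<in> block_positions \<mu> - (\<lambda>i. (e i, 0)) ` {0..<m}"
        and nz: "(A ^\<^sub>m k) $$ (?f (e i, 0), ?f y) * a y (e i', 0) \<noteq> 0"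
      obtain j s where js: "y = (j, s)" by (cases y)
      have yp: "(j, s) \<in> block_positions \<mu>" using y js by simp
      have nz1: "a (j, s) (e i', 0) \<noteq> 0" and nz2: "(A ^\<^sub>m k) $$ (?f (e i, 0), ?f (j, s)) \<noteq> 0"
        using nz js by auto
      have s: "s = 0" "x \<le> \<mu> ! j"
        using commuting_entries_le[OF A comm yp pos[OF Suc.prems]] nz1 eJ[OF Suc.prems] by (auto simp: a_def)
      have "\<mu> ! j \<le> x"
        using commuting_entries_le(2)[OF Ak pow_mat_commute[OF A nilpotent_jordan_carrier comm] pos[OF that(1)] yp nz2]
          eJ[OF that(1)] s by simp
      then have "j \<in> e ` {0..<m}" using s yp e by (auto simp: bij_betw_def block_positions_def)
      then show False using y js s by auto
    qed
    also have "\<dots> = (\<Sum>l\<in>{0..<m}. (M ^\<^sub>m k) $$ (i, l) * M $$ (l, i'))"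
      unfolding sum.reindex[OF inj] using Suc by (intro sum.cong refl) (simp add: M_def)
    also have "\<dots> = (M ^\<^sub>m Suc k) $$ (i, i')"
      using carrier_matD[OF M] carrier_matD[OF Mk] that(1) Suc.prems by (simp add: scalar_prod_def)
    finally show ?case by simp
  qed
  then have "M ^\<^sub>m K = 0\<^sub>m m m"
    using nil block_index_less[OF pos] carrier_matD[OF pow_carrier_mat[OF M, of K]] by (intro eq_matI) auto
  then show ?thesis by (simp add: M_def)
qed

lemma nilpotent_commutator_minor_bound:
  fixes A :: "'a :: field mat"
  assumes "A \<in> nilpotent_commutator B" and minor: "has_minor (sum_list B) \<rho> (A ^\<^sub>m m)"
  shows "\<exists>ss. sorted ss \<and> \<rho> + length ss * m \<le> config_weight B ss"
proof -
  define n where "n = sum_list B"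
  define T where "T = length B"
  obtain K where A: "A \<in> carrier_mat (sum_list B) (sum_list B)" and nil: "A ^\<^sub>m K = 0\<^sub>m (sum_list B) (sum_list B)"
    and comm: "A * nilpotent_jordan B = nilpotent_jordan B * A"
    using assms(1) by (auto simp: nilpotent_commutator_def nilpotent_mat_def)
  define f where "f = block_index B"
  define a where "a z w = A $$ (f z, f w)" for z w
  have le: "s \<le> t \<and> B ! l + s \<le> B ! j + t"
    if "(j, s) \<in> block_positions B" "(l, t) \<in> block_positions B" "a (j, s) (l, t) \<noteq> 0" for j s l t
    using commuting_entries_le[OF A comm that(1,2)] that(3) by (simp add: a_def f_def)
  have diag: "a (j, s) (l, s) = a (j, 0) (l, 0)"
    if "(j, s) \<in> block_positions B" "(l, s) \<in> block_positions B" for j s l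
    using commuting_entries_diagonal[OF A comm that] by (simp add: a_def f_def)
  define J where "J x = {j. j < T \<and> B ! j = x}" for x
  have finJ: "finite (J x)" for x by (simp add: J_def)
  have "\<exists>e. bij_betw e {0..<card (J x)} (J x)" for x using ex_bij_betw_nat_finite[OF finJ] by blast
  then have "\<forall>x. \<exists>e. bij_betw e {0..<card (J x)} (J x)" by blast
  from choice[OF this] obtain e where e: "\<And>x. bij_betw (e x) {0..<card (J x)} (J x)" by blast
  define ord where "ord j = inv_into {0..<card (J (B ! j))} (e (B ! j)) j" for j
  define good where "good x p q \<longleftrightarrow>
      (\<forall>j\<in>J x. \<forall>l\<in>J x. (\<Sum>i\<in>J x. p j i * q i l) = (if j = l then 1 else 0)) \<and>
      (\<forall>j\<in>J x. \<forall>l\<in>J x. (\<Sum>j'\<in>J x. \<Sum>l'\<in>J x. q j j' * a (j', 0) (l', 0) * p l' l) \<noteq> 0 \<longrightarrow> ord j < ord l)"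
    for x and p q :: "nat \<Rightarrow> nat \<Rightarrow> 'a"
  have "\<exists>p q. 0 < x \<longrightarrow> good x p q" for x
  proof (cases "0 < x")
    case True
    have nilx: "mat (card (J x)) (card (J x)) (\<lambda>(i, k). a (e x i, 0) (e x k, 0)) ^\<^sub>m K = 0\<^sub>m (card (J x)) (card (J x))"
      using level_nilpotent[OF A comm nil True, of "e x" "card (J x)"] e[of x] by (simp add: J_def T_def a_def f_def)
    have ordx: "inv_into {0..<card (J x)} (e x) j = ord j" if "j \<in> J x" for j
      using that by (simp add: ord_def J_def)
    from level_triangularization[OF e nilx] obtain p q where
      pq: "\<forall>j\<in>J x. \<forall>l\<in>J x. (\<Sum>i\<in>J x. p j i * q i l) = (if j = l then 1 else 0)"
        "\<forall>j\<in>J x. \<forall>l\<in>J x. (\<Sum>j'\<in>J x. \<Sum>l'\<in>J x. q j j' * a (j', 0) (l', 0) * p l' l) \<noteq> 0 \<longrightarrow>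
           inv_into {0..<card (J x)} (e x) j < inv_into {0..<card (J x)} (e x) l"
      by blast
    have "good x p q" unfolding good_def using pq ordx by auto
    then show ?thesis by blast
  qed simp
  then have "\<forall>x. \<exists>pq. 0 < x \<longrightarrow> good x (fst pq) (snd pq)" by simp
  from choice[OF this] obtain PQ where PQ': "\<forall>x. 0 < x \<longrightarrow> good x (fst (PQ x)) (snd (PQ x))" by blast
  define P where "P x = fst (PQ x)" for x
  define Q' where "Q' x = snd (PQ x)" for x
  have PQ: "good x (P x) (Q' x)" if "0 < x" for x using PQ' that by (simp add: P_def Q'_def)
  define p where "p j l = (if j < T \<and> l < T \<and> B ! j = B ! l then P (B ! j) j l else 0)" for j l
  define q where "q j l = (if j < T \<and> l < T \<and> B ! j = B ! l then Q' (B ! j) j l else 0)" for j l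
  have supp: "p j l = 0" "q j l = 0" if "B ! j \<noteq> B ! l" for j l using that by (auto simp: p_def q_def)
  have inverse: "(\<Sum>i<T. p j i * q i l) = (if j = l then 1 else 0)" if "j < T" "l < T" "0 < B ! j" for j l
  proof (cases "B ! j = B ! l")
    case True
    have "(\<Sum>i<T. p j i * q i l) = (\<Sum>i\<in>J (B ! j). P (B ! j) j i * Q' (B ! j) i l)"
      using that True by (intro sum.mono_neutral_cong_right) (auto simp: J_def p_def q_def)
    then show ?thesis using PQ[OF that(3)] that True by (simp add: good_def J_def)
  next
    case False
    have "p j i * q i l = 0" for i using supp[of j i] supp[of i l] False by (cases "B ! j = B ! i") auto
    then show ?thesis using False by auto
  qed
  define V where "V = block_positions B"
  have finV: "finite V" and cardV: "card V = n" by (simp_all add: V_def card_block_positions n_def)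
  define g where "g = inv_into V f"
  have gf: "g (f z) = z" if "z \<in> V" for z
    unfolding g_def using inj_on_block_index[of B] that by (simp add: f_def V_def)
  have sumV: "(\<Sum>z\<in>V. F z) = (\<Sum>j<T. \<Sum>s<B ! j. F (j, s))" for F :: "nat \<times> nat \<Rightarrow> 'a"
    unfolding V_def block_positions_def T_def by (simp add: sum.Sigma)
  have sumV_level: "(\<Sum>z\<in>V. F z) = (\<Sum>j<T. F (j, s))"
    if F: "\<And>j t. t \<noteq> s \<Longrightarrow> F (j, t) = 0" "\<And>j. B ! j \<le> s \<Longrightarrow> F (j, s) = 0" for F :: "nat \<times> nat \<Rightarrow> 'a" and s
    unfolding sumV
  proof (rule sum.cong[OF refl])
    fix j
    have "(\<Sum>t<B ! j. F (j, t)) = (\<Sum>t<B ! j. if t = s then F (j, s) else 0)"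
      using F(1) by (intro sum.cong) auto
    also have "\<dots> = F (j, s)" using F(2)[of j] by (cases "s < B ! j") auto
    finally show "(\<Sum>t<B ! j. F (j, t)) = F (j, s)" .
  qed
  \<comment> \<open>The new basis mixes blocks of equal order only, and in the same way at every
    position. Hence \<open>C\<close>, the matrix in this basis, is subject to the same restrictions
    on nonzero entries as \<open>A\<close>, with strict triangularity in addition.\<close>
  define bb where "bb v z = (if snd v = snd z then p (fst z) (fst v) else 0)" for v z :: "nat \<times> nat"
  define C where "C w v = (\<Sum>j<T. \<Sum>l<T. q (fst w) j * a (j, snd w) (l, snd v) * p l (fst v))" for w v :: "nat \<times> nat"
  \<comment> \<open>Position weakly down, distance to the end weakly up, ties broken by the
    triangular order. Two incomparable elements differ strictly, and in the same direction, in both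
    coordinates; so antichains for \<open>r\<close> are chains in the quadrant.\<close>
  define r where "r v w \<longleftrightarrow> snd w \<le> snd v \<and> B ! fst v + snd w \<le> B ! fst w + snd v \<and>
     (snd v = snd w \<and> B ! fst v = B ! fst w \<longrightarrow> ord (fst w) < ord (fst v))" for v w :: "nat \<times> nat"
  have irrefl: "\<not> r x x" for x by (simp add: r_def)
  have trans: "r x z" if xy: "r x y" and yz: "r y z" for x y z
  proof -
    have ineqs: "snd y \<le> snd x" "snd z \<le> snd y" "B ! fst x + snd y \<le> B ! fst y + snd x"
      "B ! fst y + snd z \<le> B ! fst z + snd y"
      using xy yz by (auto simp: r_def)
    have "ord (fst z) < ord (fst x)" if "snd x = snd z" "B ! fst x = B ! fst z"
    proof -
      have "snd y = snd x" "B ! fst y = B ! fst x" using ineqs that by linarith+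
      then show ?thesis using xy yz that by (auto simp: r_def)
    qed
    then show ?thesis using ineqs unfolding r_def by auto
  qed
  have strict: "r v w" if v: "v \<in> V" and w: "w \<in> V" and nz: "C w v \<noteq> 0" for v w
  proof -
    obtain j s l t where vw: "w = (j, s)" "v = (l, t)" by (cases v; cases w) auto
    have valid: "j < T" "l < T" "s < B ! j" "t < B ! l"
      using v w by (auto simp: vw V_def block_positions_def T_def)
    have "(\<Sum>j'<T. \<Sum>l'<T. q j j' * a (j', s) (l', t) * p l' l) \<noteq> 0" using nz by (simp add: C_def vw)
    from sum.not_neutral_contains_not_neutral[OF this] obtain j'
      where j': "j' < T" "(\<Sum>l'<T. q j j' * a (j', s) (l', t) * p l' l) \<noteq> 0" by auto
    from sum.not_neutral_contains_not_neutral[OF j'(2)] obtain l'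
      where l': "l' < T" "q j j' * a (j', s) (l', t) * p l' l \<noteq> 0" by auto
    have lev: "B ! j = B ! j'" "B ! l' = B ! l" using l'(2) supp by auto
    have "(j', s) \<in> block_positions B" "(l', t) \<in> block_positions B"
      using lev valid j' l' by (auto simp: block_positions_def T_def)
    then have "s \<le> t" "B ! l + s \<le> B ! j + t" using le[of j' s l' t] l'(2) lev by auto
    moreover have "ord j < ord l" if "t = s" "B ! l = B ! j"
    proof -
      define x where "x = B ! j"
      have x0: "0 < x" using valid by (simp add: x_def)
      have jl: "j \<in> J x" "l \<in> J x" using valid that by (auto simp: J_def x_def)
      have pos: "(i, s) \<in> block_positions B" if "i \<in> J x" for i
        using that valid by (auto simp: J_def x_def block_positions_def T_def)
      have sub: "J x \<subseteq> {..<T}" by (auto simp: J_def)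
      have off: "q j i = 0" "p i l = 0" if "i \<in> {..<T} - J x" for i
        using that jl by (auto simp: J_def intro!: supp)
      have "C w v = (\<Sum>j'<T. \<Sum>l'<T. q j j' * a (j', s) (l', s) * p l' l)"
        unfolding C_def vw using that by simp
      also have "\<dots> = (\<Sum>j'\<in>J x. \<Sum>l'<T. q j j' * a (j', s) (l', s) * p l' l)"
        using off by (intro sum.mono_neutral_right[OF _ sub]) auto
      also have "\<dots> = (\<Sum>j'\<in>J x. \<Sum>l'\<in>J x. q j j' * a (j', s) (l', s) * p l' l)"
        using off by (intro sum.cong refl sum.mono_neutral_right[OF _ sub]) auto
      also have "\<dots> = (\<Sum>j'\<in>J x. \<Sum>l'\<in>J x. Q' x j j' * a (j', 0) (l', 0) * P x l' l)"
        using diag[OF pos pos] jl by (intro sum.cong refl) (auto simp: p_def q_def J_def)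
      finally show ?thesis using PQ[OF x0] nz jl unfolding good_def by auto
    qed
    ultimately show ?thesis by (auto simp: r_def vw)
  qed
  have step: "(\<Sum>l<n. A $$ (i, l) * bb v (g l)) = (\<Sum>w\<in>V. C w v * bb w (g i))"
    if v: "v \<in> V" and i: "i < n" for v i
  proof -
    obtain z where z: "z \<in> V" "i = f z" using i unfolding n_def V_def f_def by (rule block_index_cases)
    have lv: "snd v < B ! fst v" "snd z < B ! fst z" "fst z < T"
      using v z by (auto simp: V_def block_positions_def T_def)
    have "(\<Sum>l<n. A $$ (i, l) * bb v (g l)) = (\<Sum>y\<in>V. a z y * bb v y)"
      unfolding n_def sum_block_index V_def[symmetric] f_def[symmetric] z(2) a_def
      by (intro sum.cong refl) (simp add: gf)
    also have "\<dots> = (\<Sum>l<T. a z (l, snd v) * p l (fst v))"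
      using supp lv by (subst sumV_level[of "snd v"]) (auto simp: bb_def)
    finally have lhs: "(\<Sum>l<n. A $$ (i, l) * bb v (g l)) = (\<Sum>l<T. a z (l, snd v) * p l (fst v))" .
    have "(\<Sum>w\<in>V. C w v * bb w (g i)) = (\<Sum>j<T. C (j, snd z) v * p (fst z) j)"
      using supp lv by (subst sumV_level[of "snd z"]) (auto simp: bb_def z gf)
    also have "\<dots> = (\<Sum>j<T. \<Sum>j'<T. p (fst z) j * q j j' * (\<Sum>l<T. a (j', snd z) (l, snd v) * p l (fst v)))"
      by (simp add: C_def sum_distrib_left sum_distrib_right mult_ac)
    also have "\<dots> = (\<Sum>j'<T. (\<Sum>j<T. p (fst z) j * q j j') * (\<Sum>l<T. a (j', snd z) (l, snd v) * p l (fst v)))"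
      by (subst sum.swap) (simp only: sum_distrib_right)
    also have "\<dots> = (\<Sum>j'<T. if j' = fst z then (\<Sum>l<T. a (j', snd z) (l, snd v) * p l (fst v)) else 0)"
      using inverse[of "fst z"] lv by (intro sum.cong refl) auto
    also have "\<dots> = (\<Sum>l<T. a z (l, snd v) * p l (fst v))" using lv by simp
    finally show ?thesis using lhs by simp
  qed
  have span: "(if i = x then 1 else 0) =
      (\<Sum>v\<in>V. bb v (g i) * (if snd v = snd (g x) then q (fst v) (fst (g x)) else 0))"
    if x: "x < n" and i: "i < n" for x i
  proof -
    obtain z where z: "z \<in> V" "i = f z" using i unfolding n_def V_def f_def by (rule block_index_cases)
    obtain y where y: "y \<in> V" "x = f y" using x unfolding n_def V_def f_def by (rule block_index_cases)
    have lv: "snd z < B ! fst z" "fst z < T" "fst y < T"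
      using z y by (auto simp: V_def block_positions_def T_def)
    have "(\<Sum>v\<in>V. bb v (g i) * (if snd v = snd (g x) then q (fst v) (fst (g x)) else 0)) =
        (\<Sum>l<T. p (fst z) l * (if snd z = snd y then q l (fst y) else 0))"
      unfolding z(2) y(2) gf[OF z(1)] gf[OF y(1)]
      using supp lv by (subst sumV_level[of "snd z"]) (auto simp: bb_def cong: if_cong)
    also have "\<dots> = (if snd z = snd y then (\<Sum>l<T. p (fst z) l * q l (fst y)) else 0)" by simp
    also have "\<dots> = (if z = y then 1 else 0)" using inverse[of "fst z" "fst y"] lv by (cases "snd z = snd y") (simp_all add: prod_eq_iff)
    also have "z = y \<longleftrightarrow> i = x"
    proof
      assume "i = x"
      then have "g (f z) = g (f y)" using z(2) y(2) by simp
      then show "z = y" unfolding gf[OF z(1)] gf[OF y(1)] .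
    qed (simp add: z(2) y(2))
    finally show ?thesis by simp
  qed
  obtain Z \<tau> X k where Z: "Z \<subseteq> V" "\<And>v. v \<in> Z \<Longrightarrow> 1 \<le> \<tau> v \<and> \<tau> v \<le> m"
      "\<And>v w. \<lbrakk>v \<in> Z; w \<in> Z; r v w\<rbrakk> \<Longrightarrow> \<tau> v < (\<tau> w :: nat)"
    and X: "X \<subseteq> V" "\<And>A. \<lbrakk>A \<subseteq> X; \<And>a b. a \<in> A \<Longrightarrow> b \<in> A \<Longrightarrow> \<not> r a b\<rbrakk> \<Longrightarrow> card A \<le> k"
    and card: "card V + k * m \<le> card X + card Z"
    by (rule greene_kleitman_duality[where V = V and r = r and m = m, OF finV irrefl trans]) blast+
  have "\<rho> + card Z \<le> card V"
    by (rule has_minor_pow_cut[where A = A and n = n and V = V and b = "\<lambda>v l. bb v (g l)" and r = r and C = C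
          and q = "\<lambda>v x. if snd v = snd (g x) then q (fst v) (fst (g x)) else 0" and \<tau> = \<tau> and m = m])
      (fact A[folded n_def] finV trans step strict span Z minor[folded n_def])+
  then have \<rho>: "\<rho> + k * m \<le> card X" using card by simp
  have "\<exists>ss. sorted ss \<and> length ss \<le> k \<and> card X \<le> config_weight B ss"
  proof (rule card_le_config_weight)
    show XV: "X \<subseteq> {(j, a). j < length B \<and> a < B ! j}" using X(1) by (auto simp: V_def block_positions_def)
    fix S assume S: "S \<subseteq> X" and chain: "\<And>j a j' a'. \<lbrakk>(j, a) \<in> S; (j', a') \<in> S; (j, a) \<noteq> (j', a')\<rbrakk> \<Longrightarrow>
       a < a' \<and> B ! j - 1 - a < B ! j' - 1 - a' \<or> a' < a \<and> B ! j' - 1 - a' < B ! j - 1 - a"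
    show "card S \<le> k"
    proof (rule X(2)[OF S])
      fix v w assume vw: "v \<in> S" "w \<in> S"
      show "\<not> r v w"
      proof (cases "v = w")
        case False
        obtain j a j' a' where eq: "v = (j, a)" "w = (j', a')" by (cases v; cases w) auto
        have "a < B ! j" "a' < B ! j'" using vw S XV by (auto simp: eq)
        then show ?thesis using chain[of j a j' a'] vw False unfolding r_def eq by auto
      qed (simp add: irrefl)
    qed
  qed
  then obtain ss where ss: "sorted ss" "length ss \<le> k" "card X \<le> config_weight B ss" by blast
  have "\<rho> + length ss * m \<le> config_weight B ss"
    using \<rho> ss(3) mult_le_mono1[OF ss(2), of m] by linarith
  then show ?thesis using ss(1) by blast
qed

section \<open>Degeneration to a partial permutation\<close>

text \<open>The configuration consists of the entries below \<open>k\<close>. The later ones lie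
  beyond all parts and only spare a case distinction; \<open>present\<close> excludes paths that
  have no block to exhaust.\<close>

locale level_paths =
  fixes B :: "nat list" and s :: "nat \<Rightarrow> nat" and k :: nat
  assumes sorted_B: "sorted_wrt (\<ge>) B" and pos_B: "\<And>x. x \<in> set B \<Longrightarrow> 1 \<le> x"
    and mono_s: "mono s" and pos_s: "\<And>i. 1 \<le> s i"
    and present: "\<And>i. i < k \<Longrightarrow> s i + 2 * i \<in> set B \<or> s i + 2 * i + 1 \<in> set B"
    and far: "\<And>i x. k \<le> i \<Longrightarrow> x \<in> set B \<Longrightarrow> x < s i + 2 * i"
begin

text \<open>The matrix has powers of a parameter as entries and is conjugated by the diagonal matrix of the powers
  \<open>H x a\<close>, where \<open>x\<close> is the order of the block and \<open>a\<close> the distance to its end. The slopes \<open>\<tau>\<close> are chosen such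
  that no negative exponents arise and that the entries of exponent \<open>0\<close> are exactly the steps of the paths
  of the configuration. The larger order of the pair at index \<open>i\<close> is \<open>p i\<close>. The paths leave
  the blocks of order \<open>x\<close> towards smaller ones from the last \<open>lo x\<close> positions and towards larger ones from the
  first \<open>hi x\<close> positions; if only one order of a pair is present, then the path loops through the others.\<close>

definition p :: "nat \<Rightarrow> nat" where "p i = s i + 2 * i + 1"

definition K :: "nat \<Rightarrow> nat" where "K x = (LEAST i. x \<le> p i)"

definition \<rho> :: "nat \<Rightarrow> nat" where "\<rho> x = (if x + 1 = p (K x) then x + 1 else x)"

definition \<tau> :: "nat \<Rightarrow> nat \<Rightarrow> nat" where "\<tau> x d = min (2 * \<rho> x) (2 * p (d + 1) - 1)"

definition H :: "nat \<Rightarrow> nat \<Rightarrow> nat" where "H x a = (\<Sum>b<a. \<tau> x (min b (x - 2 - b)))"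

definition lo :: "nat \<Rightarrow> nat" where
  "lo x = (if x = p (K x) \<and> x - 1 \<in> set B then x - 1 - K x else K x)"

definition hi :: "nat \<Rightarrow> nat" where
  "hi x = (if x = p (K x) then K x + 1 else if x + 1 = p (K x) then (if x + 1 \<in> set B then x - K x else K x + 1)
     else K x)"

definition loop :: "nat \<Rightarrow> bool" where
  "loop x \<longleftrightarrow> x = p (K x) \<and> x - 1 \<notin> set B \<or> x + 1 = p (K x) \<and> x + 1 \<notin> set B"

definition on_path :: "nat \<Rightarrow> nat \<Rightarrow> bool" where
  "on_path x a \<longleftrightarrow> a < lo x \<or> x - 1 - a < hi x \<or> loop x"

definition consecutive :: "nat \<Rightarrow> nat \<Rightarrow> bool" where
  "consecutive x y \<longleftrightarrow> x \<in> set B \<and> y \<in> set B \<and> y < x \<and> s 0 \<le> y \<and> (\<forall>z\<in>set B. \<not> (y < z \<and> z < x))"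

section \<open>Slopes, and the positions at which paths pass between orders\<close>

lemma p_Suc: "p i + 2 \<le> p (Suc i)"
  using monoD[OF mono_s, of i "Suc i"] by (simp add: p_def)

lemma p_mono: "i \<le> j \<Longrightarrow> p i \<le> p j"
  using monoD[OF mono_s, of i j] by (simp add: p_def)

lemma p_less: "i < j \<Longrightarrow> p i + 2 \<le> p j"
  using p_Suc[of i] p_mono[of "Suc i" j] by simp

lemma p_ge: "2 * i + 2 \<le> p i"
  using pos_s[of i] by (simp add: p_def)

lemma K_le: "x \<le> p (K x)"
  unfolding K_def by (rule LeastI[of _ x]) (use p_ge[of x] in linarith)

lemma less_K_iff: "i < K x \<longleftrightarrow> p i < x"
proof
  assume "i < K x"
  then show "p i < x" unfolding K_def using not_less_Least by force
next
  assume "p i < x"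
  then show "i < K x" using K_le[of x] p_mono[of "K x" i] by (meson leD le_less_trans not_le)
qed

lemma K_eqI: "x \<le> p i \<Longrightarrow> (\<And>j. j < i \<Longrightarrow> p j < x) \<Longrightarrow> K x = i"
  using less_K_iff[of i x] less_K_iff[of "K x" x] by (metis leD linorder_neqE_nat less_irrefl)

lemma K_p: "K (p i) = i"
  using p_less[of _ i] by (intro K_eqI) force+

lemma K_less: "2 * K x < x \<or> K x = 0"
proof (cases "K x")
  case (Suc i)
  then have "p i < x" using less_K_iff[of i x] by simp
  then show ?thesis using p_ge[of i] Suc by simp
qed simp

lemma K_le_k: "x \<in> set B \<Longrightarrow> K x \<le> k"
  using far[of k x] less_K_iff[of k x] by (force simp: p_def)

lemma K_less_k: "x \<in> set B \<Longrightarrow> x = p (K x) \<or> x + 1 = p (K x) \<Longrightarrow> K x < k"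
  using far[of "K x" x] by (force simp: p_def)

lemma K_mono: "y \<le> x \<Longrightarrow> K y \<le> K x"
proof (rule ccontr)
  assume "y \<le> x" "\<not> K y \<le> K x"
  then show False using less_K_iff[of "K x" y] K_le[of x] by linarith
qed

lemma \<rho>_mono: "y < x \<Longrightarrow> \<rho> y \<le> \<rho> x"
  by (auto simp: \<rho>_def)

lemma \<tau>_mono: "\<lbrakk>y < x; d \<le> d'\<rbrakk> \<Longrightarrow> \<tau> y d \<le> \<tau> x d'"
  using \<rho>_mono[of y x] p_mono[of "d + 1" "d' + 1"] by (auto simp: \<tau>_def min_def)

lemma H_mono: "y < x \<Longrightarrow> H y a \<le> H x a"
  unfolding H_def by (intro sum_mono \<tau>_mono) auto

lemma H_mono2: "a \<le> a' \<Longrightarrow> H x a \<le> H x a'"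
  unfolding H_def by (intro sum_mono2) auto

lemma H_symmetric: "a < x \<Longrightarrow> H x a + H x (x - 1 - a) = H x (x - 1)"
proof -
  assume a: "a < x"
  define g where "g b = \<tau> x (min b (x - 2 - b))" for b
  have "H x (x - 1) = (\<Sum>b<a. g b) + (\<Sum>b\<in>{a..<x - 1}. g b)"
    unfolding H_def g_def[symmetric] using a
    by (subst sum.union_disjoint[symmetric]) (auto intro!: sum.cong)
  also have "(\<Sum>b\<in>{a..<x - 1}. g b) = (\<Sum>b<x - 1 - a. g b)"
  proof (rule sum.reindex_bij_witness[of _ "\<lambda>b. x - 2 - b" "\<lambda>b. x - 2 - b"])
    fix b assume "b \<in> {a..<x - 1}"
    then have "x - 2 - (x - 2 - b) = b" by auto
    then show "g (x - 2 - b) = g b" by (simp add: g_def min.commute)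
  qed (use a in auto)
  finally show ?thesis by (simp add: H_def g_def)
qed

lemma H_eq_iff:
  assumes "y < x"
  shows "H x a = H y a \<longleftrightarrow> (\<forall>b<a. \<tau> x (min b (x - 2 - b)) = \<tau> y (min b (y - 2 - b)))"
proof
  assume eq: "H x a = H y a"
  show "\<forall>b<a. \<tau> x (min b (x - 2 - b)) = \<tau> y (min b (y - 2 - b))"
  proof (intro allI impI)
    fix b assume "b < a"
    have "(\<Sum>b<a. \<tau> y (min b (y - 2 - b))) = (\<Sum>b<a. \<tau> x (min b (x - 2 - b)))"
      using eq by (simp add: H_def)
    then have "\<tau> y (min b (y - 2 - b)) = \<tau> x (min b (x - 2 - b))"
      by (rule sum_mono_inv) (use \<open>b < a\<close> assms in \<open>auto intro!: \<tau>_mono\<close>)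
    then show "\<tau> x (min b (x - 2 - b)) = \<tau> y (min b (y - 2 - b))" by simp
  qed
qed (simp add: H_def)

lemma consecutive_ge:
  assumes "consecutive x y" "i < K x"
  shows "p i \<le> y + 1"
proof -
  have pi: "p i < x" using assms(2) less_K_iff by simp
  have "x \<in> set B" using assms(1) by (simp add: consecutive_def)
  then have "i < k" using pi far[of i x] by (force simp: p_def)
  from present[OF this] show ?thesis using assms(1) pi unfolding consecutive_def p_def
    by (metis Suc_eq_plus1 Suc_leI le_SucI less_Suc_eq not_le not_less_eq)
qed

lemma consecutive_K:
  assumes "consecutive x y"
  shows "K x = (if y = p (K y) \<or> y + 1 = p (K y) \<and> x \<noteq> y + 1 then K y + 1 else K y)"
proof -
  have yx: "y < x" using assms by (simp add: consecutive_def)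
  have "K y \<le> K x" using K_mono yx by simp
  have only: "p i = y \<or> p i = y + 1" "i = K y" if "K y \<le> i" "i < K x" for i
  proof -
    have "p i \<le> y + 1" using consecutive_ge[OF assms that(2)] .
    moreover have "y \<le> p i" using K_le[of y] p_mono[OF that(1)] by simp
    ultimately show "p i = y \<or> p i = y + 1" by linarith
    show "i = K y"
    proof (rule ccontr)
      assume "i \<noteq> K y"
      then have "p (K y) + 2 \<le> p i" using p_less that by simp
      then show False using K_le[of y] \<open>p i \<le> y + 1\<close> by linarith
    qed
  qed
  have "K x \<le> K y + 1"
  proof (rule ccontr)
    assume "\<not> ?thesis"
    then show False using only(2)[of "K y + 1"] by simp
  qed
  moreover have "K y < K x \<longleftrightarrow> p (K y) < x" by (rule less_K_iff)
  ultimately show ?thesis using only(1)[of "K y"] \<open>K y \<le> K x\<close> yx by (auto split: if_splits)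
qed

text \<open>Between neighbouring orders equally many positions are used downwards and upwards. This
  turns disjointness of the sources into disjointness of the targets.\<close>

lemma consecutive_lo_hi:
  assumes "consecutive x y"
  shows "lo x = hi y"
proof -
  have xy: "y < x" "x \<in> set B" "y \<in> set B" and between: "\<And>z. z \<in> set B \<Longrightarrow> \<not> (y < z \<and> z < x)"
    using assms by (auto simp: consecutive_def)
  note Kx = consecutive_K[OF assms]
  show ?thesis
  proof (cases "x = p (K x) \<and> x - 1 \<in> set B")
    case True
    then have yx: "y = x - 1" using between[of "x - 1"] xy by linarith
    have "K y = K x" using True yx p_less[of _ "K x"] by (intro K_eqI) force+
    then show ?thesis using True yx xy by (simp add: lo_def hi_def)
  next
    case False
    have lo: "lo x = K x" using False by (simp only: lo_def if_False)
    have 1: "y + 1 \<noteq> p (K y)" if "x = y + 1"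
    proof
      assume "y + 1 = p (K y)"
      then have "x = p (K x)" using K_p[of "K y"] that by simp
      moreover have "x - 1 \<in> set B" using that xy(3) by simp
      ultimately show False using False by blast
    qed
    have 2: "y + 1 \<in> set B \<Longrightarrow> x = y + 1" using between[of "y + 1"] xy by linarith
    consider (a) "p (K y) = y" | (b) "p (K y) = y + 1" | (c) "p (K y) \<noteq> y" "p (K y) \<noteq> y + 1" by blast
    then show ?thesis
    proof cases
      case a
      then show ?thesis unfolding lo Kx hi_def by simp
    next
      case b
      then have "x \<noteq> y + 1" "y + 1 \<notin> set B" using 1 2 by auto
      then show ?thesis using b unfolding lo Kx hi_def by simp
    next
      case c
      then have "y \<noteq> p (K y)" "y + 1 \<noteq> p (K y)" by metis+
      then show ?thesis unfolding lo Kx hi_def by (simp only: if_False simp_thms refl)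
    qed
  qed
qed

text \<open>At depths \<open>d\<close> with \<open>d + 1 < K x\<close> both slopes equal the cap
  \<open>2 * p (d + 1) - 1\<close>; at depth \<open>K x - 1\<close> the larger order is strictly
  steeper. If instead \<open>x\<close> and \<open>y\<close> form a pair, \<open>\<rho>\<close> gives
  them the same slopes, and they first differ where the shorter block has returned to depth
  \<open>K x - 1\<close> and the longer one has not. That is a real difference because the cap there
  is one less than the inner slope \<open>2 * p (K x)\<close>.\<close>

lemma H_consecutive:
  assumes cons: "consecutive x y" and "a < y"
  shows "H x a = H y a \<longleftrightarrow> a < lo x"
proof -
  have xy: "y < x" "x \<in> set B" "y \<in> set B" "s 0 \<le> y" and between: "\<And>z. z \<in> set B \<Longrightarrow> \<not> (y < z \<and> z < x)"
    using cons by (auto simp: consecutive_def)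
  define i where "i = K x"
  show ?thesis
  proof (cases "x = p i \<and> x - 1 \<in> set B")
    case True
    then have yx: "y = x - 1" using between[of "x - 1"] xy by linarith
    have Ky: "K y = i" using True yx p_less[of _ i] by (intro K_eqI) force+
    have x0: "2 * i + 2 \<le> x" using True p_ge[of i] by simp
    have lo: "lo x = y - i" using True yx by (simp add: lo_def i_def)
    have rho: "\<rho> x = p i" "\<rho> y = p i" using True yx xy(1) Ky by (auto simp: \<rho>_def i_def)
    have big: "\<tau> z d = 2 * p i" if "i \<le> d" "\<rho> z = p i" for z d
      using p_less[of i "d + 1"] that by (simp add: \<tau>_def)
    have small: "\<tau> z d \<le> 2 * p i - 1" if "d < i" for z d
      using p_mono[of "d + 1" i] that by (auto simp: \<tau>_def min_def)
    have eq: "\<tau> x (min b (x - 2 - b)) = \<tau> y (min b (y - 2 - b))" if "b < y - i - 1" for b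
    proof (cases "b \<le> y - 2 - b")
      case True
      then have "min b (x - 2 - b) = min b (y - 2 - b)" using yx by auto
      then show ?thesis using rho by (simp add: \<tau>_def)
    next
      case False
      then show ?thesis using that yx rho by (simp add: big min_def)
    qed
    have neq: "\<tau> x (min b (x - 2 - b)) \<noteq> \<tau> y (min b (y - 2 - b))" if "b = y - i - 1" "0 < i" for b
    proof -
      have "min b (x - 2 - b) = i" "min b (y - 2 - b) < i" using that yx x0 by auto
      then have "\<tau> x (min b (x - 2 - b)) = 2 * p i" "\<tau> y (min b (y - 2 - b)) \<le> 2 * p i - 1"
        using big[of i x] small[of _ y] rho by simp_all
      then show ?thesis using p_ge[of i] by linarith
    qed
    show ?thesis unfolding H_eq_iff[OF xy(1)] lo
    proof
      assume "\<forall>b<a. \<tau> x (min b (x - 2 - b)) = \<tau> y (min b (y - 2 - b))"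
      then have "i = 0 \<or> \<not> y - i - 1 < a" using neq[of "y - i - 1"] by blast
      then show "a < y - i" using \<open>a < y\<close> x0 yx by auto
    next
      assume "a < y - i"
      then show "\<forall>b<a. \<tau> x (min b (x - 2 - b)) = \<tau> y (min b (y - 2 - b))" using eq by auto
    qed
  next
    case False
    have lo: "lo x = i" using False by (auto simp: lo_def i_def)
    have "i \<noteq> 0"
    proof
      assume "i = 0"
      then have "x \<le> p 0" using K_le[of x] by (simp add: i_def)
      then have "x = p 0" "y = x - 1" using xy by (auto simp: p_def)
      then show False using False \<open>i = 0\<close> xy by simp
    qed
    then have pi: "p (i - 1) < x" "p (i - 1) \<le> y + 1"
      using less_K_iff[of "i - 1" x] consecutive_ge[OF cons, of "i - 1"] by (auto simp: i_def)
    have y_ge: "2 * i \<le> y + 1" using p_ge[of "i - 1"] pi(2) \<open>i \<noteq> 0\<close> by simp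
    have x_ge: "2 * i < x" using K_less[of x] \<open>i \<noteq> 0\<close> by (simp add: i_def)
    have rho_x: "x \<le> \<rho> x" by (simp add: \<rho>_def)
    have rho_y: "p (i - 1) \<le> \<rho> y"
    proof (cases "y + 1 = p (i - 1)")
      case True
      then have "K y = i - 1" using p_less[of _ "i - 1"] by (intro K_eqI) force+
      then show ?thesis using True by (simp add: \<rho>_def)
    qed (use pi in \<open>auto simp: \<rho>_def\<close>)
    have rho_y': "\<rho> y < x"
    proof (cases "y + 1 = p (K y)")
      case True
      have "x \<noteq> y + 1"
      proof
        assume "x = y + 1"
        then have "x = p i" using True K_p by (simp add: i_def)
        moreover have "x - 1 \<in> set B" using \<open>x = y + 1\<close> xy(3) by simp
        ultimately show False using False by blast
      qed
      then show ?thesis using xy by (simp add: \<rho>_def)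
    qed (use xy in \<open>simp add: \<rho>_def\<close>)
    have eq: "\<tau> x (min b (x - 2 - b)) = \<tau> y (min b (y - 2 - b))" if "b + 1 < i" for b
    proof -
      have "min b (x - 2 - b) = b" "min b (y - 2 - b) = b" using that x_ge y_ge by auto
      moreover have "p (b + 1) \<le> p (i - 1)" using that by (intro p_mono) simp
      ultimately show ?thesis using pi rho_x rho_y by (simp add: \<tau>_def)
    qed
    have neq: "\<tau> x (min b (x - 2 - b)) \<noteq> \<tau> y (min b (y - 2 - b))" if "b + 1 = i" for b
    proof -
      have "min b (x - 2 - b) = b" using that x_ge by auto
      moreover have "x \<le> p i" unfolding i_def by (rule K_le)
      ultimately have "2 * \<rho> y < \<tau> x (min b (x - 2 - b))" using rho_y' rho_x that by (simp add: \<tau>_def)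
      moreover have "\<tau> y (min b (y - 2 - b)) \<le> 2 * \<rho> y" by (simp add: \<tau>_def)
      ultimately show ?thesis by linarith
    qed
    show ?thesis unfolding H_eq_iff[OF xy(1)] lo
    proof
      assume "\<forall>b<a. \<tau> x (min b (x - 2 - b)) = \<tau> y (min b (y - 2 - b))"
      moreover have "i - 1 + 1 = i" using \<open>i \<noteq> 0\<close> by simp
      ultimately have "\<not> i - 1 < a" using neq[of "i - 1"] by blast
      then show "a < i" using \<open>i \<noteq> 0\<close> by linarith
    next
      assume "a < i"
      then show "\<forall>b<a. \<tau> x (min b (x - 2 - b)) = \<tau> y (min b (y - 2 - b))" using eq by auto
    qed
  qed
qed

text \<open>The two ends of a block do not overlap. The last claim, applied to the largest order,
  bounds the number of path ends by \<open>k\<close>.\<close>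

lemma lo_hi:
  assumes "x \<in> set B"
  shows "lo x + hi x \<le> x" and "\<not> loop x \<Longrightarrow> lo x = hi x \<or> lo x + hi x = x"
    and "loop x \<Longrightarrow> hi x = lo x + 1" and "\<not> (x + 1 = p (K x) \<and> x + 1 \<in> set B) \<Longrightarrow> hi x \<le> k"
proof -
  define i where "i = K x"
  have i: "2 * i < x \<or> i = 0" "2 * i + 2 \<le> p i" "i \<le> k"
    using K_less[of x] p_ge[of i] K_le_k[OF assms] by (simp_all add: i_def)
  have ik: "i < k" if "p i = x \<or> p i = x + 1"
    using K_less_k[OF assms] that by (auto simp only: i_def[symmetric] eq_commute[of _ "p i"])
  note defs = lo_def hi_def loop_def i_def[symmetric] eq_commute[of _ "p i"]
  consider (a) "p i = x" | (b) "p i = x + 1" "p i \<noteq> x" | (c) "p i \<noteq> x" "p i \<noteq> x + 1" by linarith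
  then have "lo x + hi x \<le> x \<and> (\<not> loop x \<longrightarrow> lo x = hi x \<or> lo x + hi x = x) \<and> (loop x \<longrightarrow> hi x = lo x + 1)
    \<and> (\<not> (x + 1 = p (K x) \<and> x + 1 \<in> set B) \<longrightarrow> hi x \<le> k)"
  proof cases
    case a
    then show ?thesis using i ik unfolding defs by simp
  next
    case b
    then show ?thesis using i ik unfolding defs by simp
  next
    case c
    then show ?thesis using i unfolding defs by (simp only: if_False simp_thms) arith
  qed
  then show "lo x + hi x \<le> x" "\<not> loop x \<Longrightarrow> lo x = hi x \<or> lo x + hi x = x"
    "loop x \<Longrightarrow> hi x = lo x + 1" "\<not> (x + 1 = p (K x) \<and> x + 1 \<in> set B) \<Longrightarrow> hi x \<le> k" by blast+
qed

lemma loop_exponent: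
  assumes "loop x" "a + 1 < x"
  shows "\<tau> x (min a (x - 2 - a)) \<le> 2 * \<rho> x"
    and "\<tau> x (min a (x - 2 - a)) = 2 * \<rho> x \<longleftrightarrow> lo x \<le> a \<and> hi x \<le> x - 1 - a"
proof -
  define i where "i = K x"
  have "\<rho> x = p i \<and> lo x = i \<and> hi x = i + 1"
  proof (cases "p i = x")
    case True
    then have "x - 1 \<notin> set B" using assms(1) unfolding loop_def i_def[symmetric] by simp
    then show ?thesis using True unfolding \<rho>_def lo_def hi_def i_def[symmetric] by simp
  next
    case False
    then have "p i = x + 1" "x + 1 \<notin> set B" using assms(1) unfolding loop_def i_def[symmetric] by metis+
    then show ?thesis unfolding \<rho>_def lo_def hi_def i_def[symmetric] by simp
  qed
  then have rho: "\<rho> x = p i" and lh: "lo x = i" "hi x = i + 1" by blast+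
  show "\<tau> x (min a (x - 2 - a)) \<le> 2 * \<rho> x" by (simp add: \<tau>_def)
  have "\<tau> x d = 2 * p i \<longleftrightarrow> i \<le> d" for d
  proof
    assume "\<tau> x d = 2 * p i"
    then have "2 * p i \<le> 2 * p (d + 1) - 1" by (simp add: \<tau>_def rho)
    then have "p i < p (d + 1)" using p_ge[of i] by linarith
    then show "i \<le> d" using p_mono[of "d + 1" i] by linarith
  next
    assume "i \<le> d"
    then show "\<tau> x d = 2 * p i" using p_less[of i "d + 1"] by (simp add: \<tau>_def rho)
  qed
  moreover have "i \<le> min a (x - 2 - a) \<longleftrightarrow> i \<le> a \<and> i + 1 \<le> x - 1 - a" using assms(2) by auto
  ultimately show "\<tau> x (min a (x - 2 - a)) = 2 * \<rho> x \<longleftrightarrow> lo x \<le> a \<and> hi x \<le> x - 1 - a"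
    unfolding rho lh by (rule trans)
qed

text \<open>Each of the \<open>K x\<close> pairs below \<open>x\<close> contributes the two ends of
  the block; if \<open>x\<close> itself belongs to the pair at \<open>K x\<close>, the rest of the
  block is covered too.\<close>

lemma card_on_path:
  assumes "x \<in> set B"
  shows "card {a. a < x \<and> on_path x a} = level_weight (map s [0..<k]) x"
proof -
  define i where "i = K x"
  have sorted: "sorted (map s [0..<k])" using mono_s by (auto simp: sorted_iff_nth_mono mono_def)
  have "level_weight (map s [0..<k]) x = (\<Sum>j<k. level_term x j (s j))"
    unfolding level_weight_sum[OF sorted] by simp
  also have "\<dots> = (\<Sum>j<k. (if j < i then 2 else 0) + (if j = i then (if x = p i \<or> x + 1 = p i then x - 2 * i else 0) else 0))"
  proof (rule sum.cong[OF refl])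
    fix j
    consider "j < i" | "j = i" | "i < j" by linarith
    then show "level_term x j (s j) = (if j < i then 2 else 0) + (if j = i then (if x = p i \<or> x + 1 = p i then x - 2 * i else 0) else 0)"
    proof cases
      case 1
      then have "p j < x" using less_K_iff[of j x] by (simp add: i_def)
      then show ?thesis using 1 by (auto simp: level_term_def p_def)
    next
      case 2
      then show ?thesis using K_le[of x] by (auto simp: level_term_def p_def i_def)
    next
      case 3
      then have "x + 2 \<le> p j" using K_le[of x] p_less[of i j] by (simp add: i_def)
      then show ?thesis using 3 by (auto simp: level_term_def p_def)
    qed
  qed
  also have "\<dots> = 2 * i + (if x = p i \<or> x + 1 = p i then x - 2 * i else 0)"
  proof -
    have "(\<Sum>j<k. if j < i then 2 else 0) = 2 * card ({..<k} \<inter> {j. j < i})" by (simp add: sum.If_cases)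
    also have "{..<k} \<inter> {j. j < i} = {..<i}" using K_le_k[OF assms] by (auto simp: i_def)
    finally show ?thesis using K_less_k[OF assms] by (auto simp: sum.distrib i_def)
  qed
  also have "\<dots> = (if x = p i \<or> x + 1 = p i then x else 2 * i)"
    using p_ge[of i] by auto
  also have "\<dots> = card {a. a < x \<and> on_path x a}"
  proof (cases "x = p i \<or> x + 1 = p i")
    case True
    have "lo x + hi x = x \<or> loop x"
      using True p_ge[of i] by (auto simp: lo_def hi_def loop_def i_def)
    then have "{a. a < x \<and> on_path x a} = {..<x}" by (auto simp: on_path_def)
    then show ?thesis using True by simp
  next
    case False
    have lh: "lo x = i" "hi x = i" "\<not> loop x" using False by (auto simp: lo_def hi_def loop_def i_def)
    have "2 * i < x \<or> i = 0" using K_less[of x] by (simp add: i_def)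
    then have "{a. a < x \<and> on_path x a} = {..<i} \<union> {x - i..<x}" "{..<i} \<inter> {x - i..<x} = {}" "i \<le> x"
      by (auto simp: on_path_def lh)
    then show ?thesis using False by (simp add: card_Un_disjoint)
  qed
  finally show ?thesis ..
qed

end

text \<open>Blocks of equal order are traversed by increasing index: paths enter at the first and
  leave from the last.\<close>

definition first_index :: "nat list \<Rightarrow> nat \<Rightarrow> bool" where
  "first_index B j \<longleftrightarrow> j < length B \<and> (\<forall>i<j. B ! i \<noteq> B ! j)"

definition last_index :: "nat list \<Rightarrow> nat \<Rightarrow> bool" where
  "last_index B l \<longleftrightarrow> l < length B \<and> (\<forall>i<length B. l < i \<longrightarrow> B ! i \<noteq> B ! l)"

lemma first_index_unique: "\<lbrakk>first_index B j; first_index B j'; B ! j = B ! j'\<rbrakk> \<Longrightarrow> j = j'"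
  unfolding first_index_def by (metis linorder_neqE_nat)

lemma last_index_unique: "\<lbrakk>last_index B j; last_index B j'; B ! j = B ! j'\<rbrakk> \<Longrightarrow> j = j'"
  unfolding last_index_def by (metis linorder_neqE_nat)

lemma ex_first_index: "x \<in> set B \<Longrightarrow> \<exists>j. first_index B j \<and> B ! j = x"
proof -
  assume "x \<in> set B"
  then have ex: "\<exists>j. j < length B \<and> B ! j = x" by (auto simp: in_set_conv_nth)
  then obtain j where "j < length B \<and> B ! j = x" "\<And>i. i < j \<Longrightarrow> \<not> (i < length B \<and> B ! i = x)"
    using exists_least_iff[of "\<lambda>j. j < length B \<and> B ! j = x"] by blast
  then show ?thesis unfolding first_index_def by (intro exI[of _ j]) auto
qed

lemma last_index_or_Suc:
  assumes "sorted_wrt (\<ge>) B" "l < length B" "\<not> last_index B l"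
  shows "Suc l < length B" "B ! Suc l = B ! l"
proof -
  obtain i where i: "i < length B" "l < i" "B ! i = B ! l" using assms by (auto simp: last_index_def)
  then show "Suc l < length B" by simp
  have "B ! i \<le> B ! Suc l" using sorted_wrt_nth_less[OF assms(1), of "Suc l" i] i by (cases "Suc l = i") auto
  moreover have "B ! Suc l \<le> B ! l" using sorted_wrt_nth_less[OF assms(1), of l "Suc l"] i by simp
  ultimately show "B ! Suc l = B ! l" using i by simp
qed

section \<open>The steps of exponent zero\<close>

context level_paths
begin

definition arrow :: "nat \<Rightarrow> nat \<Rightarrow> bool" where
  "arrow l j \<longleftrightarrow> j = Suc l \<and> B ! j = B ! l \<or>
     last_index B l \<and> first_index B j \<and>
       (consecutive (B ! l) (B ! j) \<or> consecutive (B ! j) (B ! l) \<or> B ! j = B ! l \<and> loop (B ! l))"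

definition shift :: "nat \<Rightarrow> nat \<Rightarrow> nat" where
  "shift l j = (if B ! j = B ! l then if j = Suc l then 0 else 1 else B ! j - B ! l)"

text \<open>The exponent of the parameter before conjugation. It depends on the two blocks only, as
  commutation with the Jordan matrix requires. The subtraction truncates to 0 for steps to smaller
  orders.\<close>

definition degree :: "nat \<Rightarrow> nat \<Rightarrow> nat" where
  "degree l j = (if B ! j = B ! l then if j = Suc l then 0 else 2 * \<rho> (B ! l)
     else H (B ! j) (B ! j - 1) - H (B ! l) (B ! l - 1))"

definition step :: "nat \<times> nat \<Rightarrow> nat \<times> nat \<Rightarrow> bool" where
  "step = (\<lambda>(l, t) (j, i). arrow l j \<and> t + B ! j = i + B ! l + shift l j)"

definition pot :: "nat \<times> nat \<Rightarrow> nat" where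
  "pot = (\<lambda>(l, t). H (B ! l) (B ! l - 1 - t))"

definition zero_step :: "nat \<times> nat \<Rightarrow> nat \<times> nat \<Rightarrow> bool" where
  "zero_step z w \<longleftrightarrow> step z w \<and> degree (fst z) (fst w) + pot z = pot w"

lemma step_cases:
  assumes "(l, t) \<in> block_positions B" "(j, i) \<in> block_positions B" "step (l, t) (j, i)"
  obtains (along) "j = Suc l" "B ! j = B ! l" "i = t" "degree l j = 0"
  | (down) "last_index B l" "first_index B j" "consecutive (B ! l) (B ! j)"
      "B ! j - 1 - i = B ! l - 1 - t" "degree l j = 0"
  | (up) "last_index B l" "first_index B j" "consecutive (B ! j) (B ! l)" "i = t"
      "degree l j = H (B ! j) (B ! j - 1) - H (B ! l) (B ! l - 1)"
  | (loop) "last_index B l" "first_index B j" "B ! j = B ! l" "loop (B ! l)" "t = Suc i"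
      "degree l j = 2 * \<rho> (B ! l)"
proof -
  have t: "t < B ! l" "i < B ! j" "l < length B" "j < length B" using assms by (auto simp: block_positions_def)
  have ar: "arrow l j" and eq: "t + B ! j = i + B ! l + shift l j" using assms(3) by (auto simp: step_def)
  from ar consider "j = Suc l \<and> B ! j = B ! l"
    | "last_index B l" "first_index B j" "consecutive (B ! l) (B ! j)"
    | "last_index B l" "first_index B j" "consecutive (B ! j) (B ! l)"
    | "last_index B l" "first_index B j" "B ! j = B ! l" "loop (B ! l)"
    unfolding arrow_def by blast
  then show thesis
  proof cases
    case 1
    then show thesis using eq by (intro along) (auto simp: shift_def degree_def)
  next
    case 2
    then have "B ! j < B ! l" by (simp add: consecutive_def)
    moreover have "H (B ! j) (B ! j - 1) \<le> H (B ! l) (B ! l - 1)"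
      using H_mono[OF \<open>B ! j < B ! l\<close>, of "B ! j - 1"] H_mono2[of "B ! j - 1" "B ! l - 1" "B ! l"] \<open>B ! j < B ! l\<close>
      by linarith
    ultimately show thesis using eq 2 t by (intro down) (auto simp: shift_def degree_def)
  next
    case 3
    then have "B ! l < B ! j" by (simp add: consecutive_def)
    then show thesis using eq 3 t by (intro up) (auto simp: shift_def degree_def)
  next
    case 4
    then have "j \<noteq> Suc l" using t by (auto simp: last_index_def)
    then show thesis using eq 4 t by (intro loop) (auto simp: shift_def degree_def)
  qed
qed

text \<open>A downward step compares \<open>H\<close> for two neighbouring orders at the same
  distance from the end; by \<open>H_symmetric\<close> an upward step becomes the same comparison at
  the same distance from the beginning. A loop compares a single slope with
  \<open>2 * \<rho>\<close>.\<close>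

lemma pot_diff:
  assumes "(l, t) \<in> block_positions B" "(j, i) \<in> block_positions B" "step (l, t) (j, i)"
  shows "pot (j, i) \<le> degree l j + pot (l, t)"
    and "degree l j + pot (l, t) = pot (j, i) \<longleftrightarrow>
      B ! j = B ! l \<and> j = Suc l \<or> B ! j < B ! l \<and> B ! l - 1 - t < lo (B ! l) \<or> B ! l < B ! j \<and> t < hi (B ! l) \<or>
      last_index B l \<and> B ! j = B ! l \<and> lo (B ! l) \<le> B ! l - 1 - t \<and> hi (B ! l) \<le> t"
proof -
  have t: "t < B ! l" "i < B ! j" "l < length B" "j < length B" using assms by (auto simp: block_positions_def)
  have "pot (j, i) \<le> degree l j + pot (l, t) \<and> (degree l j + pot (l, t) = pot (j, i) \<longleftrightarrow>
      B ! j = B ! l \<and> j = Suc l \<or> B ! j < B ! l \<and> B ! l - 1 - t < lo (B ! l) \<or> B ! l < B ! j \<and> t < hi (B ! l) \<or>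
      last_index B l \<and> B ! j = B ! l \<and> lo (B ! l) \<le> B ! l - 1 - t \<and> hi (B ! l) \<le> t)"
    using assms
  proof (cases rule: step_cases)
    case along
    then show ?thesis by (simp add: pot_def)
  next
    case down
    then have lt: "B ! j < B ! l" by (simp add: consecutive_def)
    have a: "B ! l - 1 - t < B ! j" using down(4) t by linarith
    have "pot (j, i) = H (B ! j) (B ! l - 1 - t)" "pot (l, t) = H (B ! l) (B ! l - 1 - t)"
      using down(4) by (simp_all add: pot_def)
    then show ?thesis
      using H_consecutive[OF down(3) a] H_mono[OF lt, of "B ! l - 1 - t"] down(5) lt by simp
  next
    case up
    then have lt: "B ! l < B ! j" by (simp add: consecutive_def)
    have "H (B ! j) t + H (B ! j) (B ! j - 1 - t) = H (B ! j) (B ! j - 1)"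
      "H (B ! l) t + H (B ! l) (B ! l - 1 - t) = H (B ! l) (B ! l - 1)"
      using H_symmetric[of t "B ! j"] H_symmetric[of t "B ! l"] t lt by simp_all
    moreover have "H (B ! l) (B ! l - 1) \<le> H (B ! j) (B ! j - 1)"
      using H_mono[OF lt, of "B ! l - 1"] H_mono2[of "B ! l - 1" "B ! j - 1" "B ! j"] lt by linarith
    moreover have "H (B ! l) t \<le> H (B ! j) t" using H_mono[OF lt] .
    moreover have "H (B ! j) t = H (B ! l) t \<longleftrightarrow> t < hi (B ! l)"
      using H_consecutive[OF up(3) t(1)] consecutive_lo_hi[OF up(3)] by simp
    moreover have "pot (j, i) = H (B ! j) (B ! j - 1 - t)" "pot (l, t) = H (B ! l) (B ! l - 1 - t)"
      using up(4) by (simp_all add: pot_def)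
    moreover note up(5)
    ultimately have "pot (j, i) \<le> degree l j + pot (l, t)"
      "degree l j + pot (l, t) = pot (j, i) \<longleftrightarrow> t < hi (B ! l)" by linarith+
    then show ?thesis using lt by simp
  next
    case loop
    define a where "a = B ! l - 1 - t"
    have a: "a + 1 < B ! l" "B ! j - 1 - i = Suc a" "B ! l - 1 - a = t" using loop t by (auto simp: a_def)
    have "j \<noteq> Suc l" using loop t by (auto simp: last_index_def)
    have "pot (l, t) = H (B ! l) a" "pot (j, i) = H (B ! l) a + \<tau> (B ! l) (min a (B ! l - 2 - a))"
      using a(2) loop(3) by (simp_all add: pot_def a_def H_def)
    then have "pot (j, i) \<le> degree l j + pot (l, t)"
      "degree l j + pot (l, t) = pot (j, i) \<longleftrightarrow> lo (B ! l) \<le> a \<and> hi (B ! l) \<le> t"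
      using loop_exponent[OF loop(4) a(1)] loop(6) a(3) by auto
    then show ?thesis using \<open>j \<noteq> Suc l\<close> loop by (simp add: a_def)
  qed
  then show "pot (j, i) \<le> degree l j + pot (l, t)"
    "degree l j + pot (l, t) = pot (j, i) \<longleftrightarrow>
      B ! j = B ! l \<and> j = Suc l \<or> B ! j < B ! l \<and> B ! l - 1 - t < lo (B ! l) \<or> B ! l < B ! j \<and> t < hi (B ! l) \<or>
      last_index B l \<and> B ! j = B ! l \<and> lo (B ! l) \<le> B ! l - 1 - t \<and> hi (B ! l) \<le> t"
    by blast+
qed

lemma zero_step_cases:
  assumes "(l, t) \<in> block_positions B" "(j, i) \<in> block_positions B" "zero_step (l, t) (j, i)"
  obtains (along) "\<not> last_index B l" "\<not> first_index B j" "j = Suc l" "B ! j = B ! l" "i = t"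
  | (down) "last_index B l" "first_index B j" "consecutive (B ! l) (B ! j)"
      "B ! j - 1 - i = B ! l - 1 - t" "B ! l - 1 - t < lo (B ! l)"
  | (up) "last_index B l" "first_index B j" "consecutive (B ! j) (B ! l)" "i = t" "t < hi (B ! l)"
  | (loop) "last_index B l" "first_index B j" "B ! j = B ! l" "loop (B ! l)" "t = Suc i"
      "lo (B ! l) \<le> B ! l - 1 - t" "hi (B ! l) \<le> t"
proof -
  note a1 = along and a2 = down and a3 = up and a4 = loop
  have t: "l < length B" "j < length B" using assms by (auto simp: block_positions_def)
  have st: "step (l, t) (j, i)" using assms(3) by (simp add: zero_step_def)
  have z: "B ! j = B ! l \<and> j = Suc l \<or> B ! j < B ! l \<and> B ! l - 1 - t < lo (B ! l) \<or> B ! l < B ! j \<and> t < hi (B ! l) \<or>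
      last_index B l \<and> B ! j = B ! l \<and> lo (B ! l) \<le> B ! l - 1 - t \<and> hi (B ! l) \<le> t"
    using assms(3) pot_diff(2)[OF assms(1,2) st] by (simp add: zero_step_def)
  show thesis using assms(1,2) st
  proof (cases rule: step_cases)
    case along
    note 1 = this
    then show thesis using t by (intro a1) (auto simp: last_index_def first_index_def)
  next
    case down
    note 2 = this
    moreover have "B ! j < B ! l" using 2 by (simp add: consecutive_def)
    ultimately show thesis using z by (intro a2) auto
  next
    case up
    note 3 = this
    moreover have "B ! l < B ! j" using 3 by (simp add: consecutive_def)
    ultimately show thesis using z by (intro a3) auto
  next
    case loop
    note 4 = this
    moreover have "j \<noteq> Suc l" using 4 t by (auto simp: last_index_def)
    ultimately show thesis using z by (intro a4) auto
  qed
qed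

lemma consecutive_unique:
  "\<lbrakk>consecutive x y; consecutive x y'\<rbrakk> \<Longrightarrow> y = y'"
  "\<lbrakk>consecutive y x; consecutive y' x\<rbrakk> \<Longrightarrow> y = y'"
  unfolding consecutive_def by (metis linorder_neqE_nat)+

lemma lo_hi_exclusive:
  assumes "x \<in> set B" "t < x"
  shows "\<not> (x - 1 - t < lo x \<and> t < hi x)" "\<not> (x - 1 - t < hi x \<and> t < lo x)"
  using lo_hi(1)[OF assms(1)] assms(2) by auto

text \<open>From the last block of an order the ways out start at disjoint sets of positions:
  downwards from the last \<open>lo\<close>, upwards from the first \<open>hi\<close>, and the loop
  in between.\<close>

lemma zero_step_unique:
  assumes z: "z \<in> block_positions B" and w: "w \<in> block_positions B" "w' \<in> block_positions B"
    and st: "zero_step z w" "zero_step z w'"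
  shows "w = w'"
proof -
  obtain l t j i j' i' where eq: "z = (l, t)" "w = (j, i)" "w' = (j', i')" by (metis surj_pair)
  have zp: "(l, t) \<in> block_positions B" and wp: "(j, i) \<in> block_positions B" and wp': "(j', i') \<in> block_positions B"
    using z w eq by auto
  have st1: "zero_step (l, t) (j, i)" and st2: "zero_step (l, t) (j', i')" using st eq by auto
  have lt: "B ! l \<in> set B" "t < B ! l" and i: "i < B ! j" "i' < B ! j'" using zp wp wp' by (auto simp: block_positions_def)
  note ex = lo_hi_exclusive[OF lt]
  have uniq: "w = w'" if "first_index B j" "first_index B j'" "B ! j = B ! j'" "B ! j - 1 - i = B ! j' - 1 - i' \<or> i = i'"
    using first_index_unique[OF that(1,2,3)] that(4) i by (auto simp: eq)
  note cu = consecutive_unique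
  from zp wp st1 show ?thesis
  proof (cases rule: zero_step_cases)
    case along
    note 11 = this
    from zp wp' st2 show ?thesis by (cases rule: zero_step_cases) (use 11 in \<open>auto simp: eq\<close>)
  next
    case down
    note 11 = this
    from zp wp' st2 show ?thesis
    proof (cases rule: zero_step_cases)
      case down
      note 2 = this
      show ?thesis by (rule uniq) (use 11 2 cu(1)[OF 11(3) 2(3)] in auto)
    qed (use 11 ex in auto)
  next
    case up
    note 11 = this
    from zp wp' st2 show ?thesis
    proof (cases rule: zero_step_cases)
      case up
      note 3 = this
      show ?thesis by (rule uniq) (use 11 3 cu(2)[OF 11(3) 3(3)] in auto)
    qed (use 11 ex in auto)
  next
    case loop
    note 11 = this
    from zp wp' st2 show ?thesis
    proof (cases rule: zero_step_cases)
      case loop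
      note 4 = this
      show ?thesis by (rule uniq) (use 11 4 in auto)
    qed (use 11 ex in auto)
  qed
qed

text \<open>The previous case distinction seen from the target, with the bounds translated by
  \<open>consecutive_lo_hi\<close>; it serves for injectivity.\<close>

lemma zero_step_target:
  assumes "(l, t) \<in> block_positions B" "(j, i) \<in> block_positions B" "zero_step (l, t) (j, i)"
  obtains (along) "\<not> first_index B j" "l = j - 1" "t = i"
  | (down) "first_index B j" "last_index B l" "consecutive (B ! l) (B ! j)" "B ! l - 1 - t = B ! j - 1 - i"
     "B ! j - 1 - i < hi (B ! j)"
  | (up) "first_index B j" "last_index B l" "consecutive (B ! j) (B ! l)" "t = i" "i < lo (B ! j)"
  | (loop) "first_index B j" "last_index B l" "B ! l = B ! j" "loop (B ! j)" "t = Suc i"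
     "hi (B ! j) \<le> B ! j - 1 - i" "lo (B ! j) \<le> i"
proof -
  note a1 = along and a2 = down and a3 = up and a4 = loop
  from assms show thesis
  proof (cases rule: zero_step_cases)
  case along
  note 1 = this
  then show thesis by (intro a1) auto
next
  case down
  note 2 = this
  then show thesis using consecutive_lo_hi[OF 2(3)] by (intro a2) auto
next
  case up
  note 3 = this
  then show thesis using consecutive_lo_hi[OF 3(3)] by (intro a3) auto
next
  case loop
  note 4 = this
  have "B ! l \<in> set B" "t < B ! l" using assms(1) by (auto simp: block_positions_def)
  then show thesis using 4 lo_hi(3)[of "B ! l"] by (intro a4) auto
qed
qed

lemma zero_step_inj:
  assumes z: "z \<in> block_positions B" "z' \<in> block_positions B" and w: "w \<in> block_positions B"
    and st: "zero_step z w" "zero_step z' w"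
  shows "z = z'"
proof -
  obtain j i l t l' t' where eq: "w = (j, i)" "z = (l, t)" "z' = (l', t')" by (metis surj_pair)
  have wp: "(j, i) \<in> block_positions B" and zp: "(l, t) \<in> block_positions B" and zp': "(l', t') \<in> block_positions B"
    using z w eq by auto
  have st1: "zero_step (l, t) (j, i)" and st2: "zero_step (l', t') (j, i)" using st eq by auto
  have lt: "B ! j \<in> set B" "i < B ! j" and i: "t < B ! l" "t' < B ! l'" using zp wp zp' by (auto simp: block_positions_def)
  note ex = lo_hi_exclusive[OF lt]
  have uniq: "z = z'" if "last_index B l" "last_index B l'" "B ! l = B ! l'" "B ! l - 1 - t = B ! l' - 1 - t' \<or> t = t'"
    using last_index_unique[OF that(1,2,3)] that(4) i by (auto simp: eq)
  note cu = consecutive_unique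
  from zp wp st1 show ?thesis
  proof (cases rule: zero_step_target)
    case along
    note 11 = this
    from zp' wp st2 show ?thesis by (cases rule: zero_step_target) (use 11 in \<open>auto simp: eq\<close>)
  next
    case down
    note 11 = this
    from zp' wp st2 show ?thesis
    proof (cases rule: zero_step_target)
      case down
      note 2 = this
      show ?thesis by (rule uniq) (use 11 2 cu(2)[OF 11(3) 2(3)] in auto)
    qed (use 11 ex in auto)
  next
    case up
    note 11 = this
    from zp' wp st2 show ?thesis
    proof (cases rule: zero_step_target)
      case up
      note 3 = this
      show ?thesis by (rule uniq) (use 11 3 cu(1)[OF 11(3) 3(3)] in auto)
    qed (use 11 ex in auto)
  next
    case loop
    note 11 = this
    from zp' wp st2 show ?thesis
    proof (cases rule: zero_step_target)
      case loop
      note 4 = this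
      show ?thesis by (rule uniq) (use 11 4 in auto)
    qed (use 11 ex in auto)
  qed
qed

lemma on_path_cases:
  assumes "y \<in> set B" "i < y"
  shows "y - 1 - i < hi y \<Longrightarrow> on_path y (y - 1 - i)" "i < lo y \<Longrightarrow> on_path y (y - 1 - i)"
  using lo_hi(1)[OF assms(1)] lo_hi(2)[OF assms(1)] assms(2) by (auto simp: on_path_def)

lemma zero_step_on_path:
  assumes "(l, t) \<in> block_positions B" "(j, i) \<in> block_positions B" "zero_step (l, t) (j, i)"
    and "on_path (B ! l) (B ! l - 1 - t)"
  shows "on_path (B ! j) (B ! j - 1 - i)"
proof -
  have j: "B ! j \<in> set B" "i < B ! j" using assms by (auto simp: block_positions_def)
  from assms(1-3) show ?thesis
  proof (cases rule: zero_step_target)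
    case along
    note 1 = this
    from assms(1-3) have "B ! l = B ! j" by (cases rule: zero_step_cases) (use 1(1) in auto)
    then show ?thesis using 1(3) assms(4) by simp
  next
    case down
    show ?thesis by (rule on_path_cases(1)[OF j down(5)])
  next
    case up
    show ?thesis by (rule on_path_cases(2)[OF j up(5)])
  next
    case loop
    then show ?thesis by (simp add: on_path_def)
  qed
qed

lemma ex_consecutive:
  assumes "x \<in> set B" "0 < lo x"
  shows "\<exists>y. consecutive x y"
proof -
  let ?L = "{y \<in> set B. y < x \<and> s 0 \<le> y}"
  have "?L \<noteq> {}"
  proof (cases "K x")
    case 0
    have "x = p 0 \<and> x - 1 \<in> set B" using assms(2) unfolding lo_def 0 by (metis less_irrefl)
    then show ?thesis by (auto simp: p_def)
  next
    case (Suc i)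
    then have "p 0 < x" using less_K_iff[of 0 x] by simp
    moreover have "0 < k" using K_le_k[OF assms(1)] Suc by simp
    ultimately have "s 0 \<in> ?L \<or> Suc (s 0) \<in> ?L" using present[of 0] by (auto simp: p_def)
    then show ?thesis by blast
  qed
  moreover define m where "m = Max ?L"
  ultimately have "m \<in> ?L" using Max_in[of ?L] by simp
  moreover have "y \<le> m" if "y \<in> ?L" for y unfolding m_def using that by (intro Max_ge) auto
  ultimately show ?thesis unfolding consecutive_def using assms(1) by (intro exI[of _ m]) force
qed

text \<open>The excluded positions are the ends of the paths: an upward step from the largest order
  has no target.\<close>

lemma ex_zero_step:
  assumes z: "(l, t) \<in> block_positions B" and path: "on_path (B ! l) (B ! l - 1 - t)"
    and no_end: "\<not> (last_index B l \<and> t < hi (B ! l) \<and> (\<forall>x\<in>set B. x \<le> B ! l))"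
  shows "\<exists>w\<in>block_positions B. zero_step (l, t) w"
proof -
  have lt: "B ! l \<in> set B" "t < B ! l" "l < length B" using z by (auto simp: block_positions_def)
  have zero: "\<exists>w\<in>block_positions B. zero_step (l, t) w"
    if "(j, i) \<in> block_positions B" "step (l, t) (j, i)"
      "B ! j = B ! l \<and> j = Suc l \<or> B ! j < B ! l \<and> B ! l - 1 - t < lo (B ! l) \<or> B ! l < B ! j \<and> t < hi (B ! l) \<or>
      last_index B l \<and> B ! j = B ! l \<and> lo (B ! l) \<le> B ! l - 1 - t \<and> hi (B ! l) \<le> t" for j i
    using that pot_diff(2)[OF z that(1,2)] unfolding zero_step_def by force
  consider (along) "\<not> last_index B l" | (down) "last_index B l" "B ! l - 1 - t < lo (B ! l)"
    | (up) "last_index B l" "t < hi (B ! l)"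
    | (loop) "last_index B l" "lo (B ! l) \<le> B ! l - 1 - t" "hi (B ! l) \<le> t" by linarith
  then show ?thesis
  proof cases
    case along
    have "Suc l < length B" "B ! Suc l = B ! l" using last_index_or_Suc[OF sorted_B lt(3) along] by auto
    then show ?thesis using lt by (intro zero[of "Suc l" t]) (auto simp: block_positions_def step_def arrow_def shift_def)
  next
    case down
    then obtain y where y: "consecutive (B ! l) y" using ex_consecutive[OF lt(1)] by auto
    then have yB: "y \<in> set B" "y < B ! l" by (auto simp: consecutive_def)
    obtain j where j: "first_index B j" "B ! j = y" using ex_first_index[OF yB(1)] by blast
    have "B ! l - 1 - t < y" using down(2) consecutive_lo_hi[OF y] lo_hi(1)[OF yB(1)] by simp
    moreover have "j < length B" using j by (simp add: first_index_def)
    ultimately show ?thesis using lt j y yB down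
      by (intro zero[of j "y - 1 - (B ! l - 1 - t)"]) (auto simp: block_positions_def step_def arrow_def shift_def)
  next
    case up
    let ?U = "{y \<in> set B. B ! l < y}"
    have "?U \<noteq> {}" using no_end up by (auto simp: not_le)
    then have "Min ?U \<in> ?U" by (intro Min_in) auto
    moreover have "Min ?U \<le> y" if "y \<in> ?U" for y using that by (intro Min_le) auto
    moreover have "s 0 \<le> B ! l"
    proof (rule ccontr)
      assume "\<not> ?thesis"
      then have "B ! l + 1 < p 0" "K (B ! l) = 0" by (auto simp: p_def intro!: K_eqI)
      then have "hi (B ! l) = 0" by (auto simp: hi_def)
      then show False using up by simp
    qed
    ultimately obtain y where y: "consecutive y (B ! l)" unfolding consecutive_def using lt(1)
      by (metis (mono_tags, lifting) leD mem_Collect_eq)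
    then have yB: "y \<in> set B" "B ! l < y" by (auto simp: consecutive_def)
    obtain j where j: "first_index B j" "B ! j = y" using ex_first_index[OF yB(1)] by blast
    moreover have "j < length B" using j by (simp add: first_index_def)
    ultimately show ?thesis using lt y yB up
      by (intro zero[of j t]) (auto simp: block_positions_def step_def arrow_def shift_def)
  next
    case loop
    have L: "level_paths.loop B s (B ! l)" using path loop lt lo_hi(2)[OF lt(1)] lo_hi(1)[OF lt(1)] by (auto simp: on_path_def)
    obtain j where j: "first_index B j" "B ! j = B ! l" using ex_first_index[OF lt(1)] by blast
    have jl: "j < length B" "j \<noteq> Suc l" using j loop(1) by (auto simp: first_index_def last_index_def)
    have "0 < t" using lo_hi(3)[OF lt(1) L] loop by simp
    then show ?thesis using lt j jl loop L
      by (intro zero[of j "t - 1"]) (auto simp: block_positions_def step_def arrow_def shift_def)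
  qed
qed

end

section \<open>The maximum partition\<close>

lemma nilpotent_of_increasing:
  fixes A :: "'a :: field mat"
  assumes A: "A \<in> carrier_mat n n"
    and inc: "\<And>i k. \<lbrakk>i < n; k < n; A $$ (i, k) \<noteq> 0\<rbrakk> \<Longrightarrow> \<phi> k < (\<phi> i :: nat)"
    and bound: "\<And>i. i < n \<Longrightarrow> \<phi> i < M"
  shows "A ^\<^sub>m M = 0\<^sub>m n n"
proof -
  have grow: "\<phi> k + m \<le> \<phi> i" if "i < n" "k < n" "(A ^\<^sub>m m) $$ (i, k) \<noteq> 0" for i k m
    using that
  proof (induction m arbitrary: k)
    case 0
    then show ?case using A by (auto split: if_splits)
  next
    case (Suc m)
    have Am: "A ^\<^sub>m m \<in> carrier_mat n n" using A by simp
    have "(A ^\<^sub>m Suc m) $$ (i, k) = (\<Sum>l<n. (A ^\<^sub>m m) $$ (i, l) * A $$ (l, k))"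
      using Suc.prems(1,2) A Am carrier_matD[OF Am] carrier_matD[OF A]
      by (simp add: scalar_prod_def atLeast0LessThan)
    then obtain l where "l < n" "(A ^\<^sub>m m) $$ (i, l) * A $$ (l, k) \<noteq> 0"
      using Suc.prems(3) by (metis (no_types, lifting) lessThan_iff sum.neutral)
    then show ?case using Suc.IH[of l] Suc.prems inc[of l k] by force
  qed
  show ?thesis
  proof (rule eq_matI)
    fix i k assume "i < dim_row (0\<^sub>m n n)" "k < dim_col (0\<^sub>m n n)"
    then have "i < n" "k < n" by auto
    then show "(A ^\<^sub>m M) $$ (i, k) = 0\<^sub>m n n $$ (i, k)"
      using grow[of i k M] bound[of i] by (cases "(A ^\<^sub>m M) $$ (i, k) = 0") auto
  qed (use A in auto)
qed

text \<open>Strict triangularity of the constant coefficients is a linear condition that forces nilpotency, so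
  generic elements can be found on lines.\<close>

definition triangular_commutator :: "nat list \<Rightarrow> 'a :: field mat set" where
  "triangular_commutator \<mu> = {A \<in> carrier_mat (sum_list \<mu>) (sum_list \<mu>).
     A * nilpotent_jordan \<mu> = nilpotent_jordan \<mu> * A \<and>
     (\<forall>j l s. (j, s) \<in> block_positions \<mu> \<longrightarrow> (l, s) \<in> block_positions \<mu> \<longrightarrow> \<mu> ! j = \<mu> ! l \<longrightarrow>
        j \<le> l \<longrightarrow> A $$ (block_index \<mu> (j, s), block_index \<mu> (l, s)) = 0)}"

lemma triangular_commutator_subset: "triangular_commutator \<mu> \<subseteq> nilpotent_commutator \<mu>"
proof
  fix A :: "'a mat" assume T: "A \<in> triangular_commutator \<mu>"
  then have A: "A \<in> carrier_mat (sum_list \<mu>) (sum_list \<mu>)" and comm: "A * nilpotent_jordan \<mu> = nilpotent_jordan \<mu> * A"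
    by (auto simp: triangular_commutator_def)
  define N where "N = sum_list \<mu>"
  \<comment> \<open>Up to a constant, \<open>\<mu> ! j - 2 * s\<close> is the distance to the end
    minus the position. A nonzero entry raises it, except between equal positions in blocks of equal
    order, where the block index decides. \<open>N\<close> keeps the value a natural number.\<close>
  define \<psi> where "\<psi> = (\<lambda>(j, s). (\<mu> ! j + 2 * (N - s)) * length \<mu> + j)"
  define \<phi> where "\<phi> = (\<lambda>i. \<psi> (inv_into (block_positions \<mu>) (block_index \<mu>) i))"
  have inc: "\<psi> (l, t) < \<psi> (j, s)" if z: "(j, s) \<in> block_positions \<mu>" and w: "(l, t) \<in> block_positions \<mu>"
    and nz: "A $$ (block_index \<mu> (j, s), block_index \<mu> (l, t)) \<noteq> 0" for j s l t
  proof -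
    have le: "s \<le> t" "\<mu> ! l + s \<le> \<mu> ! j + t" using commuting_entries_le[OF A comm z w nz] by auto
    have bd: "j < length \<mu>" "l < length \<mu>" "s < \<mu> ! j" "t < \<mu> ! l" using z w by (auto simp: block_positions_def)
    have "\<mu> ! j \<le> N" "\<mu> ! l \<le> N" unfolding N_def using bd by (auto intro: member_le_sum_list)
    then have sN: "s \<le> N" "t \<le> N" using bd by simp_all
    show ?thesis
    proof (cases "s = t \<and> \<mu> ! j = \<mu> ! l")
      case True
      then have "l < j" using T nz z w unfolding triangular_commutator_def by (auto simp: not_le[symmetric])
      then show ?thesis using True by (simp add: \<psi>_def)
    next
      case False
      then have "\<mu> ! l + 2 * (N - t) < \<mu> ! j + 2 * (N - s)" using le sN by linarith
      then have "(\<mu> ! l + 2 * (N - t) + 1) * length \<mu> \<le> (\<mu> ! j + 2 * (N - s)) * length \<mu>"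
        by (intro mult_right_mono) auto
      then show ?thesis using bd(2) unfolding \<psi>_def by simp
    qed
  qed
  have inv: "inv_into (block_positions \<mu>) (block_index \<mu>) (block_index \<mu> z) = z" if "z \<in> block_positions \<mu>" for z
    using inv_into_f_f[OF inj_on_block_index that] .
  have "A ^\<^sub>m (Suc (Max (\<phi> ` {..<sum_list \<mu>}))) = 0\<^sub>m (sum_list \<mu>) (sum_list \<mu>)"
  proof (rule nilpotent_of_increasing[OF A, of \<phi>])
    fix i k assume ik: "i < sum_list \<mu>" "k < sum_list \<mu>" "A $$ (i, k) \<noteq> 0"
    obtain z w where "z \<in> block_positions \<mu>" "i = block_index \<mu> z" "w \<in> block_positions \<mu>" "k = block_index \<mu> w"
      using block_index_cases[OF ik(1)] block_index_cases[OF ik(2)] by metis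
    then show "\<phi> k < \<phi> i" using inc[of "fst z" "snd z" "fst w" "snd w"] ik(3) by (simp add: \<phi>_def inv)
  qed (simp add: le_imp_less_Suc)
  then show "A \<in> nilpotent_commutator \<mu>" using A comm
    unfolding nilpotent_commutator_def nilpotent_mat_def by blast
qed

lemma triangular_commutator_line:
  assumes "X \<in> triangular_commutator \<mu>" "Y \<in> triangular_commutator \<mu>"
  shows "mat (sum_list \<mu>) (sum_list \<mu>) (\<lambda>ij. X $$ ij + t * (Y $$ ij - X $$ ij)) \<in> triangular_commutator \<mu>"
proof -
  let ?n = "sum_list \<mu>" and ?J = "nilpotent_jordan \<mu> :: 'a mat"
  let ?Z = "mat ?n ?n (\<lambda>ij. X $$ ij + t * (Y $$ ij - X $$ ij))"
  have X: "X \<in> carrier_mat ?n ?n" "X * ?J = ?J * X" and Y: "Y \<in> carrier_mat ?n ?n" "Y * ?J = ?J * Y"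
    using assms by (auto simp: triangular_commutator_def)
  have J: "?J \<in> carrier_mat ?n ?n" by simp
  have Z: "?Z = X + t \<cdot>\<^sub>m (Y - X)" using X Y by (intro eq_matI) auto
  have D: "Y - X \<in> carrier_mat ?n ?n" "t \<cdot>\<^sub>m (Y - X) \<in> carrier_mat ?n ?n" using X Y by auto
  have "?Z * ?J = X * ?J + t \<cdot>\<^sub>m (Y * ?J - X * ?J)"
    unfolding Z using X Y D J
    by (simp add: add_mult_distrib_mat[OF X(1) D(2) J] minus_mult_distrib_mat[OF Y(1) X(1) J]
      mult_smult_assoc_mat[OF D(1) J])
  also have "\<dots> = ?J * ?Z" unfolding Z X(2) Y(2) using X Y D J
    by (simp add: mult_add_distrib_mat[OF J X(1) D(2)] mult_minus_distrib_mat[OF J Y(1) X(1)]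
      mult_smult_distrib[OF J D(1)])
  finally have comm: "?Z * ?J = ?J * ?Z" .
  have zero: "?Z $$ (block_index \<mu> z, block_index \<mu> w) = 0"
    if "z \<in> block_positions \<mu>" "w \<in> block_positions \<mu>" "X $$ (block_index \<mu> z, block_index \<mu> w) = 0"
      "Y $$ (block_index \<mu> z, block_index \<mu> w) = 0" for z w
    using that block_index_less[of "fst z" "snd z" \<mu>] block_index_less[of "fst w" "snd w" \<mu>] by simp
  have XY: "X $$ (block_index \<mu> (j, s), block_index \<mu> (l, s)) = 0" "Y $$ (block_index \<mu> (j, s), block_index \<mu> (l, s)) = 0"
    if "(j, s) \<in> block_positions \<mu>" "(l, s) \<in> block_positions \<mu>" "\<mu> ! j = \<mu> ! l" "j \<le> l" for j l s
    using that assms unfolding triangular_commutator_def by blast+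
  show ?thesis unfolding triangular_commutator_def mem_Collect_eq
  proof (intro conjI allI impI)
    fix j l s
    assume a: "(j, s) \<in> block_positions \<mu>" "(l, s) \<in> block_positions \<mu>" "\<mu> ! j = \<mu> ! l" "j \<le> l"
    show "?Z $$ (block_index \<mu> (j, s), block_index \<mu> (l, s)) = 0" by (rule zero[OF a(1,2) XY[OF a]])
  qed (rule mat_carrier comm)+
qed

text \<open>With position \<open>t\<close> of block \<open>l\<close> viewed as \<open>x ^ (\<mu> ! l - 1 - t)\<close> in \<open>K[x]/(x ^ \<mu> ! l)\<close>, the matrix is
  multiplication by \<open>\<alpha> l j * x ^ c l j\<close> from block \<open>l\<close> to block \<open>j\<close>.\<close>

lemma shift_commutes:
  fixes A :: "'a :: field mat"
  assumes A: "A \<in> carrier_mat (sum_list \<mu>) (sum_list \<mu>)"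
    and ent: "\<And>l t j i. \<lbrakk>(l, t) \<in> block_positions \<mu>; (j, i) \<in> block_positions \<mu>\<rbrakk> \<Longrightarrow>
      A $$ (block_index \<mu> (j, i), block_index \<mu> (l, t)) = (if t + \<mu> ! j = i + \<mu> ! l + c l j then \<alpha> l j else 0)"
    and c: "\<And>l j. \<mu> ! j \<le> \<mu> ! l + c l j"
  shows "A * nilpotent_jordan \<mu> = nilpotent_jordan \<mu> * A"
proof (rule eq_matI)
  let ?J = "nilpotent_jordan \<mu> :: 'a mat"
  have J: "?J \<in> carrier_mat (sum_list \<mu>) (sum_list \<mu>)" by simp
  fix i k assume "i < dim_row (?J * A)" "k < dim_col (?J * A)"
  then have ik: "i < sum_list \<mu>" "k < sum_list \<mu>" using carrier_matD[OF A] carrier_matD[OF J] by auto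
  obtain z w where zw: "z \<in> block_positions \<mu>" "i = block_index \<mu> z" "w \<in> block_positions \<mu>" "k = block_index \<mu> w"
    using block_index_cases[OF ik(1)] block_index_cases[OF ik(2)] by metis
  obtain j s l t where eq: "z = (j, s)" "w = (l, t)" by fastforce
  have z: "(j, s) \<in> block_positions \<mu>" and w: "(l, t) \<in> block_positions \<mu>" using zw eq by auto
  have bd: "s < \<mu> ! j" "t < \<mu> ! l" "j < length \<mu>" "l < length \<mu>" using z w by (auto simp: block_positions_def)
  have 1: "(if t = 0 then 0 else A $$ (block_index \<mu> (j, s), block_index \<mu> (l, t - 1))) =
     (if t + \<mu> ! j = Suc s + \<mu> ! l + c l j then \<alpha> l j else 0)"
  proof (cases "t = 0")
    case True
    have "t + \<mu> ! j \<noteq> Suc s + \<mu> ! l + c l j" using True c[of j l] by linarith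
    then show ?thesis using True by simp
  next
    case False
    then have "(l, t - 1) \<in> block_positions \<mu>" using bd by (auto simp: block_positions_def)
    then show ?thesis using False ent[OF _ z, of l "t - 1"] by auto
  qed
  have 2: "(if Suc s < \<mu> ! j then A $$ (block_index \<mu> (j, Suc s), block_index \<mu> (l, t)) else 0) =
     (if t + \<mu> ! j = Suc s + \<mu> ! l + c l j then \<alpha> l j else 0)"
  proof (cases "Suc s < \<mu> ! j")
    case True
    then have "(j, Suc s) \<in> block_positions \<mu>" using bd by (auto simp: block_positions_def)
    then show ?thesis using True ent[OF w, of j "Suc s"] by simp
  qed (use bd in auto)
  show "(A * ?J) $$ (i, k) = (?J * A) $$ (i, k)"
    unfolding zw eq mult_nilpotent_jordan_entries[OF A z w] 1 2 ..
qed (use A carrier_matD[OF nilpotent_jordan_carrier[of \<mu>, where 'a='a]] in auto)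

context level_paths
begin

lemma card_path_positions:
  "card {z \<in> block_positions B. on_path (B ! fst z) (B ! fst z - 1 - snd z)} = config_weight B (map s [0..<k])"
proof -
  have eq: "{z \<in> block_positions B. on_path (B ! fst z) (B ! fst z - 1 - snd z)} =
     (SIGMA l:{..<length B}. {t. t < B ! l \<and> on_path (B ! l) (B ! l - 1 - t)})"
    by (auto simp: block_positions_def)
  have "card {t. t < x \<and> on_path x (x - 1 - t)} = level_weight (map s [0..<k]) x" if "x \<in> set B" for x
  proof -
    have "x - 1 - (x - 1 - t) = t" if "t < x" for t using that by simp
    then have "bij_betw (\<lambda>t. x - 1 - t) {t. t < x \<and> on_path x (x - 1 - t)} {a. a < x \<and> on_path x a}"
      by (intro bij_betwI[where g = "\<lambda>t. x - 1 - t"]) (simp_all add: Pi_def)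
    from bij_betw_same_card[OF this] card_on_path[OF that] show ?thesis by (rule trans)
  qed
  then have "(\<Sum>l<length B. card {t. t < B ! l \<and> on_path (B ! l) (B ! l - 1 - t)}) =
      (\<Sum>l<length B. level_weight (map s [0..<k]) (B ! l))"
    by (intro sum.cong refl) simp
  also have "\<dots> = config_weight B (map s [0..<k])"
    unfolding config_weight_def by (simp add: sum_list_sum_nth atLeast0LessThan)
  finally have "(\<Sum>l<length B. card {t. t < B ! l \<and> on_path (B ! l) (B ! l - 1 - t)}) = config_weight B (map s [0..<k])" .
  moreover have "card (SIGMA l:{..<length B}. {t. t < B ! l \<and> on_path (B ! l) (B ! l - 1 - t)}) =
      (\<Sum>l<length B. card {t. t < B ! l \<and> on_path (B ! l) (B ! l - 1 - t)})"
    by (rule card_SigmaI) simp_all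
  ultimately show ?thesis unfolding eq by (rule trans[rotated])
qed

lemma ex_minor_triangular_commutator:
  assumes inf: "infinite (UNIV :: 'a :: field set)" and r: "r + k * m \<le> config_weight B (map s [0..<k])"
  shows "\<exists>A\<in>triangular_commutator B :: 'a mat set. has_minor (sum_list B) r (A ^\<^sub>m m)"
proof -
  let ?n = "sum_list B" and ?f = "block_index B"
  define g where "g = inv_into (block_positions B) ?f"
  have gf: "g (?f z) = z" if "z \<in> block_positions B" for z
    unfolding g_def using inv_into_f_f[OF inj_on_block_index that] .
  have g: "g i \<in> block_positions B" "?f (g i) = i" if "i < ?n" for i
    using that block_index_image[of B] unfolding g_def by (auto intro!: inv_into_into f_inv_into_f)
  have f_less: "?f z < ?n" if "z \<in> block_positions B" for z
    using that block_index_image[of B] by blast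
  define e where "e z w = degree (fst z) (fst w) + pot z - pot w" for z w
  \<comment> \<open>Entries are polynomials so that the parameter can be set to 0.
    \<open>A x\<close> is the commuting matrix; \<open>M x\<close> is its conjugate for nonzero
    \<open>x\<close>, while \<open>M 0\<close> keeps exactly the steps of exponent zero.\<close>
  define P :: "'a poly mat" where "P = mat ?n ?n (\<lambda>(i, k). if step (g k) (g i) then monom 1 (e (g k) (g i)) else 0)"
  define M where "M x = map_mat (\<lambda>p. poly p x) P" for x
  define A where "A x = mat ?n ?n (\<lambda>(i, k). if step (g k) (g i) then x ^ degree (fst (g k)) (fst (g i)) else 0)"
    for x :: 'a
  have PM: "P \<in> carrier_mat ?n ?n" "M x \<in> carrier_mat ?n ?n" "A x \<in> carrier_mat ?n ?n" for x
    by (simp_all add: P_def M_def A_def)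
  have e: "e z w + pot w = degree (fst z) (fst w) + pot z" if "z \<in> block_positions B" "w \<in> block_positions B" "step z w" for z w
    using pot_diff(1)[of "fst z" "snd z" "fst w" "snd w"] that by (simp add: e_def)
  have M: "M x $$ (i, k) = (if step (g k) (g i) then x ^ e (g k) (g i) else 0)" if "i < ?n" "k < ?n" for i k x
    using that by (simp add: M_def P_def poly_monom)
  have M0: "M 0 $$ (i, k) = (if zero_step (g k) (g i) then 1 else 0)" if "i < ?n" "k < ?n" for i k
  proof (cases "step (g k) (g i)")
    case True
    have "e (g k) (g i) = 0 \<longleftrightarrow> zero_step (g k) (g i)"
      using e[OF g(1)[OF that(2)] g(1)[OF that(1)] True] True unfolding zero_step_def by linarith
    then show ?thesis using True unfolding M[OF that] by (simp add: power_0_left)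
  qed (simp add: M[OF that] zero_step_def)
  define X where "X = {z \<in> block_positions B. on_path (B ! fst z) (B ! fst z - 1 - snd z)}"
  \<comment> \<open>The path ends: first positions in the last block of the largest order.\<close>
  define F where "F = {z \<in> block_positions B.
    last_index B (fst z) \<and> snd z < hi (B ! fst z) \<and> (\<forall>x\<in>set B. x \<le> B ! fst z)}"
  have fin: "finite X" "finite F" by (simp_all add: X_def F_def)
  have "card F \<le> k"
  proof (cases "F = {}")
    case False
    then obtain l t where l: "(l, t) \<in> F" by auto
    then have lB: "l < length B" "last_index B l" "\<And>x. x \<in> set B \<Longrightarrow> x \<le> B ! l" by (auto simp: F_def last_index_def)
    have "z \<in> {l} \<times> {..<hi (B ! l)}" if "z \<in> F" for z
    proof -
      have "last_index B (fst z)" "fst z < length B" "B ! l \<le> B ! fst z" "snd z < hi (B ! fst z)"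
        using that lB by (auto simp: F_def last_index_def)
      moreover from this have "B ! fst z \<le> B ! l" using lB(3) by simp
      ultimately have "l = fst z" "B ! l = B ! fst z" using last_index_unique[OF lB(2), of "fst z"] by linarith+
      then show ?thesis using \<open>snd z < hi (B ! fst z)\<close> by (metis (no_types) insertI1 lessThan_iff mem_Times_iff)
    qed
    then have "card F \<le> card ({l} \<times> {..<hi (B ! l)})" by (intro card_mono) auto
    also have "\<dots> = hi (B ! l)" by simp
    also have "\<dots> \<le> k"
    proof (rule lo_hi(4))
      show "B ! l \<in> set B" using lB(1) by simp
      show "\<not> (B ! l + 1 = p (K (B ! l)) \<and> B ! l + 1 \<in> set B)" using lB(3)[of "B ! l + 1"] by linarith
    qed
    finally show ?thesis .
  qed simp
  then have XF: "card X \<le> card (X - F) + k"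
    using diff_card_le_card_Diff[OF fin(2), of X] by linarith
  define \<sigma> where "\<sigma> z = (SOME w. w \<in> block_positions B \<and> zero_step z w)" for z
  have \<sigma>: "\<sigma> z \<in> block_positions B \<and> zero_step z (\<sigma> z)" if "z \<in> X - F" for z
  proof -
    have "\<exists>w. w \<in> block_positions B \<and> zero_step z w"
      using ex_zero_step[of "fst z" "snd z"] that by (auto simp: X_def F_def)
    then show ?thesis unfolding \<sigma>_def by (rule someI_ex)
  qed
  have \<sigma>X: "\<sigma> z \<in> X" if "z \<in> X - F" for z
    using \<sigma>[OF that] zero_step_on_path[of "fst z" "snd z" "fst (\<sigma> z)" "snd (\<sigma> z)"] that by (auto simp: X_def)
  have XB: "X \<subseteq> block_positions B" by (auto simp: X_def)
  have cf: "card (?f ` Y) = card Y" if "Y \<subseteq> block_positions B" for Y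
    using card_image[OF inj_on_subset[OF inj_on_block_index that]] .
  have minor0: "has_minor ?n r (M 0 ^\<^sub>m m)"
  proof (rule has_minor_partial_permutation_pow[OF PM(2), of "?f ` X" "?f ` (X - F)" k "\<lambda>v. ?f (\<sigma> (g v))"])
    show "?f ` X \<subseteq> {..<?n}" using XB f_less by auto
    show "card (?f ` X) \<le> card (?f ` (X - F)) + k" using XF XB by (simp add: cf Diff_subset subset_trans[OF Diff_subset XB])
    show "inj_on (\<lambda>v. ?f (\<sigma> (g v))) (?f ` (X - F))"
    proof (rule inj_onI, clarify)
      fix z w assume zw: "z \<in> X" "z \<notin> F" "w \<in> X" "w \<notin> F" and eq: "?f (\<sigma> (g (?f z))) = ?f (\<sigma> (g (?f w)))"
      then have pos: "z \<in> block_positions B" "w \<in> block_positions B" using XB by auto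
      then have "?f (\<sigma> z) = ?f (\<sigma> w)" using eq gf by simp
      then have "\<sigma> z = \<sigma> w" using \<sigma> zw inj_onD[OF inj_on_block_index] by blast
      moreover have "\<sigma> z \<in> block_positions B" "zero_step z (\<sigma> z)" "zero_step w (\<sigma> w)" using \<sigma> zw by auto
      ultimately show "?f z = ?f w" using zero_step_inj[OF pos, of "\<sigma> z"] by simp
    qed
    show "(\<lambda>v. ?f (\<sigma> (g v))) ` ?f ` (X - F) \<subseteq> ?f ` X" using \<sigma>X gf XB by auto
    show "r + k * m \<le> card (?f ` X)" using r card_path_positions cf[OF XB] by (simp add: X_def)
    fix v i assume "v \<in> ?f ` (X - F)" "i < ?n"
    then obtain z where z: "v = ?f z" "z \<in> X" "z \<notin> F" "z \<in> block_positions B" using XB by auto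
    have \<sigma>z: "\<sigma> z \<in> block_positions B" "zero_step z (\<sigma> z)" using \<sigma>[of z] z by auto
    have "zero_step z (g i) \<longleftrightarrow> g i = \<sigma> z"
      using zero_step_unique[OF z(4) g(1)[OF \<open>i < ?n\<close>] \<sigma>z(1)] \<sigma>z(2) by metis
    also have "\<dots> \<longleftrightarrow> i = ?f (\<sigma> z)" using g(2)[OF \<open>i < ?n\<close>] gf[OF \<sigma>z(1)] by metis
    finally have "zero_step z (g i) \<longleftrightarrow> i = ?f (\<sigma> z)" .
    then show "M 0 $$ (i, v) = (if i = ?f (\<sigma> (g v)) then 1 else 0)"
      using M0[OF \<open>i < ?n\<close> f_less[OF z(4)]] unfolding z(1) gf[OF z(4)] by simp
  qed auto
  then have "finite {x. \<not> has_minor ?n r (M x ^\<^sub>m m)}"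
    using finite_not_has_minor_pow[OF PM(1), of r 0 m] by (simp add: M_def)
  then obtain x where x: "x \<noteq> 0" "has_minor ?n r (M x ^\<^sub>m m)"
    using ex_new_if_finite[OF inf, of "insert 0 {x. \<not> has_minor ?n r (M x ^\<^sub>m m)}"] by auto
  define D where "D = mat_diag ?n (\<lambda>i. x ^ pot (g i))"
  define D' where "D' = mat_diag ?n (\<lambda>i. inverse (x ^ pot (g i)))"
  have "similar_mat_wit (M x) (A x) D' D"
  proof (rule similar_mat_witI)
    show "D' * D = 1\<^sub>m ?n" "D * D' = 1\<^sub>m ?n" unfolding D_def D'_def mat_diag_diag using x(1) by auto
    have "D' * A x * D = D' * (A x * D)" 
      by (rule assoc_mult_mat[of _ ?n ?n _ ?n _ ?n]) (simp_all add: D_def D'_def PM)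
    also have "\<dots> = M x"
    proof (rule eq_matI)
      fix i k assume "i < dim_row (M x)" "k < dim_col (M x)"
      then have ik: "i < ?n" "k < ?n" using carrier_matD[OF PM(2)] by auto
      have AD: "A x * D \<in> carrier_mat ?n ?n" by (rule mult_carrier_mat[OF PM(3)]) (simp add: D_def)
      have "(D' * (A x * D)) $$ (i, k) = inverse (x ^ pot (g i)) * (A x $$ (i, k) * x ^ pot (g k))"
        using ik unfolding D'_def mat_diag_mult_left[OF AD] unfolding D_def mat_diag_mult_right[OF PM(3)] by simp
      also have "\<dots> = M x $$ (i, k)"
      proof (cases "step (g k) (g i)")
        case True
        have "x ^ degree (fst (g k)) (fst (g i)) * x ^ pot (g k) = x ^ e (g k) (g i) * x ^ pot (g i)"
          using e[OF g(1)[OF ik(2)] g(1)[OF ik(1)] True] by (simp add: power_add[symmetric])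
        moreover have "A x $$ (i, k) = x ^ degree (fst (g k)) (fst (g i))" using ik True by (simp add: A_def)
        moreover have "x ^ pot (g i) \<noteq> 0" using x(1) by simp
        ultimately show ?thesis using M[OF ik] True by (simp only: if_True) (simp add: field_simps)
      qed (use ik M[OF ik] in \<open>simp add: A_def\<close>)
      finally show "(D' * (A x * D)) $$ (i, k) = M x $$ (i, k)" .
    qed (use carrier_matD[OF PM(2)] in \<open>auto simp: D_def D'_def mat_diag_def\<close>)
    finally show "M x = D' * A x * D" ..
  qed (auto simp: D_def D'_def PM)
  then have "has_minor ?n r (A x ^\<^sub>m m)"
    using x(2) has_minor_similar_pow[OF _ PM(2)] unfolding similar_mat_def by blast
  moreover have "A x \<in> triangular_commutator B"
  proof -
    have ent: "A x $$ (?f w, ?f z) = (if step z w then x ^ degree (fst z) (fst w) else 0)"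
      if "z \<in> block_positions B" "w \<in> block_positions B" for z w
      using that f_less gf by (simp add: A_def)
    have "A x * nilpotent_jordan B = nilpotent_jordan B * A x"
      by (rule shift_commutes[OF PM(3), where c = shift and \<alpha> = "\<lambda>l j. if arrow l j then x ^ degree l j else 0"])
        (auto simp: ent step_def shift_def)
    moreover have "A x $$ (?f (j, i), ?f (l, i)) = 0"
      if "(j, i) \<in> block_positions B" "(l, i) \<in> block_positions B" "B ! j = B ! l" "j \<le> l" for j l i
      using that by (auto simp: ent step_def shift_def)
    ultimately show ?thesis using PM(3) unfolding triangular_commutator_def by auto
  qed
  ultimately show ?thesis by blast
qed

end

section \<open>Normalized configurations and the generic ranks\<close>

lemma level_weight_le: "level_weight ss x \<le> x"
proof (induction ss arbitrary: x)
  case (Cons s ss)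
  show ?case using Cons.IH[of "x - 2"] by auto
qed simp

lemma config_weight_le: "config_weight B ss \<le> sum_list B"
  unfolding config_weight_def using sum_list_mono[of B "level_weight ss" "\<lambda>x. x"] level_weight_le by simp

lemma config_weight_butlast:
  assumes "sorted (ss @ [s])" and "\<And>x. x \<in> set B \<Longrightarrow> x < s + 2 * length ss"
  shows "config_weight B (ss @ [s]) = config_weight B ss"
proof -
  have "config_term B (length ss) s = (\<Sum>x\<leftarrow>B. 0)"
    unfolding config_term_def using assms(2) by (intro arg_cong[of _ _ sum_list] map_cong) (auto simp: level_term_def)
  moreover have "sorted ss" using assms(1) by (simp add: sorted_append)
  ultimately show ?thesis using assms(1) by (simp add: config_weight_sum nth_append)
qed

text \<open>Only the ends of a run of equal entries contribute to the change of weight: the sum of the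
  increments telescopes.\<close>

lemma config_weight_raise:
  assumes "sorted ss" "i < i'" "i' \<le> length ss" "\<And>k. i \<le> k \<Longrightarrow> k < i' \<Longrightarrow> ss ! k = v"
    and next_run: "\<And>k. i' \<le> k \<Longrightarrow> k < length ss \<Longrightarrow> v < ss ! k"
    and "v = 0 \<or> v + 2 * i \<notin> set B"
  defines "ss' \<equiv> map (\<lambda>k. if i \<le> k \<and> k < i' then Suc v else ss ! k) [0..<length ss]"
  shows "sorted ss'" "config_weight B ss \<le> config_weight B ss'"
proof -
  have le: "ss ! k \<le> ss ! l" if "k \<le> l" "l < length ss" for k l using assms(1) that by (rule sorted_nth_mono)
  have len: "length ss' = length ss" by (simp add: ss'_def)
  have nth: "ss' ! k = (if i \<le> k \<and> k < i' then Suc v else ss ! k)" if "k < length ss" for k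
    using that by (simp add: ss'_def)
  show sorted: "sorted ss'"
  proof (unfold sorted_iff_nth_mono len, intro allI impI)
    fix k l assume kl: "k \<le> l" "l < length ss"
    show "ss' ! k \<le> ss' ! l"
    proof (cases "i \<le> k \<and> k < i'")
      case True
      then show ?thesis using kl nth next_run[of l] by (auto simp: Suc_le_eq)
    next
      case False
      then have "ss' ! k = ss ! k" using kl nth[of k] by (simp only: if_False)
      also have "\<dots> \<le> ss ! l" using le kl by simp
      also have "\<dots> \<le> ss' ! l" using nth[OF kl(2)] assms(4)[of l] by simp
      finally show ?thesis .
    qed
  qed
  let ?t = "\<lambda>k s. int (config_term B k s)"
  define f where "f k = int (count_list B (v + 2 * k))" for k
  have "int (config_weight B ss') - int (config_weight B ss) = (\<Sum>k<length ss. ?t k (ss' ! k) - ?t k (ss ! k))"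
    using config_weight_sum[OF sorted, of B] config_weight_sum[OF assms(1), of B] by (simp add: len sum_subtractf)
  also have "\<dots> = (\<Sum>k\<in>{i..<i'}. ?t k (Suc v) - ?t k v)"
    using assms(3,4) nth by (intro sum.mono_neutral_cong_right) auto
  also have "\<dots> = (\<Sum>k\<in>{i..<i'}. int v * (f (Suc k) - f k))"
    by (intro sum.cong refl) (simp add: config_term_Suc f_def)
  also have "\<dots> = int v * (f i' - f i)"
    using assms(2) by (simp add: sum_distrib_left[symmetric] sum_Suc_diff')
  also have "\<dots> \<ge> 0" using assms(6) by (auto simp: f_def count_list_0_iff)
  finally show "config_weight B ss \<le> config_weight B ss'" by simp
qed

text \<open>The configuration is first normalized to fit \<open>level_paths\<close>: it is taken of
  minimal length and, among those, with maximal sum of entries. Minimality bounds the entries, since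
  a last path beyond all parts could be dropped; maximality makes every entry positive with its
  order present, since otherwise \<open>config_weight_raise\<close> would apply.\<close>

lemma ex_minor_config:
  assumes inf: "infinite (UNIV :: 'a :: field set)" and B: "sorted_wrt (\<ge>) B" "\<And>x. x \<in> set B \<Longrightarrow> 1 \<le> x"
    and ss: "sorted ss" "r + length ss * m \<le> config_weight B ss"
  shows "\<exists>A\<in>triangular_commutator B :: 'a mat set. has_minor (sum_list B) r (A ^\<^sub>m m)"
proof -
  define good where "good ss \<longleftrightarrow> sorted ss \<and> r + length ss * m \<le> config_weight B ss" for ss
  define L where "L = (LEAST L. \<exists>ss. good ss \<and> length ss = L)"
  have "\<exists>ss. good ss \<and> length ss = L" unfolding L_def
    by (rule LeastI_ex) (use ss in \<open>auto simp: good_def\<close>)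
  moreover have L: "L \<le> length ss" if "good ss" for ss unfolding L_def by (rule Least_le) (use that in auto)
  have bound: "\<exists>x\<in>set B. s + 2 * length ss \<le> x" if "good (ss @ [s])" "length (ss @ [s]) = L" for ss s
  proof (rule ccontr)
    assume "\<not> ?thesis"
    then have "config_weight B (ss @ [s]) = config_weight B ss"
      using that by (intro config_weight_butlast) (auto simp: good_def not_le)
    then have "good ss" using that(1) by (auto simp: good_def sorted_append)
    then show False using L[of ss] that(2) by simp
  qed
  have le_sum: "x \<le> sum_list B" if "x \<in> set B" for x using that by (intro member_le_sum_list) simp_all
  have sum_bound: "sum_list ss \<le> L * sum_list B" if "good ss" "length ss = L" for ss
  proof (cases ss rule: rev_cases)
    case (snoc rs s)
    have "s \<le> sum_list B" using bound[of rs s] that le_sum unfolding snoc by fastforce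
    then have "y \<le> sum_list B" if "y \<in> set ss" for y
      using that \<open>good ss\<close> by (auto simp: good_def snoc sorted_append)
    then have "sum_list (map (\<lambda>y. y) ss) \<le> sum_list (map (\<lambda>y. sum_list B) ss)" by (intro sum_list_mono) auto
    then show ?thesis using that(2) by (simp add: sum_list_triv)
  qed simp
  ultimately obtain ss0 where "good ss0 \<and> length ss0 = L" by blast
  then obtain ss where gL: "good ss" "length ss = L"
    and max: "\<And>ss'. good ss' \<Longrightarrow> length ss' = L \<Longrightarrow> sum_list ss' \<le> sum_list ss"
    using ex_has_greatest_nat[of "\<lambda>ss. good ss \<and> length ss = L" ss0 sum_list "L * sum_list B + 1"] sum_bound
    by (metis less_Suc_eq_le Suc_eq_plus1)
  have eff: "ss ! i \<noteq> 0 \<and> ss ! i + 2 * i \<in> set B" if i: "i < L" for i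
  proof (rule ccontr)
    assume neg: "\<not> ?thesis"
    define v where "v = ss ! i"
    have srt: "sorted ss" using gL by (simp add: good_def)
    have "\<exists>i'. i < i' \<and> (i' = L \<or> i' < L \<and> ss ! i' \<noteq> v)" using i by blast
    then obtain i' where i': "i < i'" "i' = L \<or> i' < L \<and> ss ! i' \<noteq> v"
      and least: "\<And>k. k < i' \<Longrightarrow> \<not> (i < k \<and> (k = L \<or> k < L \<and> ss ! k \<noteq> v))"
      using exists_least_iff[of "\<lambda>i'. i < i' \<and> (i' = L \<or> i' < L \<and> ss ! i' \<noteq> v)"] by blast
    have run: "ss ! k = v" if "i \<le> k" "k < i'" for k
      using least[OF that(2)] that i' by (cases "k = i") (auto simp: v_def)
    have next_run: "v < ss ! k" if "i' \<le> k" "k < length ss" for k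
    proof -
      have "v \<le> ss ! i'" using sorted_nth_mono[OF srt, of i i'] i' that gL by (auto simp: v_def)
      then have "v < ss ! i'" using i' that gL by auto
      also have "\<dots> \<le> ss ! k" using sorted_nth_mono[OF srt] that by simp
      finally show ?thesis .
    qed
    define ss' where "ss' = map (\<lambda>k. if i \<le> k \<and> k < i' then Suc v else ss ! k) [0..<length ss]"
    have iL: "i' \<le> length ss" using i' gL by auto
    have "sorted ss'" "config_weight B ss \<le> config_weight B ss'" unfolding ss'_def
      using config_weight_raise[OF srt i'(1) iL run next_run, of B] neg by (auto simp: v_def)
    then have "good ss'" "length ss' = L" using gL by (auto simp: good_def ss'_def)
    then have "sum_list ss' \<le> sum_list ss" by (rule max)
    moreover have "sum_list ss < sum_list ss'"
    proof -
      have "sum_list ss' = (\<Sum>k<L. if i \<le> k \<and> k < i' then Suc v else ss ! k)" "sum_list ss = (\<Sum>k<L. ss ! k)"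
        using gL by (auto simp: ss'_def sum_list_sum_nth atLeast0LessThan intro!: sum.cong)
      moreover have "(\<Sum>k<L. ss ! k) < (\<Sum>k<L. if i \<le> k \<and> k < i' then Suc v else ss ! k)"
        using i i' run by (intro sum_strict_mono_ex1) auto
      ultimately show ?thesis by simp
    qed
    ultimately show False by simp
  qed
  \<comment> \<open>Padding for the indices from \<open>L\<close> on: larger than every part and at
    least every entry.\<close>
  define c where "c = sum_list B + sum_list ss + 1"
  define s where "s i = (if i < L then ss ! i else c)" for i
  have le_c: "ss ! i \<le> c" if "i < L" for i
    using member_le_sum_list[of "ss ! i" ss] that gL by (simp add: c_def)
  interpret level_paths B s L
  proof
    show "mono s"
    proof (rule monoI)
      fix i j :: nat assume "i \<le> j"
      then show "s i \<le> s j" using le_c gL sorted_nth_mono[of ss i j] by (auto simp: s_def good_def)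
    qed
    show "1 \<le> s i" for i using eff[of i] by (auto simp: s_def c_def)
    show "x < s i + 2 * i" if "L \<le> i" "x \<in> set B" for i x using le_sum[OF that(2)] that(1) by (simp add: s_def c_def)
  qed (use B eff in \<open>auto simp: s_def\<close>)
  have "map s [0..<L] = ss" using gL by (intro nth_equalityI) (auto simp: s_def)
  then show ?thesis using gL by (intro ex_minor_triangular_commutator[OF inf]) (simp add: good_def)
qed

text \<open>The function \<open>G\<close> of the overview. Truncation is harmless, as the empty
  configuration already gives 0.\<close>

definition max_rank :: "nat list \<Rightarrow> nat \<Rightarrow> nat" where
  "max_rank B m = Max ((\<lambda>ss. config_weight B ss - length ss * m) ` {ss. sorted ss})"

lemma le_max_rank_iff: "r \<le> max_rank B m \<longleftrightarrow> (\<exists>ss. sorted ss \<and> r + length ss * m \<le> config_weight B ss)"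
proof -
  let ?S = "(\<lambda>ss. config_weight B ss - length ss * m) ` {ss. sorted ss}"
  have "?S \<subseteq> {..sum_list B}" using config_weight_le[of B] by (auto intro: le_trans[OF diff_le_self])
  then have fin: "finite ?S" by (rule finite_subset) simp
  have ne: "?S \<noteq> {}" using sorted_wrt.simps(1) by blast
  have "r \<le> max_rank B m \<longleftrightarrow> (\<exists>ss. sorted ss \<and> r \<le> config_weight B ss - length ss * m)"
    unfolding max_rank_def Max_ge_iff[OF fin ne] by auto
  also have "\<dots> \<longleftrightarrow> (\<exists>ss. sorted ss \<and> r + length ss * m \<le> config_weight B ss)"
  proof (cases "r = 0")
    case True
    then show ?thesis by (metis add_cancel_left_left list.size(3) mult_0 sorted_wrt.simps(1) zero_le)
  qed (metis le_diff_conv2 nat_le_linear diff_is_0_eq le_zero_eq le_diff_conv add_leE)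
  finally show ?thesis .
qed

lemma max_rank_eq_0:
  assumes "sum_list B \<le> m"
  shows "max_rank B m = 0"
proof (rule ccontr)
  assume "max_rank B m \<noteq> 0"
  then obtain ss where ss: "1 + length ss * m \<le> config_weight B ss"
    using le_max_rank_iff[of 1 B m] by auto
  then have "ss \<noteq> []" by (auto simp: config_weight_def)
  then have "m \<le> length ss * m" by (cases ss) auto
  then show False using ss config_weight_le[of B ss] assms by linarith
qed

lemma has_partition_excess_le:
  assumes "(A :: 'a :: field mat) \<in> nilpotent_commutator B" "has_partition A p"
  shows "excess p m \<le> max_rank B m"
proof -
  have A: "A \<in> carrier_mat (sum_list B) (sum_list B)"
    using assms(1) by (simp add: nilpotent_commutator_def nilpotent_mat_def)
  have "has_minor (sum_list B) (excess p m) (A ^\<^sub>m m)" using has_partition_minor(2)[OF assms(2) A] by simp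
  from nilpotent_commutator_minor_bound[OF assms(1) this] show ?thesis by (simp add: le_max_rank_iff)
qed

lemma has_partition_pos: "has_partition A p \<Longrightarrow> 0 \<notin> set p"
  by (auto simp: has_partition_def jordan_nf_def image_image)

text \<open>Powers beyond \<open>sum_list B\<close> impose nothing, since \<open>max_rank\<close>
  vanishes there; so finitely many conditions remain for one generic matrix. Its
  \<open>excess\<close> is the upper bound itself, which makes the maximum unique.\<close>

lemma ex_max_partition:
  assumes inf: "infinite (UNIV :: 'a :: field set)" and B: "sorted_wrt (\<ge>) B" "\<And>x. x \<in> set B \<Longrightarrow> 1 \<le> x"
  obtains p where "is_max_partition TYPE('a) B p" "Q TYPE('a) B = p" "sorted_wrt (\<ge>) p" "0 \<notin> set p"
    "\<And>m. excess p m = max_rank B m"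
proof -
  let ?n = "sum_list B"
  have "\<exists>A\<in>triangular_commutator B :: 'a mat set. \<forall>m\<le>?n. has_minor ?n (max_rank B m) (A ^\<^sub>m m)"
  proof (rule simultaneous_minors[OF inf])
    show "triangular_commutator B \<subseteq> (carrier_mat ?n ?n :: 'a mat set)" by (auto simp: triangular_commutator_def)
    show "mat ?n ?n (\<lambda>ij. X $$ ij + t * (Y $$ ij - X $$ ij)) \<in> triangular_commutator B"
      if "X \<in> triangular_commutator B" "Y \<in> triangular_commutator B" for X Y and t :: 'a
      using that by (rule triangular_commutator_line)
    show "\<exists>A\<in>triangular_commutator B :: 'a mat set. has_minor ?n (max_rank B m) (A ^\<^sub>m m)" for m
      using le_max_rank_iff[of "max_rank B m" B m] ex_minor_config[OF inf B] by blast
  qed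
  then obtain A :: "'a mat" where A: "A \<in> nilpotent_commutator B"
    and minor: "\<And>m. m \<le> ?n \<Longrightarrow> has_minor ?n (max_rank B m) (A ^\<^sub>m m)"
    using triangular_commutator_subset by blast
  have nil: "nilpotent_mat ?n A" using A by (simp add: nilpotent_commutator_def)
  then obtain p where p: "has_partition A p" using nilpotent_has_partition by blast
  have Ac: "A \<in> carrier_mat ?n ?n" using nil by (simp add: nilpotent_mat_def)
  have ex: "excess p m = max_rank B m" for m
  proof (rule antisym)
    show "max_rank B m \<le> excess p m"
    proof (cases "m \<le> ?n")
      case True
      then show ?thesis using minor[OF True] has_partition_minor(2)[OF p Ac] by simp
    qed (simp add: max_rank_eq_0)
  qed (rule has_partition_excess_le[OF A p])
  have mx: "is_max_partition TYPE('a) B p"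
    unfolding is_max_partition_def commuting_partitions_def partition_le_iff ex
    using A p has_partition_excess_le by blast
  have uniq: "p' = p" if max': "is_max_partition TYPE('a) B p'" for p'
  proof -
    obtain A' :: "'a mat" where A': "A' \<in> nilpotent_commutator B" "has_partition A' p'"
      using max' by (auto simp: is_max_partition_def commuting_partitions_def)
    have "excess p' m = excess p m" for m
    proof (rule antisym)
      show "excess p' m \<le> excess p m" using has_partition_excess_le[OF A'] by (simp add: ex)
      show "excess p m \<le> excess p' m"
        using that mx by (auto simp: is_max_partition_def partition_le_iff)
    qed
    then have "mset p' = mset p" using has_partition_pos A'(2) p by (intro mset_eq_of_excess) auto
    then show ?thesis using A'(2) p by (intro sorted_desc_unique) (auto simp: has_partition_def)
  qed
  have "Q TYPE('a) B = p" unfolding Q_def using mx uniq by (rule the_equality)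
  then show thesis using mx p ex has_partition_pos by (intro that[of p]) (auto simp: has_partition_def)
qed

section \<open>Splitting off the largest part\<close>

lemma config_weight_Cons_Nil: "config_weight B [s] = config_term B 0 s"
  using config_weight_sum[of "[s]" B] by simp

text \<open>A path does not get smaller when the paths before it are dropped, so each one weighs at
  most as much as the best single path.\<close>

lemma config_weight_le_maximal:
  assumes max: "\<And>s. config_term B 0 s \<le> w" and "sorted ss"
  shows "config_weight B ss \<le> length ss * w"
proof -
  have "config_term B i s \<le> config_term B 0 (s + 2 * i)" for i s
    unfolding config_term_def by (intro sum_list_mono) (auto simp: level_term_def)
  then have "config_term B i s \<le> w" for i s using max le_trans by blast
  then have "(\<Sum>i<length ss. config_term B i (ss ! i)) \<le> of_nat (card {..<length ss}) * w"
    by (intro sum_bounded_above) simp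
  then show ?thesis using config_weight_sum[OF assms(2), of B] by simp
qed

text \<open>The first claim combines \<open>config_exchange\<close> with the weight of an insertion.
  The second one says that no part of the remaining maximum partition exceeds
  \<open>w\<close>.\<close>

lemma max_rank_remove_pair:
  assumes max: "\<And>s. config_term B 0 s \<le> config_term B 0 \<sigma>" and w: "w = config_term B 0 \<sigma>"
  shows "max_rank B m = (w - m) + max_rank (remove_pair \<sigma> B) m" and "max_rank (remove_pair \<sigma> B) w = 0"
proof -
  let ?B' = "remove_pair \<sigma> B"
  have bound: "config_weight B ss \<le> length ss * w" if "sorted ss" for ss
    using config_weight_le_maximal[of B w] max that by (simp add: w)
  have ins: "config_weight B (config_insert \<sigma> ss) = w + config_weight ?B' ss" if "sorted ss" for ss
    using config_weight_config_insert[OF that] by (simp add: config_weight_Cons_Nil w)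
  have zero: "max_rank ?B' m = 0" "max_rank B m = 0" if "w \<le> m" for m
  proof -
    have lw: "length ss * w \<le> length ss * m" for ss :: "nat list" using that by simp
    have bound': "config_weight ?B' ss \<le> length ss * w" if "sorted ss" for ss
      using bound[OF sorted_config_insert[OF that, of \<sigma>]] ins[OF that] by simp
    have "\<not> 1 + length ss * m \<le> config_weight ?B' ss" "\<not> 1 + length ss * m \<le> config_weight B ss" if "sorted ss" for ss
      using bound[OF that] bound'[OF that] lw[of ss] by linarith+
    then have "\<not> 1 \<le> max_rank ?B' m" "\<not> 1 \<le> max_rank B m" unfolding le_max_rank_iff by blast+
    then show "max_rank ?B' m = 0" "max_rank B m = 0" by simp_all
  qed
  show "max_rank ?B' w = 0" by (rule zero) simp
  show "max_rank B m = (w - m) + max_rank ?B' m"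
  proof (cases "w \<le> m")
    case False
    show ?thesis
    proof (rule antisym)
      obtain ss where ss: "sorted ss" "max_rank B m + length ss * m \<le> config_weight B ss"
        using le_max_rank_iff[of "max_rank B m" B m] by auto
      show "max_rank B m \<le> (w - m) + max_rank ?B' m"
      proof (cases "ss = []")
        case True
        then show ?thesis using ss by (simp add: config_weight_def)
      next
        case nonempty: False
        obtain ss' where ss': "sorted ss'" "length ss = Suc (length ss')"
            "config_weight B ss \<le> config_weight B (config_insert \<sigma> ss')"
          using config_exchange[OF ss(1) nonempty max] by blast
        then have "max_rank B m + m + length ss' * m \<le> w + config_weight ?B' ss'"
          using ss(2) ins[OF ss'(1)] by simp
        moreover have le: "r \<le> max_rank ?B' m" if "r + length ss' * m \<le> config_weight ?B' ss'" for r
          using that ss'(1) le_max_rank_iff by blast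
        ultimately have "max_rank B m + m - w \<le> max_rank ?B' m" if "w \<le> max_rank B m + m"
          using that by (intro le) linarith
        then show ?thesis using False by linarith
      qed
    next
      obtain ss where ss: "sorted ss" "max_rank ?B' m + length ss * m \<le> config_weight ?B' ss"
        using le_max_rank_iff[of "max_rank ?B' m" ?B' m] by auto
      then have "(w - m) + max_rank ?B' m + length (config_insert \<sigma> ss) * m \<le> config_weight B (config_insert \<sigma> ss)"
        using ins[OF ss(1)] False by simp
      then show "(w - m) + max_rank ?B' m \<le> max_rank B m"
        using le_max_rank_iff sorted_config_insert[OF ss(1)] by blast
    qed
  qed (use zero in simp)
qed

section \<open>The recursion\<close>

locale partition_blocks =
  fixes \<mu> :: "nat list" and u :: nat and q :: "nat \<Rightarrow> nat"
  assumes sorted: "sorted_wrt (\<ge>) \<mu>" and pos: "\<And>x. x \<in> set \<mu> \<Longrightarrow> 1 \<le> x" and blocks: "block_ends \<mu> u q"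
begin

abbreviation level :: "nat \<Rightarrow> nat" where "level j \<equiv> part \<mu> (q j)"

abbreviation mult :: "nat \<Rightarrow> nat" where "mult j \<equiv> q j - q (j - 1)"

lemma q_less: "i < j \<Longrightarrow> j \<le> u \<Longrightarrow> q i < q j"
proof (induction j)
  case (Suc j)
  have "q j < q (Suc j)" using blocks Suc.prems by (simp add: block_ends_def)
  moreover have "q i < q j" if "i \<noteq> j" using Suc.IH Suc.prems that by simp
  ultimately show ?case by (cases "i = j") auto
qed simp

lemma q_ends: "q 0 = 0" "q u = length \<mu>"
  using blocks by (auto simp: block_ends_def)

lemma q_le: "j \<le> u \<Longrightarrow> q j \<le> length \<mu>"
  using q_less[of j u] q_ends(2) by (cases "j = u") (auto intro: less_imp_le)

lemma part_block: "\<lbrakk>1 \<le> i; i \<le> u; q (i - 1) < j; j \<le> q i\<rbrakk> \<Longrightarrow> part \<mu> j = level i"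
  using blocks unfolding block_ends_def by (metis Suc_eq_plus1 Suc_leI atLeastAtMost_iff)

lemma level_in: "1 \<le> i \<Longrightarrow> i \<le> u \<Longrightarrow> level i \<in> set \<mu>"
  using q_less[of 0 i] q_le[of i] by (auto simp: part_def)

lemma level_decreasing:
  assumes "1 \<le> i" "i < j" "j \<le> u"
  shows "level j < level i"
  using assms(2,3)
proof (induction j)
  case (Suc j)
  have j: "1 \<le> j" "j < u" using Suc.prems assms(1) by auto
  have qj: "0 < q j" "q j < q (Suc j)" "q (Suc j) \<le> length \<mu>"
    using q_less[of 0 j] q_less[of j "Suc j"] q_le[of "Suc j"] j by auto
  have "part \<mu> (q j + 1) = level (Suc j)" using part_block[of "Suc j" "q j + 1"] qj j by simp
  moreover have "level j \<noteq> part \<mu> (q j + 1)" using blocks j by (simp add: block_ends_def)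
  moreover have "part \<mu> (q j + 1) \<le> level j"
    using sorted_wrt_nth_less[OF sorted, of "q j - 1" "q j"] qj by (simp add: part_def)
  ultimately have "level (Suc j) < level j" by simp
  moreover have "level j < level i" if "i \<noteq> j" using Suc.IH Suc.prems that by simp
  ultimately show ?case by (cases "i = j") auto
qed simp

lemma concat_blocks: "j \<le> u \<Longrightarrow> concat (map (\<lambda>j. replicate (mult j) (level j)) [1..<j + 1]) = take (q j) \<mu>"
proof (induction j)
  case 0
  then show ?case by (simp add: q_ends)
next
  case (Suc j)
  have qj: "q j < q (Suc j)" "q (Suc j) \<le> length \<mu>" using q_less[of j "Suc j"] q_le[of "Suc j"] Suc.prems by auto
  have "take (q (Suc j)) \<mu> = take (q j) \<mu> @ replicate (q (Suc j) - q j) (level (Suc j))"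
  proof (rule nth_equalityI)
    fix k assume "k < length (take (q (Suc j)) \<mu>)"
    then have k: "k < q (Suc j)" "k < length \<mu>" by auto
    show "take (q (Suc j)) \<mu> ! k = (take (q j) \<mu> @ replicate (q (Suc j) - q j) (level (Suc j))) ! k"
    proof (cases "k < q j")
      case False
      then have "part \<mu> (Suc k) = level (Suc j)" using part_block[of "Suc j" "Suc k"] k Suc.prems by simp
      then show ?thesis using False k qj by (simp add: nth_append part_def)
    qed (use k qj in \<open>simp add: nth_append\<close>)
  qed (use qj in simp)
  then show ?case using Suc by simp
qed

lemma \<mu>_concat: "\<mu> = concat (map (\<lambda>j. replicate (mult j) (level j)) [1..<u + 1])"
  using concat_blocks[of u] q_ends by simp

lemma sum_list_blocks: "(\<Sum>x\<leftarrow>\<mu>. f x) = (\<Sum>j\<in>{1..u}. mult j * f (level j))" for f :: "nat \<Rightarrow> nat"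
proof -
  have "(\<Sum>x\<leftarrow>concat (map (\<lambda>j. replicate (mult j) (level j)) js). f x) = (\<Sum>j\<leftarrow>js. mult j * f (level j))" for js
    by (induction js) (auto simp: sum_list_replicate)
  from this[of "[1..<u + 1]"] show ?thesis
    unfolding \<mu>_concat[symmetric] sum_list_distinct_conv_sum_set[OF distinct_upt] set_upt
    by (simp only: Suc_eq_plus1[symmetric] atLeastLessThanSuc_atLeastAtMost)
qed

lemma sum_mult: "j \<le> u \<Longrightarrow> (\<Sum>i\<in>{1..j}. mult i) = q j"
proof (induction j)
  case (Suc j)
  have "q j < q (Suc j)" using q_less[of j "Suc j"] Suc.prems by auto
  then show ?case using Suc by simp
qed (simp add: q_ends)

text \<open>The levels decrease strictly, so at most two of them lie in \<open>{s, s + 1}\<close>,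
  and these directly follow the \<open>j\<close> levels above \<open>s + 1\<close>.\<close>

lemma config_term_blocks:
  assumes "j \<le> u" and big: "\<And>i. \<lbrakk>1 \<le> i; i \<le> j\<rbrakk> \<Longrightarrow> s + 1 < level i"
    and small: "\<And>i. \<lbrakk>j < i; i \<le> u\<rbrakk> \<Longrightarrow> level i \<le> s + 1"
  shows "config_term \<mu> 0 s = 2 * q j +
    (if j + 1 \<le> u \<and> s \<le> level (j + 1) then mult (j + 1) * level (j + 1) +
       (if j + 2 \<le> u \<and> s \<le> level (j + 2) then mult (j + 2) * level (j + 2) else 0) else 0)"
proof -
  define t where "t i = mult i * level_term (level i) 0 s" for i
  have "config_term \<mu> 0 s = (\<Sum>i\<in>{1..u}. t i)"
    unfolding config_term_def sum_list_blocks t_def ..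
  also have "{1..u} = {1..j} \<union> ({j + 1..u} \<inter> {j + 1, j + 2}) \<union> {j + 3..u}" using assms(1) by auto
  also have "(\<Sum>i\<in>\<dots>. t i) = (\<Sum>i\<in>{1..j}. t i) + (\<Sum>i\<in>{j + 1..u} \<inter> {j + 1, j + 2}. t i) + (\<Sum>i\<in>{j + 3..u}. t i)"
    by (subst sum.union_disjoint; (subst sum.union_disjoint)?) auto
  also have "(\<Sum>i\<in>{1..j}. t i) = (\<Sum>i\<in>{1..j}. 2 * mult i)"
    using big by (intro sum.cong refl) (force simp: t_def level_term_def)
  also have "\<dots> = 2 * q j" using sum_mult[OF assms(1)] by (simp add: sum_distrib_left[symmetric])
  also have "(\<Sum>i\<in>{j + 3..u}. t i) = 0"
  proof (rule sum.neutral, intro ballI)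
    fix i assume i: "i \<in> {j + 3..u}"
    then have "level i < level (j + 2)" "level (j + 2) < level (j + 1)" "level (j + 1) \<le> s + 1"
      using level_decreasing[of "j + 2" i] level_decreasing[of "j + 1" "j + 2"] small[of "j + 1"] by auto
    then have "level i < s" by linarith
    then show "t i = 0" by (simp add: t_def level_term_def)
  qed
  also have "(\<Sum>i\<in>{j + 1..u} \<inter> {j + 1, j + 2}. t i) =
    (if j + 1 \<le> u then t (j + 1) else 0) + (if j + 2 \<le> u then t (j + 2) else 0)"
    by (cases "j + 2 \<le> u"; cases "j + 1 \<le> u") (auto simp: Int_insert_right)
  finally have eq: "config_term \<mu> 0 s = 2 * q j + ((if j + 1 \<le> u then t (j + 1) else 0) + (if j + 2 \<le> u then t (j + 2) else 0))"
    by simp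
  have t: "t i = (if s \<le> level i then mult i * level i else 0)" if "j < i" "i \<le> u" for i
    using small[OF that] by (auto simp: t_def level_term_def)
  show ?thesis
  proof (cases "j + 2 \<le> u")
    case True
    have "level (j + 2) < level (j + 1)" using level_decreasing[of "j + 1" "j + 2"] True by simp
    then show ?thesis using eq t[of "j + 1"] t[of "j + 2"] True by auto
  next
    case False
    then show ?thesis using eq t[of "j + 1"] by auto
  qed
qed

lemma finite_admissible: "finite (admissible \<mu> u q)"
  by (rule finite_subset[of _ "{1..u} \<times> {0, 1}"]) (auto simp: admissible_def)

lemma pair_weight_le: "(i, \<epsilon>) \<in> admissible \<mu> u q \<Longrightarrow> pair_weight \<mu> q i \<epsilon> \<le> omega1 \<mu> u q"
  unfolding omega1_def using finite_admissible by (intro Max_ge) force+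

lemma admissible_zero: "1 \<le> i \<Longrightarrow> i \<le> u \<Longrightarrow> (i, 0) \<in> admissible \<mu> u q"
  by (simp add: admissible_def)

lemma config_term_le_omega1: "config_term \<mu> 0 s \<le> omega1 \<mu> u q"
proof -
  define j where "j = Max {j. j \<le> u \<and> (\<forall>i\<in>{1..j}. s + 1 < level i)}"
  have "j \<in> {j. j \<le> u \<and> (\<forall>i\<in>{1..j}. s + 1 < level i)}" unfolding j_def
    by (rule Max_in) (auto intro: exI[of _ 0])
  then have j: "j \<le> u" "\<And>i. \<lbrakk>1 \<le> i; i \<le> j\<rbrakk> \<Longrightarrow> s + 1 < level i" by auto
  have small: "level i \<le> s + 1" if i: "j < i" "i \<le> u" for i
  proof (rule ccontr)
    assume "\<not> ?thesis"
    then have "\<forall>l\<in>{1..i}. s + 1 < level l"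
      using level_decreasing[of _ i] i by (metis atLeastAtMost_iff le_neq_implies_less less_trans not_le)
    then have "i \<le> j" unfolding j_def using i by (intro Max_ge) auto
    then show False using i by simp
  qed
  note W = config_term_blocks[OF j small]
  consider (a) "j + 1 \<le> u" "s \<le> level (j + 1)" "j + 2 \<le> u" "s \<le> level (j + 2)"
    | (b) "j + 1 \<le> u" "s \<le> level (j + 1)" "\<not> (j + 2 \<le> u \<and> s \<le> level (j + 2))"
    | (c) "\<not> (j + 1 \<le> u \<and> s \<le> level (j + 1))" by blast
  then show ?thesis
  proof cases
    case a
    then have "(j + 1, 1) \<in> admissible \<mu> u q" using small[of "j + 1"] by (auto simp: admissible_def)
    then have "pair_weight \<mu> q (j + 1) 1 \<le> omega1 \<mu> u q" by (rule pair_weight_le)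
    then show ?thesis using W a by (simp add: pair_weight_def mult.commute)
  next
    case b
    then have "pair_weight \<mu> q (j + 1) 0 \<le> omega1 \<mu> u q" by (intro pair_weight_le admissible_zero) auto
    moreover have "config_term \<mu> 0 s = 2 * q j + mult (j + 1) * level (j + 1)"
      using W b(1,2) unfolding if_not_P[OF b(3)] by simp
    ultimately show ?thesis by (simp add: pair_weight_def mult.commute)
  next
    case c
    \<comment> \<open>No part equals \<open>s\<close> or \<open>s + 1\<close>. The pair
      \<open>(j, 0)\<close> then does at least as well, because the parts of block \<open>j\<close>
      are at least 2.\<close>
    have W': "config_term \<mu> 0 s = 2 * q j" using W unfolding if_not_P[OF c] by simp
    show ?thesis
    proof (cases "j = 0")
      case False
      then have "pair_weight \<mu> q j 0 \<le> omega1 \<mu> u q" using j(1) by (intro pair_weight_le admissible_zero) auto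
      moreover have "2 * mult j \<le> level j * mult j" using j(2)[of j] False by (intro mult_right_mono) auto
      moreover have "q (j - 1) < q j" using q_less[of "j - 1" j] False j(1) by simp
      ultimately show ?thesis unfolding W' pair_weight_def mult_0 add_0_right by linarith
    qed (simp add: W' q_ends)
  qed
qed

text \<open>The admissible pair corresponds to the path with entry \<open>level i - 1\<close>, whose
  orders are \<open>level i\<close> and the one just below it. If the latter occurs, it is
  \<open>level (i + 1)\<close>, and \<open>\<epsilon>\<close> records whether it does.\<close>

lemma maximal_pair:
  assumes adm: "(i, \<epsilon>) \<in> admissible \<mu> u q" and max: "pair_weight \<mu> q i \<epsilon> = omega1 \<mu> u q"
  shows "config_term \<mu> 0 (level i - 1) = omega1 \<mu> u q" and "0 < omega1 \<mu> u q"
    and "hat \<mu> u q i \<epsilon> = filter (\<lambda>x. 0 < x) (remove_pair (level i - 1) \<mu>)"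
proof -
  have i: "1 \<le> i" "i \<le> u" and \<epsilon>: "\<epsilon> = 0 \<or> \<epsilon> = 1 \<and> i + 1 \<le> u \<and> level i \<le> level (i + 1) + 1"
    using adm by (auto simp: admissible_def)
  define s where "s = level i - 1"
  have lev: "level i = s + 1" using pos[OF level_in[OF i]] by (simp add: s_def)
  have mult_pos: "q (j - 1) < q j" if "1 \<le> j" "j \<le> u" for j using q_less[of "j - 1" j] that by simp
  have \<epsilon>': "\<epsilon> = (if i + 1 \<le> u \<and> s \<le> level (i + 1) then 1 else 0)"
  proof (cases "i + 1 \<le> u \<and> s \<le> level (i + 1)")
    case True
    \<comment> \<open>If the second order occurs, including it is admissible and strictly increases
      the weight, so maximality forces \<open>\<epsilon> = 1\<close>.\<close>
    have "\<epsilon> \<noteq> 0"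
    proof
      assume "\<epsilon> = 0"
      have "(i, 1) \<in> admissible \<mu> u q" using True i lev by (auto simp: admissible_def)
      then have "pair_weight \<mu> q i 1 \<le> pair_weight \<mu> q i 0" using pair_weight_le max \<open>\<epsilon> = 0\<close> by simp
      then show False using mult_pos[of "i + 1"] pos[OF level_in[of "i + 1"]] True by (simp add: pair_weight_def)
    qed
    then show ?thesis using \<epsilon> True by simp
  next
    case False
    then show ?thesis using \<epsilon> lev by auto
  qed
  have big: "s + 1 < level j" if "1 \<le> j" "j \<le> i - 1" for j
    using level_decreasing[of j i] that i lev by simp
  have small: "level j \<le> s + 1" if "i - 1 < j" "j \<le> u" for j
  proof (cases "i = j")
    case False
    then show ?thesis using level_decreasing[of i j] that i lev by linarith
  qed (use lev in simp)
  have "config_term \<mu> 0 s = 2 * q (i - 1) + (mult i * level i +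
       (if i + 1 \<le> u \<and> s \<le> level (i + 1) then mult (i + 1) * level (i + 1) else 0))"
    using config_term_blocks[of "i - 1" s] big small i lev by simp
  also have "\<dots> = pair_weight \<mu> q i \<epsilon>" unfolding \<epsilon>' by (auto simp: pair_weight_def mult.commute)
  finally show "config_term \<mu> 0 (level i - 1) = omega1 \<mu> u q" using max by (simp add: s_def)
  have "0 < pair_weight \<mu> q i \<epsilon>" using mult_pos[OF i] lev by (simp add: pair_weight_def)
  then show "0 < omega1 \<mu> u q" using max by simp
  consider (one) "\<epsilon> = 0" "\<not> (i + 1 \<le> u \<and> s \<le> level (i + 1))" | (two) "\<epsilon> = 1" "i + 1 \<le> u" "s \<le> level (i + 1)"
    using \<epsilon>' by presburger
  note cases = this
  have small': "level j < s" if "i + \<epsilon> + 1 \<le> j" "j \<le> u" for j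
    using cases
  proof cases
    case one
    then have "level (i + 1) < s" using that by simp
    moreover have "level j < level (i + 1)" if "i + 1 < j" using level_decreasing[of "i + 1" j] that \<open>j \<le> u\<close> by simp
    ultimately show ?thesis using that(1) one(1) by (cases "j = i + 1") force+
  next
    case two
    have "level j < level (i + 1)" using level_decreasing[of "i + 1" j] two(1) that by simp
    moreover have "level (i + 1) \<le> s + 1" using small[of "i + 1"] two(2) by simp
    moreover have "level (i + 1) < level i" using level_decreasing[of i "i + 1"] two(2) i by simp
    ultimately show ?thesis using lev by linarith
  qed
  have middle: "s \<le> level j" "level j \<le> s + 1" if "i \<le> j" "j \<le> i + \<epsilon>" for j
  proof -
    have "j = i \<or> j = i + 1 \<and> i + 1 \<le> u \<and> s \<le> level (i + 1)" using cases that by cases auto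
    then show "s \<le> level j" "level j \<le> s + 1" using lev small[of "i + 1"] by auto
  qed
  define blk where "blk js = concat (map (\<lambda>j. replicate (mult j) (level j)) js)" for js
  have rp_append: "remove_pair s (xs @ ys) = remove_pair s xs @ remove_pair s ys" for xs ys
    by (simp add: remove_pair_def)
  have rp_blk: "remove_pair s (blk js) = concat (map (\<lambda>j. remove_pair s (replicate (mult j) (level j))) js)" for js
  proof (induction js)
    case Nil
    then show ?case by (simp add: blk_def remove_pair_def)
  next
    case (Cons j js)
    then show ?case by (simp add: blk_def rp_append)
  qed
  have ie: "i + \<epsilon> \<le> u" using \<epsilon> i by auto
  have split: "[a..<c] = [a..<b] @ [b..<c]" if "a \<le> b" "b \<le> c" for a b c
    using upt_add_eq_append[OF that(1), of "c - b"] that by simp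
  have "[1..<u + 1] = [1..<i] @ [i..<i + \<epsilon> + 1] @ [i + \<epsilon> + 1..<u + 1]"
    using i ie split[of 1 i "u + 1"] split[of i "i + \<epsilon> + 1" "u + 1"] by simp
  then have "\<mu> = blk [1..<i] @ blk [i..<i + \<epsilon> + 1] @ blk [i + \<epsilon> + 1..<u + 1]"
    using \<mu>_concat by (simp add: blk_def)
  then have "remove_pair s \<mu> = remove_pair s (blk [1..<i]) @ remove_pair s (blk [i..<i + \<epsilon> + 1])
     @ remove_pair s (blk [i + \<epsilon> + 1..<u + 1])" by (metis rp_append)
  moreover have "remove_pair s (blk [1..<i]) = concat (map (\<lambda>j. replicate (mult j) (level j - 2)) [1..<i])"
  proof -
    have "remove_pair s (replicate (mult j) (level j)) = replicate (mult j) (level j - 2)" if "j \<in> set [1..<i]" for j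
    proof -
      have "s + 1 < level j" using big[of j] that by auto
      then show ?thesis by (simp add: remove_pair_def)
    qed
    then show ?thesis unfolding rp_blk by (intro arg_cong[of _ _ concat] map_cong refl)
  qed
  moreover have "remove_pair s (blk [i..<i + \<epsilon> + 1]) = []"
  proof -
    have "remove_pair s (replicate (mult j) (level j)) = []" if "j \<in> set [i..<i + \<epsilon> + 1]" for j
      using middle[of j] that by (auto simp: remove_pair_def filter_empty_conv)
    then show ?thesis unfolding rp_blk by simp
  qed
  moreover have "remove_pair s (blk [i + \<epsilon> + 1..<u + 1]) = blk [i + \<epsilon> + 1..<u + 1]"
  proof -
    have "remove_pair s (replicate (mult j) (level j)) = replicate (mult j) (level j)" if "j \<in> set [i + \<epsilon> + 1..<u + 1]" for j
    proof -
      have "level j < s" using small'[of j] that by auto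
      then show ?thesis by (simp add: remove_pair_def)
    qed
    then show ?thesis unfolding rp_blk unfolding blk_def by (intro arg_cong[of _ _ concat] map_cong refl)
  qed
  ultimately show "hat \<mu> u q i \<epsilon> = filter (\<lambda>x. 0 < x) (remove_pair (level i - 1) \<mu>)"
    by (simp add: hat_def blk_def s_def)
qed

end

lemma sorted_remove_pair:
  assumes "sorted_wrt (\<ge>) B"
  shows "sorted_wrt (\<ge>) (remove_pair \<sigma> B)"
proof -
  have "sorted_wrt (\<lambda>x y. y < \<sigma> \<or> \<sigma> + 1 < y \<longrightarrow> x < \<sigma> \<or> \<sigma> + 1 < x \<longrightarrow> (if y < \<sigma> then y else y - 2) \<le> (if x < \<sigma> then x else x - 2)) B"
    by (rule sorted_wrt_mono_rel[OF _ assms]) auto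
  then show ?thesis unfolding remove_pair_def sorted_wrt_map
    by (induction B) auto
qed

lemma level_weight_0: "level_weight ss 0 = 0"
proof (induction ss)
  case (Cons s ss)
  then show ?case by simp
qed simp

lemma config_weight_filter_pos: "config_weight (filter (\<lambda>x. 0 < x) B) ss = config_weight B ss"
  unfolding config_weight_def by (induction B) (auto simp: level_weight_0)

lemma max_rank_filter_pos: "max_rank (filter (\<lambda>x. 0 < x) B) = max_rank B"
  by (rule ext) (simp add: max_rank_def config_weight_filter_pos)

lemma excess_eq_0: "excess p m = 0 \<longleftrightarrow> (\<forall>x\<in>set p. x \<le> m)"
  by (simp add: excess_def)

theorem theorem1p2:
  fixes n u i \<epsilon> :: nat and \<mu> :: "nat list" and q :: "nat \<Rightarrow> nat"
  assumes "infinite (UNIV :: 'a :: field set)"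
    and "n \<ge> 1"
    and "is_partition n \<mu>"
    and "block_ends \<mu> u q"
    and "(i, \<epsilon>) \<in> admissible \<mu> u q"
    and "pair_weight \<mu> q i \<epsilon> = omega1 \<mu> u q"
  shows "is_max_partition TYPE('a) \<mu> (omega1 \<mu> u q # Q TYPE('a) (hat \<mu> u q i \<epsilon>))
    \<and> Q TYPE('a) \<mu> = omega1 \<mu> u q # Q TYPE('a) (hat \<mu> u q i \<epsilon>)"
proof -
  note inf = assms(1)
  have \<mu>: "sorted_wrt (\<ge>) \<mu>" "\<And>x. x \<in> set \<mu> \<Longrightarrow> 1 \<le> x" using assms(3) by (auto simp: is_partition_def)
  interpret partition_blocks \<mu> u q using \<mu> assms(4) by unfold_locales
  let ?w = "omega1 \<mu> u q" and ?h = "hat \<mu> u q i \<epsilon>" and ?\<sigma> = "part \<mu> (q i) - 1"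
  note mp = maximal_pair[OF assms(5,6)]
  have max: "\<And>s. config_term \<mu> 0 s \<le> config_term \<mu> 0 ?\<sigma>" using config_term_le_omega1 mp(1) by simp
  note rem = max_rank_remove_pair[OF max mp(1)[symmetric]]
  have h: "sorted_wrt (\<ge>) ?h" "\<And>x. x \<in> set ?h \<Longrightarrow> 1 \<le> x"
    unfolding mp(3) using sorted_wrt_filter[OF sorted_remove_pair[OF \<mu>(1)]] by auto
  obtain p where p: "is_max_partition TYPE('a) \<mu> p" "Q TYPE('a) \<mu> = p" "sorted_wrt (\<ge>) p" "0 \<notin> set p"
    "\<And>m. excess p m = max_rank \<mu> m" using ex_max_partition[OF inf \<mu>] by metis
  obtain p' where "is_max_partition TYPE('a) ?h p'" and p': "Q TYPE('a) ?h = p'" "sorted_wrt (\<ge>) p'" "0 \<notin> set p'"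
    "\<And>m. excess p' m = max_rank ?h m" using ex_max_partition[OF inf h] by metis
  have ex': "excess p' m = max_rank (remove_pair ?\<sigma> \<mu>) m" for m
    by (simp add: p'(4) mp(3) max_rank_filter_pos)
  have "\<forall>x\<in>set p'. x \<le> ?w" using ex'[of ?w] rem(2) excess_eq_0 by metis
  then have "sorted_wrt (\<ge>) (?w # p')" using p'(2) by simp
  moreover have "mset p = mset (?w # p')"
  proof (rule mset_eq_of_excess)
    show "excess p m = excess (?w # p') m" for m using p(5) rem(1)[of m] ex'[of m] by (simp add: excess_def)
  qed (use p(4) p'(3) mp(2) in auto)
  ultimately have "p = ?w # p'" using p(3) by (intro sorted_desc_unique)
  then show ?thesis using p(1,2) p'(1) by simp
qed

end
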